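(* Let $p$ be a prime, let $q=p^r$ with $r\ge 1$, and let $\mathbb{F}$ be an algebraically closed field of characteristic $p$. Let $C\subset\mathbb{P}^2(\mathbb{F})$ be the Drinfeld curve $XY^q-X^qY-Z^{q+1}=0$, equipped with its standard action of $G=SL_2(\mathbb{F}_q)$, and regard $H^0(C,\Omega_C)$ as a right $\mathbb{F}[G]$-module via pull-back of differentials. For $k\ge 0$ let $V^k=\mathrm{Sym}^k(\mathbb{F}^2)$ be the $k$-th symmetric power of the standard right $\mathbb{F}[G]$-module $\mathbb{F}^2$ of row vectors. Then there is an isomorphism of right $\mathbb{F}[G]$-modules $$H^0(C,\Omega_C)\;\cong\;\bigoplus_{k=0}^{q-2}V^k,$$ and each $V^k$ with $0\le k\le q-2$ is an indecomposable $\mathbb{F}[G]$-module. In particular, the $\mathbb{F}[G]$-module $H^0(C,\Omega_C)$ is semi-simple if and only if $q=p$.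
   Context: $\mathbb{F}_q$ is viewed as the unique subfield of $\mathbb{F}$ with $q$ elements. The Drinfeld curve $C$ is the zero locus in $\mathbb{P}^2(\mathbb{F})$ of $XY^q-X^qY-Z^{q+1}$; it is a smooth irreducible projective curve of genus $q(q-1)/2$. The group $G=SL_2(\mathbb{F}_q)$ acts on $C$ from the left by $$g\cdot[x:y:z]=[\alpha x+\beta y:\gamma x+\delta y:z]\quad\text{for } g=\begin{pmatrix}\alpha&\beta\\ \gamma&\delta\end{pmatrix}\in G,\ [x:y:z]\in C.$$ $H^0(C,\Omega_C)$ is the $\mathbb{F}$-vector space of (global) holomorphic differentials on $C$; pulling back differentials, $\omega\mapsto g^*(\omega)$, defines a right $\mathbb{F}$-linear action of $G$ on it. The elements of $\mathbb{F}^2$ are viewed as row vectors, on which $G$ acts from the right by matrix multiplication, and $V^k=\mathrm{Sym}^k(\mathbb{F}^2)$ carries the induced right $G$-action. *)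

theory Defs
  imports
    "HOL-Analysis.Determinants"
    "HOL-Algebra.Algebraic_Closure_Type"
    "HOL-Library.Poly_Mapping"
    "HOL-Library.Function_Algebras"
begin

section \<open>Right modules over a group algebra\<close>

text \<open>
  A right module over the group algebra of \<open>G\<close> over the field \<open>'a\<close> is an \<open>'a\<close>-vector space
  with a linear right action of \<open>G\<close>. Addition is that of the type \<open>'v\<close>; the underlying
  vector space is a subspace, the carrier, of \<open>'v\<close>.
\<close>

record ('a, 'v, 'g) fg_module = "'v partial_object" +
  scale :: "'a \<Rightarrow> 'v \<Rightarrow> 'v"
  act :: "'v \<Rightarrow> 'g \<Rightarrow> 'v"

definition right_FG_module ::
  "('g, 'x) monoid_scheme \<Rightarrow> ('a::field, 'v::ab_group_add, 'g) fg_module \<Rightarrow> bool" where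
  "right_FG_module G M \<longleftrightarrow>
     group G \<and> vector_space (scale M) \<and> Modules.module.subspace (scale M) (carrier M) \<and>
     (\<forall>g\<in>carrier G. \<forall>u\<in>carrier M. act M u g \<in> carrier M) \<and>
     (\<forall>g\<in>carrier G. \<forall>u\<in>carrier M. \<forall>v\<in>carrier M. act M (u + v) g = act M u g + act M v g) \<and>
     (\<forall>g\<in>carrier G. \<forall>c. \<forall>u\<in>carrier M. act M (scale M c u) g = scale M c (act M u g)) \<and>
     (\<forall>u\<in>carrier M. act M u \<one>\<^bsub>G\<^esub> = u) \<and>
     (\<forall>g\<in>carrier G. \<forall>h\<in>carrier G. \<forall>u\<in>carrier M.
        act M u (g \<otimes>\<^bsub>G\<^esub> h) = act M (act M u g) h)"

definition FG_submodule ::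
  "('g, 'x) monoid_scheme \<Rightarrow> ('a::field, 'v::ab_group_add, 'g) fg_module \<Rightarrow> 'v set \<Rightarrow> bool" where
  "FG_submodule G M W \<longleftrightarrow>
     W \<subseteq> carrier M \<and> Modules.module.subspace (scale M) W \<and>
     (\<forall>g\<in>carrier G. \<forall>w\<in>W. act M w g \<in> W)"

definition FG_isomorphic ::
  "('g, 'x) monoid_scheme \<Rightarrow> ('a::field, 'v::ab_group_add, 'g) fg_module \<Rightarrow>
   ('a, 'w::ab_group_add, 'g) fg_module \<Rightarrow> bool" where
  "FG_isomorphic G M N \<longleftrightarrow>
     right_FG_module G M \<and> right_FG_module G N \<and>
     (\<exists>f. bij_betw f (carrier M) (carrier N) \<and>
        (\<forall>u\<in>carrier M. \<forall>v\<in>carrier M. f (u + v) = f u + f v) \<and>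
        (\<forall>c. \<forall>u\<in>carrier M. f (scale M c u) = scale N c (f u)) \<and>
        (\<forall>g\<in>carrier G. \<forall>u\<in>carrier M. f (act M u g) = act N (f u) g))"

definition FG_indecomposable ::
  "('g, 'x) monoid_scheme \<Rightarrow> ('a::field, 'v::ab_group_add, 'g) fg_module \<Rightarrow> bool" where
  "FG_indecomposable G M \<longleftrightarrow>
     right_FG_module G M \<and> carrier M \<noteq> {0} \<and>
     (\<forall>U W. FG_submodule G M U \<and> FG_submodule G M W \<and>
        U \<inter> W = {0} \<and> {u + w | u w. u \<in> U \<and> w \<in> W} = carrier M \<longrightarrow> U = {0} \<or> W = {0})"

definition simple_FG_submodule ::
  "('g, 'x) monoid_scheme \<Rightarrow> ('a::field, 'v::ab_group_add, 'g) fg_module \<Rightarrow> 'v set \<Rightarrow> bool" where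
  "simple_FG_submodule G M W \<longleftrightarrow>
     FG_submodule G M W \<and> W \<noteq> {0} \<and>
     (\<forall>U. FG_submodule G M U \<and> U \<subseteq> W \<longrightarrow> U = {0} \<or> U = W)"

text \<open>Semi-simple means being the sum of the simple submodules.\<close>

definition FG_semisimple ::
  "('g, 'x) monoid_scheme \<Rightarrow> ('a::field, 'v::ab_group_add, 'g) fg_module \<Rightarrow> bool" where
  "FG_semisimple G M \<longleftrightarrow>
     right_FG_module G M \<and>
     carrier M = Modules.module.span (scale M) (\<Union>{W. simple_FG_submodule G M W})"

definition FG_direct_sum ::
  "'i set \<Rightarrow> ('i \<Rightarrow> ('a::field, 'v::ab_group_add, 'g) fg_module) \<Rightarrow>
   ('a, 'i \<Rightarrow> 'v, 'g) fg_module" where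
  "FG_direct_sum I M =
     \<lparr> carrier = {u. (\<forall>i\<in>I. u i \<in> carrier (M i)) \<and> (\<forall>i. i \<notin> I \<longrightarrow> u i = 0) \<and>
                    finite {i. u i \<noteq> 0}},
       scale = (\<lambda>c u i. scale (M i) c (u i)),
       act = (\<lambda>u g i. if i \<in> I then act (M i) (u i) g else 0) \<rparr>"


section \<open>The group \<open>SL\<^sub>2\<close> over a subfield\<close>

definition SL2 :: "'a::field set \<Rightarrow> ('a^2^2) monoid" where
  "SL2 K = \<lparr> carrier = {g. (\<forall>i j. g $ i $ j \<in> K) \<and> det g = 1}, mult = (**), one = mat 1 \<rparr>"


section \<open>Symmetric powers of row vectors\<close>

text \<open>
  The symmetric algebra of the space of row vectors \<open>'a^'n\<close> is the polynomial ring over \<open>'a\<close> in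
  the standard basis vectors, represented as finitely supported functions from exponents to
  coefficients; \<open>sym_lin\<close> is the embedding of \<open>'a^'n\<close> as the space of linear forms. A matrix
  \<open>A\<close> acts by the algebra endomorphism which extends \<open>v \<mapsto> v A\<close>, that is, which replaces each
  basis vector by its image; see \<open>sym_act_prod_lin\<close> below.
\<close>

type_synonym ('a, 'n) sym_algebra = "('n \<Rightarrow>\<^sub>0 nat) \<Rightarrow>\<^sub>0 'a"

definition sym_scale :: "'a::field \<Rightarrow> ('a, 'n::finite) sym_algebra \<Rightarrow> ('a, 'n) sym_algebra" where
  "sym_scale c p = Poly_Mapping.single 0 c * p"

definition sym_lin :: "'a::field^'n \<Rightarrow> ('a, 'n::finite) sym_algebra" where
  "sym_lin v = (\<Sum>i\<in>UNIV. Poly_Mapping.single (Poly_Mapping.single i 1) (v $ i))"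

definition sym_act ::
  "('a::field, 'n::finite) sym_algebra \<Rightarrow> 'a^'n^'n \<Rightarrow> ('a, 'n) sym_algebra" where
  "sym_act p A =
     (\<Sum>m\<in>Poly_Mapping.keys p. sym_scale (Poly_Mapping.lookup p m)
        (\<Prod>i\<in>UNIV. sym_lin (axis i 1 v* A) ^ Poly_Mapping.lookup m i))"

lemma sym_act_prod_lin:
  "sym_act (\<Prod>i\<in>I. sym_lin (v i)) A = (\<Prod>i\<in>I. sym_lin (v i v* A))"
  for v :: "'i \<Rightarrow> 'a::field^'n::finite"
proof -
  define M where "M = (\<lambda>m::'n \<Rightarrow>\<^sub>0 nat. \<Prod>i\<in>UNIV. sym_lin (axis i 1 v* A) ^ Poly_Mapping.lookup m i)"
  have act: "sym_act p A = (\<Sum>m\<in>F. sym_scale (Poly_Mapping.lookup p m) (M m))"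
    if "finite F" "Poly_Mapping.keys p \<subseteq> F" for p F
    unfolding sym_act_def M_def using that
    by (intro sum.mono_neutral_left) (auto simp: in_keys_iff sym_scale_def)
  have scale_add: "sym_scale (c + d) x = sym_scale c x + sym_scale d x"
    for c d and x :: "('a, 'n) sym_algebra"
    by (simp add: sym_scale_def single_add distrib_right)
  have scale_mult: "sym_scale (c * d) (x * y) = sym_scale c x * sym_scale d y"
    for c d and x y :: "('a, 'n) sym_algebra"
  proof -
    have "Poly_Mapping.single 0 (c * d) =
        Poly_Mapping.single 0 c * (Poly_Mapping.single 0 d :: ('a, 'n) sym_algebra)"
      by (simp add: mult_single)
    then show ?thesis by (simp add: sym_scale_def mult_ac)
  qed
  have add: "sym_act (p + q) A = sym_act p A + sym_act q A" for p q
  proof -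
    let ?F = "Poly_Mapping.keys p \<union> Poly_Mapping.keys q"
    have "Poly_Mapping.keys (p + q) \<subseteq> ?F" by (rule Poly_Mapping.keys_add)
    then show ?thesis
      by (simp add: act[of ?F] lookup_add scale_add sum.distrib)
  qed
  have sum: "sym_act (sum f S) A = (\<Sum>s\<in>S. sym_act (f s) A)" for f and S :: "'s set"
  proof (induction S rule: infinite_finite_induct)
    case (insert x F)
    then show ?case by (simp add: add)
  qed (simp_all add: sym_act_def)
  have single_sum: "Poly_Mapping.single m (sum f S) = (\<Sum>s\<in>S. Poly_Mapping.single m (f s))"
    for m :: "'n \<Rightarrow>\<^sub>0 nat" and f :: "'s \<Rightarrow> 'a" and S
    by (induction S rule: infinite_finite_induct) (simp_all add: single_add)
  have single: "sym_act (Poly_Mapping.single m c) A = sym_scale c (M m)" for m c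
    by (subst act[of "{m}"]) auto
  have M_add: "M (m + n) = M m * M n" for m n
    by (simp add: M_def lookup_add power_add prod.distrib)
  have rep: "p = (\<Sum>m\<in>Poly_Mapping.keys p. Poly_Mapping.single m (Poly_Mapping.lookup p m))"
    for p :: "('a, 'n) sym_algebra"
    by (rule poly_mapping_eqI)
      (auto simp: lookup_sum lookup_single when_def in_keys_iff)
  have mult: "sym_act (p * q) A = sym_act p A * sym_act q A" for p q
  proof -
    have "p * q = (\<Sum>m\<in>Poly_Mapping.keys p. Poly_Mapping.single m (Poly_Mapping.lookup p m)) *
        (\<Sum>n\<in>Poly_Mapping.keys q. Poly_Mapping.single n (Poly_Mapping.lookup q n))"
      by (simp only: rep[symmetric])
    then have "sym_act (p * q) A = (\<Sum>m\<in>Poly_Mapping.keys p. \<Sum>n\<in>Poly_Mapping.keys q.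
        sym_scale (Poly_Mapping.lookup p m * Poly_Mapping.lookup q n) (M m * M n))"
      by (simp only: sum_product mult_single sum single M_add)
    also have "\<dots> = sym_act p A * sym_act q A"
      unfolding sym_act_def sum_product
      by (simp only: scale_mult M_def)
    finally show ?thesis .
  qed
  have one: "sym_act 1 A = 1"
    using single[of 0 1] by (simp add: M_def sym_scale_def)
  have lin: "sym_act (sym_lin w) A = sym_lin (w v* A)" for w :: "'a^'n"
  proof -
    have M1: "M (Poly_Mapping.single i 1) = sym_lin (axis i 1 v* A)" for i
    proof -
      have "M (Poly_Mapping.single i 1) = (\<Prod>j\<in>UNIV. if j = i then sym_lin (axis i 1 v* A) else 1)"
        unfolding M_def by (intro prod.cong) (auto simp: lookup_single when_def)
      then show ?thesis by simp
    qed
    have "sym_act (sym_lin w) A = (\<Sum>i\<in>UNIV. sym_scale (w $ i) (sym_lin (axis i 1 v* A)))"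
      unfolding sym_lin_def[of w] sum single M1 ..
    also have "\<dots> = (\<Sum>j\<in>UNIV. \<Sum>i\<in>UNIV.
        Poly_Mapping.single (Poly_Mapping.single j 1) (w $ i * A $ i $ j))"
      unfolding sym_lin_def sym_scale_def sum_distrib_left mult_single
      by (subst sum.swap)
        (simp add: vector_matrix_mult_def axis_def if_distrib if_distribR cong: if_cong)
    also have "\<dots> = sym_lin (w v* A)"
      unfolding sym_lin_def vector_matrix_mult_def by (simp add: single_sum mult.commute)
    finally show ?thesis .
  qed
  show ?thesis
    by (induction I rule: infinite_finite_induct) (simp_all add: one mult lin)
qed

definition Sym_power :: "nat \<Rightarrow> ('a::field, ('a, 'n::finite) sym_algebra, 'a^'n^'n) fg_module" where
  "Sym_power k =
     \<lparr> carrier = {p. \<forall>m\<in>Poly_Mapping.keys p. (\<Sum>i\<in>UNIV. Poly_Mapping.lookup m i) = k},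
       scale = sym_scale,
       act = sym_act \<rparr>"


section \<open>Regular functions and differential forms on projective plane curves\<close>

text \<open>A point of the projective plane is the set of all its homogeneous coordinate vectors.\<close>

type_synonym 'a point = "('a^3) set"

definition proj_plane :: "'a::field point set" where
  "proj_plane = {{c *s v | c. c \<noteq> 0} | v. v \<noteq> 0}"

definition homogeneous :: "nat \<Rightarrow> ('a::field^3 \<Rightarrow> 'a) set" where
  "homogeneous d =
     {A. \<exists>a. \<forall>v. A v = (\<Sum>i\<le>d. \<Sum>j\<le>d - i. a i j * (v$1)^i * (v$2)^j * (v$3)^(d - i - j))}"

definition zariski_open :: "'a::field point set \<Rightarrow> 'a point set \<Rightarrow> bool" where
  "zariski_open V U \<longleftrightarrow>
     (\<exists>S \<subseteq> (\<Union>d. homogeneous d). U = {P\<in>V. \<exists>A\<in>S. \<forall>v\<in>P. A v \<noteq> 0})"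

text \<open>
  A function on an open neighbourhood of \<open>P\<close> is represented by a total function, whose values
  outside the neighbourhood are irrelevant.
\<close>

definition regular_at :: "'a::field point set \<Rightarrow> ('a point \<Rightarrow> 'a) \<Rightarrow> 'a point \<Rightarrow> bool" where
  "regular_at V f P \<longleftrightarrow>
     (\<exists>U. zariski_open V U \<and> P \<in> U \<and>
        (\<exists>d. \<exists>A\<in>homogeneous d. \<exists>B\<in>homogeneous d.
           \<forall>Q\<in>U. \<forall>v\<in>Q. B v \<noteq> 0 \<and> f Q = A v / B v))"

text \<open>
  Tangent vectors at \<open>P\<close> are the \<open>'a\<close>-linear derivations from the local ring at \<open>P\<close> to its
  residue field \<open>'a\<close>. They are given on functions regular at \<open>P\<close>, have to depend only on the
  germ, and are extended by \<open>0\<close> to all other functions.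
\<close>

definition tangent_space :: "'a::field point set \<Rightarrow> 'a point \<Rightarrow> (('a point \<Rightarrow> 'a) \<Rightarrow> 'a) set" where
  "tangent_space V P =
     {D. (\<forall>f h. regular_at V f P \<and> regular_at V h P \<longrightarrow>
            D (\<lambda>Q. f Q + h Q) = D f + D h \<and>
            D (\<lambda>Q. f Q * h Q) = f P * D h + h P * D f) \<and>
         (\<forall>c f. regular_at V f P \<longrightarrow> D (\<lambda>Q. c * f Q) = c * D f) \<and>
         (\<forall>f h U. regular_at V f P \<and> regular_at V h P \<and> zariski_open V U \<and> P \<in> U \<and>
            (\<forall>Q\<in>U. f Q = h Q) \<longrightarrow> D f = D h) \<and>
         (\<forall>f. \<not> regular_at V f P \<longrightarrow> D f = 0)}"

text \<open>
  The differential of \<open>f\<close> at \<open>Q\<close> is the cotangent vector \<open>D \<mapsto> D f\<close>. A holomorphic differential on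
  a smooth variety \<open>V\<close> assigns to each point a cotangent vector and is locally of the form
  \<open>\<Sum>\<^sub>i f\<^sub>i dh\<^sub>i\<close> with regular functions \<open>f\<^sub>i\<close> and \<open>h\<^sub>i\<close>. The values where \<open>P\<close> is not a point of \<open>V\<close>
  or \<open>D\<close> is not a tangent vector at \<open>P\<close> are fixed to be \<open>0\<close>.
\<close>

type_synonym 'a diff_form = "'a point \<Rightarrow> (('a point \<Rightarrow> 'a) \<Rightarrow> 'a) \<Rightarrow> 'a"

definition holomorphic_differentials :: "'a::field point set \<Rightarrow> 'a diff_form set" where
  "holomorphic_differentials V =
     {\<omega>. (\<forall>P D. \<not> (P \<in> V \<and> D \<in> tangent_space V P) \<longrightarrow> \<omega> P D = 0) \<and>
         (\<forall>P\<in>V. \<exists>U. zariski_open V U \<and> P \<in> U \<and>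
            (\<exists>(n::nat) f h. (\<forall>i<n. \<forall>Q\<in>U. regular_at V (f i) Q \<and> regular_at V (h i) Q) \<and>
               (\<forall>Q\<in>U. \<forall>D\<in>tangent_space V Q. \<omega> Q D = (\<Sum>i<n. f i Q * D (h i)))))}"

text \<open>The tangent map at \<open>P\<close> of a morphism \<open>\<phi>\<close> to \<open>Y\<close>, and the pull-back of differentials.\<close>

definition tangent_map ::
  "'a::field point set \<Rightarrow> ('a point \<Rightarrow> 'a point) \<Rightarrow> 'a point \<Rightarrow>
   (('a point \<Rightarrow> 'a) \<Rightarrow> 'a) \<Rightarrow> ('a point \<Rightarrow> 'a) \<Rightarrow> 'a" where
  "tangent_map Y \<phi> P D = (\<lambda>f. if regular_at Y f (\<phi> P) then D (f \<circ> \<phi>) else 0)"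

definition pullback ::
  "'a::field point set \<Rightarrow> 'a point set \<Rightarrow> ('a point \<Rightarrow> 'a point) \<Rightarrow> 'a diff_form \<Rightarrow> 'a diff_form" where
  "pullback V Y \<phi> \<omega> =
     (\<lambda>P D. if P \<in> V \<and> D \<in> tangent_space V P then \<omega> (\<phi> P) (tangent_map Y \<phi> P D) else 0)"


section \<open>The Drinfeld curve\<close>

definition drinfeld_curve :: "nat \<Rightarrow> 'a::field point set" where
  "drinfeld_curve q =
     {P\<in>proj_plane. \<forall>v\<in>P. v$1 * (v$2)^q - (v$1)^q * v$2 - (v$3)^(q + 1) = 0}"

definition point_act :: "'a::field^2^2 \<Rightarrow> 'a point \<Rightarrow> 'a point" where
  "point_act g P =
     (\<lambda>v. vector [g$1$1 * v$1 + g$1$2 * v$2, g$2$1 * v$1 + g$2$2 * v$2, v$3]) ` P"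

definition H0_drinfeld :: "nat \<Rightarrow> ('a::field, 'a diff_form, 'a^2^2) fg_module" where
  "H0_drinfeld q =
     \<lparr> carrier = holomorphic_differentials (drinfeld_curve q),
       scale = (\<lambda>c \<omega> P D. c * \<omega> P D),
       act = (\<lambda>\<omega> g. pullback (drinfeld_curve q) (drinfeld_curve q) (point_act g) \<omega>) \<rparr>"

end

theory Submission
  imports Defs
begin

text \<open>
  On the chart \<open>Y \<noteq> 0\<close> with coordinates \<open>x = X/Y\<close>, \<open>z = Z/Y\<close> the curve is
  \<open>z\<^sup>q\<^sup>+\<^sup>1 = x - x\<^sup>q\<close>, so that \<open>dx = z\<^sup>q dz\<close> and \<open>dz\<close> generates the differentials. The chart is a
  cyclic cover of the \<open>x\<close>-line, and its regular functions are uniquely of the form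
  \<open>\<Sum>\<^sub>i\<^sub>\<le>\<^sub>q a\<^sub>i(x) z\<^sup>i\<close>. Comparing a global form \<open>\<Sum>\<^sub>i a\<^sub>i(x) z\<^sup>i dz\<close> with its pull-back under the Weyl element,
  which exchanges the two charts, gives \<open>deg a\<^sub>i + i \<le> q - 2\<close>. Hence the holomorphic forms are
  \<open>A/Y\<^sup>q\<^sup>-\<^sup>2 dz\<close> with \<open>A\<close> homogeneous of degree \<open>q - 2\<close>, and collecting the powers of the invariant
  coordinate \<open>Z\<close> in \<open>A\<close> yields the sum of the \<open>V\<^sup>k\<close>. Every non-zero submodule of \<open>V\<^sup>k\<close> contains \<open>y\<^sup>k\<close>,
  so \<open>V\<^sup>k\<close> is indecomposable. For \<open>q = p\<close> the translates of \<open>y\<^sup>k\<close> span \<open>V\<^sup>k\<close>, which is therefore simple;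
  for \<open>q > p\<close> the socle of \<open>V\<^sup>p\<close> lies in the span of the \<open>p\<close>-th powers \<open>x\<^sup>p\<close>, \<open>y\<^sup>p\<close>.
\<close>

section \<open>Bivariate polynomials\<close>

text \<open>Forms are families of functions on tangent vectors, so the argument runs on values: at
  each chart point one explicit derivation, normalised by dz = 1, spans the tangent space, and a
  form is known there from a single number. Only one point lies outside the chart, and the Weyl
  element carries it in. Polynomial identities come from counting. As q + 1 is prime to p, a fibre
  over x outside \<open>Fq\<close> has q + 1 points, more than the degree in z of a reduced
  expression, and infinitely many such x exist. Function fields and irreducibility are thereby
  avoided. Testing outside \<open>Fq\<close> also keeps c = g21 x + g22 nonzero for every g in G.
  The main obstacle is that the coefficient of a holomorphic form is only locally a quotient of
  polynomials. Gluing these quotients to one polynomial means showing that the ideal of denominators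
  contains 1; norms reduce this to one variable. The weight q - 2 comes from d(z/c): its numerator c
  - z dc/dz = g21 (x - z^(q+1)) + g22 equals c^q on the curve, so d(z/c) = c^(q-2) dz, and forms of
  degree q - 2 absorb exactly this factor.\<close>

definition ev :: "'a::comm_ring_1 poly poly \<Rightarrow> 'a \<Rightarrow> 'a \<Rightarrow> 'a" where
  "ev b x z = poly (poly b [:z:]) x"

definition polyX :: "'a::comm_ring_1 poly poly" where "polyX = [:[:0, 1:]:]"

definition polyZ :: "'a::comm_ring_1 poly poly" where "polyZ = [:0, 1:]"

lemma ev_add [simp]: "ev (a + b) x z = ev a x z + ev b x z"
  and ev_diff [simp]: "ev (a - b) x z = ev a x z - ev b x z"
  and ev_uminus [simp]: "ev (- a) x z = - ev a x z"
  and ev_mult [simp]: "ev (a * b) x z = ev a x z * ev b x z"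
  and ev_0 [simp]: "ev 0 x z = 0"
  and ev_1 [simp]: "ev 1 x z = 1"
  and ev_const [simp]: "ev [:c:] x z = poly c x"
  and ev_X [simp]: "ev polyX x z = x"
  and ev_Z [simp]: "ev polyZ x z = z"
  and ev_power [simp]: "ev (a ^ n) x z = ev a x z ^ n"
  by (simp_all add: ev_def polyX_def polyZ_def)

lemma ev_smult [simp]: "ev (smult c b) x z = poly c x * ev b x z"
  by (simp add: ev_def)

lemma ev_sum [simp]: "ev (sum f A) x z = (\<Sum>i\<in>A. ev (f i) x z)"
  by (simp add: ev_def poly_sum)

lemma ev_prod [simp]: "ev (prod f A) x z = (\<Prod>i\<in>A. ev (f i) x z)"
  by (simp add: ev_def poly_prod)

lemma ev_monom [simp]: "ev (monom c n) x z = poly c x * z ^ n"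
  by (simp add: ev_def poly_monom flip: poly_const_pow)

lemma ev_altdef: "ev b x z = (\<Sum>i\<le>degree b. poly (coeff b i) x * z ^ i)"
  by (subst poly_as_sum_of_monoms[symmetric, of b]) simp

text \<open>The ring is generated by the constants and the two coordinates. The formula for a
  tangent vector on polynomials and the existence of homogenisations are both checked on these
  generators.\<close>

lemma poly_const_poly_induct [case_names const X Z add mult]:
  fixes P :: "'a::comm_ring_1 poly poly \<Rightarrow> bool"
  assumes const: "\<And>c. P [:[:c:]:]" and X: "P polyX" and Z: "P polyZ"
    and add: "\<And>a b. P a \<Longrightarrow> P b \<Longrightarrow> P (a + b)" and mult: "\<And>a b. P a \<Longrightarrow> P b \<Longrightarrow> P (a * b)"
  shows "P b"
proof -
  have P1: "P [:c:]" for c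
  proof (induction c)
    case 0
    then show ?case using const[of 0] by simp
  next
    case (pCons a c)
    have "[:pCons a c:] = [:[:a:]:] + polyX * [:c:]"
      by (simp add: polyX_def)
    then show ?case using pCons const X add mult by metis
  qed
  show ?thesis
  proof (induction b)
    case 0
    then show ?case using const[of 0] by simp
  next
    case (pCons c b)
    have "pCons c b = [:c:] + polyZ * b"
      by (simp add: polyZ_def)
    then show ?case using pCons P1 Z add mult by metis
  qed
qed

text \<open>The derivation with respect to \<open>z\<close> on the curve, where \<open>dx = z\<^sup>q dz\<close>.\<close>

definition der :: "nat \<Rightarrow> 'a::idom poly poly \<Rightarrow> 'a poly poly" where
  "der n b = pderiv b + monom 1 n * map_poly pderiv b"

lemma map_poly_pderiv_add:
  "map_poly pderiv (a + b) = map_poly pderiv a + map_poly pderiv b" for a b :: "'a::idom poly poly"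
  by (intro poly_eqI) (simp add: coeff_map_poly pderiv_add)

lemma map_poly_pderiv_smult:
  "map_poly pderiv (smult c b) = smult (pderiv c) b + smult c (map_poly pderiv b)"
  for b :: "'a::idom poly poly"
  by (intro poly_eqI) (simp add: coeff_map_poly pderiv_mult algebra_simps)

lemma map_poly_pderiv_mult:
  "map_poly pderiv (a * b) = map_poly pderiv a * b + a * map_poly pderiv b"
  for a b :: "'a::idom poly poly"
proof (induction a)
  case (pCons c a)
  have shift: "map_poly pderiv (pCons 0 b) = pCons 0 (map_poly pderiv b)" for b :: "'a poly poly"
    by (intro poly_eqI) (simp add: coeff_map_poly coeff_pCons split: nat.splits)
  show ?case
    using pCons by (simp add: map_poly_pCons map_poly_pderiv_add map_poly_pderiv_smult shift algebra_simps)
qed simp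

lemma der_add [simp]: "der n (a + b) = der n a + der n b"
  by (simp add: der_def map_poly_pderiv_add pderiv_add algebra_simps)

lemma der_mult [simp]: "der n (a * b) = der n a * b + a * der n b"
  by (simp add: der_def map_poly_pderiv_mult pderiv_mult algebra_simps)

lemma der_const [simp]: "der n [:[:c:]:] = 0"
  by (simp add: der_def map_poly_pCons)

lemma der_const' [simp]: "der n 1 = 0" "der n 0 = 0"
  using der_const[of n 1] by (simp_all add: der_def flip: one_pCons)

lemma der_X [simp]: "der n polyX = polyZ ^ n"
  by (simp add: der_def polyX_def polyZ_def map_poly_pCons pderiv_pCons monom_altdef flip: one_pCons)

lemma der_Z [simp]: "der n polyZ = 1"
  by (simp add: der_def polyZ_def map_poly_pCons pderiv_pCons one_pCons)

lemma der_uminus [simp]: "der n (- a) = - der n a"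
  using der_add[of n a "- a"] by (simp add: eq_neg_iff_add_eq_0 add.commute)

lemma der_diff [simp]: "der n (a - b) = der n a - der n b"
  using der_add[of n a "- b"] by simp

lemma der_power: "der n (a ^ m) = of_nat m * a ^ (m - 1) * der n a"
proof (induction m)
  case (Suc m)
  then show ?case by (cases m) (simp_all add: algebra_simps)
qed simp

lemma ev_of_nat [simp]: "ev (of_nat m) x z = of_nat m"
  by (induction m) simp_all


section \<open>Finite subfields\<close>

text \<open>Over a finite field, 1 plus the product of all X - a would take the value 1 everywhere
  and so be a polynomial of positive degree without a root.\<close>

lemma infinite_UNIV_alg_closed: "infinite (UNIV :: 'a::alg_closed_field set)"
proof
  assume fin: "finite (UNIV :: 'a set)"
  define f where "f = 1 + (\<Prod>a\<in>UNIV. [:-a, 1 :: 'a:])"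
  have "poly f x = 1" for x
    using fin by (auto simp: f_def poly_prod prod_zero_iff)
  moreover have "degree (\<Prod>a\<in>UNIV. [:-a, 1 :: 'a:]) = card (UNIV :: 'a set)"
    using degree_prod_sum_eq[of UNIV "\<lambda>a::'a. [:-a, 1:]"] by simp
  then have "degree f > 0"
    using fin finite_UNIV_card_ge_0[where ?'a='a] unfolding f_def
    by (subst degree_add_eq_right) auto
  ultimately show False
    using alg_closed_imp_poly_has_root[of f] by auto
qed

text \<open>The derivative n z^(n-1) vanishes only at 0, which is not a root of z^n - c. Hence no
  linear factor is repeated, and the n factors give n distinct roots.\<close>

lemma card_roots_binomial:
  fixes c :: "'a::alg_closed_field"
  assumes "c \<noteq> 0" "n > 0" "of_nat n \<noteq> (0 :: 'a)"
  shows "card {z. z ^ n = c} = n"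
proof -
  define f where "f = monom 1 n - [:c:]"
  have deg: "degree f = n"
    using assms unfolding f_def diff_conv_add_uminus
    by (subst degree_add_eq_left) (auto simp: degree_monom_eq)
  then have "f \<noteq> 0" using assms by auto
  obtain A where A: "size A = n" "f = smult (lead_coeff f) (\<Prod>x\<in>#A. [:-x, 1:])"
    using alg_closed_imp_factorization[OF \<open>f \<noteq> 0\<close>] deg by auto
  have roots: "poly f x = 0 \<longleftrightarrow> x ^ n = c" for x
    by (simp add: f_def poly_monom)
  have "count A x \<le> 1" for x
  proof (rule ccontr)
    assume "\<not> count A x \<le> 1"
    then have "{#x, x#} \<subseteq># A"
      by (metis count_le_replicate_mset_subset_eq not_less_eq_eq numeral_2_eq_2 One_nat_def
          replicate_mset_Suc replicate_mset_0)
    then obtain B where "A = {#x, x#} + B"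
      using subset_mset.less_eqE by blast
    then have f: "f = [:-x, 1:] * ([:-x, 1:] * smult (lead_coeff f) (\<Prod>x\<in>#B. [:-x, 1:]))"
      using A(2) by (simp add: mult_smult_right)
    have 1: "poly (pderiv f) x = 0"
      by (subst f) (simp only: pderiv_mult poly_add poly_mult, simp)
    have 2: "poly f x = 0"
      by (subst f) simp
    have "pderiv f = monom (of_nat n) (n - 1)"
      by (simp add: f_def pderiv_diff pderiv_monom pderiv_pCons)
    then have "x = 0" using 1 assms by (simp add: poly_monom)
    then show False using 2 assms by (auto simp: roots zero_power)
  qed
  then have "card (set_mset A) = size A"
    by (simp add: size_multiset_overloaded_eq le_antisym Suc_leI flip: count_greater_zero_iff cong: sum.cong)
      (metis (no_types, lifting) card_eq_sum count_greater_zero_iff le_antisym One_nat_def Suc_leI sum.cong)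
  moreover have "set_mset A = {z. z ^ n = c}"
  proof -
    have "poly f x = 0 \<longleftrightarrow> x \<in># A" for x
      using \<open>f \<noteq> 0\<close> by (subst A(2)) (auto simp: poly_prod_mset prod_mset_zero_iff)
    then show ?thesis by (auto simp: roots)
  qed
  ultimately show ?thesis using A by simp
qed

locale drinfeld =
  fixes p r q :: nat
    and Fq :: "'a::alg_closed_field set"
  assumes prime_p: "prime p" and r_ge: "r \<ge> 1" and q_eq: "q = p ^ r"
    and char: "CHAR('a) = p"
    and subfield_Fq: "subfield Fq (ring_of_type_algebra :: 'a ring)" and card_Fq: "card Fq = q"
begin

lemma q_ge: "q \<ge> 2"
  using prime_p r_ge prime_ge_2_nat[OF prime_p] self_le_power[of p r] by (simp add: q_eq)

lemma q_pos [simp]: "q > 0" "q \<noteq> 0"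
  using q_ge by auto

lemma of_nat_q [simp]: "of_nat q = (0 :: 'a)"
  using r_ge by (simp add: of_nat_eq_0_iff_char_dvd char q_eq)

lemma frob_add: "(a + b :: 'a) ^ q = a ^ q + b ^ q"
  by (rule freshmans_dream') (simp_all add: char prime_p q_eq)

lemma frob_uminus: "(- a :: 'a) ^ q = - (a ^ q)"
  using frob_add[of a "- a"] q_ge by (simp add: eq_neg_iff_add_eq_0 add.commute zero_power)

lemma finite_Fq: "finite Fq"
  using card_Fq q_ge by (metis card.infinite not_numeral_le_zero)

lemma Fq_mult: "a \<in> Fq \<Longrightarrow> b \<in> Fq \<Longrightarrow> a * b \<in> Fq" and Fq_0: "0 \<in> Fq" and Fq_1: "1 \<in> Fq"
proof -
  have "subring Fq (ring_of_type_algebra :: 'a ring)"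
    using subfield_Fq by (simp add: subfield_def subdomain_def subcring_def)
  from subringE[OF this]
  show "a \<in> Fq \<Longrightarrow> b \<in> Fq \<Longrightarrow> a * b \<in> Fq" "0 \<in> Fq" "1 \<in> Fq"
    by (auto simp: ring_of_type_algebra_def)
qed

text \<open>Multiplication by a nonzero a permutes the nonzero elements of \<open>Fq\<close>.
  Comparing the products over them gives a^(q-1) = 1.\<close>

lemma Fq_pow: "a \<in> Fq \<Longrightarrow> a ^ q = a"
proof (cases "a = 0")
  case False
  assume a: "a \<in> Fq"
  let ?U = "Fq - {0}"
  have fin: "finite ?U" using finite_Fq by simp
  have inj: "inj_on ((*) a) ?U"
    using False by (auto intro: inj_onI)
  have "(*) a ` ?U \<subseteq> ?U"
    using a False by (auto intro: Fq_mult)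
  then have im: "(*) a ` ?U = ?U"
    using inj fin by (simp add: endo_inj_surj)
  have "(\<Prod>b\<in>?U. b) = (\<Prod>b\<in>?U. a * b)"
    using prod.reindex[OF inj, of "\<lambda>b. b"] im by simp
  also have "\<dots> = a ^ card ?U * (\<Prod>b\<in>?U. b)"
    by (simp add: prod.distrib)
  finally have "a ^ card ?U = 1"
    using fin by (simp add: prod_zero_iff)
  moreover have "Suc (card ?U) = q"
    using Fq_0 finite_Fq card_Fq by (simp add: card_Suc_Diff1)
  ultimately show ?thesis by (metis mult.right_neutral power_Suc)
qed simp

text \<open>X^q - X has at most q roots, and the q elements of \<open>Fq\<close> are already
  roots.\<close>

lemma Fq_iff: "a \<in> Fq \<longleftrightarrow> a ^ q = a"
proof -
  define f where "f = monom (1::'a) q - [:0, 1:]"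
  have "degree f = q"
    unfolding f_def diff_conv_add_uminus using q_ge
    by (subst degree_add_eq_left) (auto simp: degree_monom_eq)
  then have "f \<noteq> 0" by auto
  then have "card {x. poly f x = 0} \<le> q"
    using card_poly_roots_bound[of f] \<open>degree f = q\<close> by simp
  moreover have "{x. poly f x = 0} = {x. x ^ q = x}"
    by (auto simp: f_def poly_monom)
  moreover have "finite {x. poly f x = 0}"
    using \<open>f \<noteq> 0\<close> by (rule poly_roots_finite)
  ultimately have "Fq = {x. x ^ q = x}"
    using Fq_pow card_Fq by (intro card_seteq) auto
  then show ?thesis by blast
qed

lemma Fq_add: "a \<in> Fq \<Longrightarrow> b \<in> Fq \<Longrightarrow> a + b \<in> Fq"
  and Fq_uminus: "a \<in> Fq \<Longrightarrow> - a \<in> Fq"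
  and Fq_divide: "a \<in> Fq \<Longrightarrow> b \<in> Fq \<Longrightarrow> a / b \<in> Fq"
  by (simp_all add: Fq_iff frob_add frob_uminus power_divide)

lemma infinite_outside_Fq: "infinite {x::'a. x ^ q \<noteq> x}"
proof -
  have "{x::'a. x ^ q \<noteq> x} = UNIV - Fq"
    by (auto simp: Fq_iff)
  then show ?thesis
    using infinite_UNIV_alg_closed finite_Fq by simp
qed

text \<open>Over x in \<open>Fq\<close> the fibre of the chart collapses to z = 0, so the
  comparisons of coefficients along fibres are available only for the other x. These still suffice
  to identify polynomials.\<close>

lemma poly_eqI_outside_Fq:
  fixes f g :: "'a poly"
  assumes "\<And>x. x ^ q \<noteq> x \<Longrightarrow> poly f x = poly g x"
  shows "f = g"
proof (rule ccontr)
  assume "f \<noteq> g"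
  then have "finite {x. poly (f - g) x = 0}"
    by (intro poly_roots_finite) simp
  moreover have "{x. x ^ q \<noteq> x} \<subseteq> {x. poly (f - g) x = 0}"
    using assms by auto
  ultimately show False
    using infinite_outside_Fq finite_subset by blast
qed

text \<open>In characteristic p the number q + 1 becomes 1, so the binomial is separable.\<close>

lemma card_fibre: "c \<noteq> (0::'a) \<Longrightarrow> card {z. z ^ (q + 1) = c} = q + 1"
  by (rule card_roots_binomial) auto

lemma poly_zero_on_fibre:
  fixes f :: "'a poly"
  assumes "c \<noteq> 0" "degree f \<le> q" "\<And>z. z ^ (q + 1) = c \<Longrightarrow> poly f z = 0"
  shows "f = 0"
proof (rule ccontr)
  assume "f \<noteq> 0"
  have "q + 1 = card {z. z ^ (q + 1) = c}"
    using card_fibre[OF assms(1)] by simp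
  also have "\<dots> \<le> card {z. poly f z = 0}"
    using assms \<open>f \<noteq> 0\<close> by (intro card_mono poly_roots_finite) auto
  also have "\<dots> \<le> q"
    using card_poly_roots_bound[OF \<open>f \<noteq> 0\<close>] assms by simp
  finally show False by simp
qed

text \<open>Since X^m - 1 has at most m < q - 1 roots, some nonzero a in \<open>Fq\<close> has a^m
  \<noteq> 1. Replacing c by a c multiplies the sum by a^m without changing it.\<close>

lemma power_sum_Fq:
  assumes "0 < m" "m < q - 1"
  shows "(\<Sum>c\<in>Fq - {0}. c ^ m) = 0"
proof -
  let ?U = "Fq - {0}"
  have "\<exists>a\<in>?U. a ^ m \<noteq> 1"
  proof (rule ccontr)
    assume H: "\<not> ?thesis"
    define f where "f = monom (1::'a) m - [:1:]"
    have deg: "degree f = m"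
      using assms unfolding f_def diff_conv_add_uminus
      by (subst degree_add_eq_left) (auto simp: degree_monom_eq)
    then have "f \<noteq> 0" using assms by auto
    have "q - 1 = card ?U"
      using Fq_0 finite_Fq card_Fq by simp
    also have "\<dots> \<le> card {x. poly f x = 0}"
      using H \<open>f \<noteq> 0\<close> by (intro card_mono poly_roots_finite) (auto simp: f_def poly_monom)
    also have "\<dots> \<le> m"
      using card_poly_roots_bound[OF \<open>f \<noteq> 0\<close>] deg by simp
    finally show False using assms by simp
  qed
  then obtain a where a: "a \<in> Fq" "a \<noteq> 0" "a ^ m \<noteq> 1" by auto
  have inj: "inj_on ((*) a) ?U"
    using a by (auto intro: inj_onI)
  have "(*) a ` ?U \<subseteq> ?U"
    using a by (auto intro: Fq_mult)
  then have im: "(*) a ` ?U = ?U"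
    using inj finite_Fq by (simp add: endo_inj_surj)
  have "(\<Sum>c\<in>?U. c ^ m) = (\<Sum>c\<in>?U. (a * c) ^ m)"
    using sum.reindex[OF inj, of "\<lambda>b. b ^ m"] im by simp
  also have "\<dots> = a ^ m * (\<Sum>c\<in>?U. c ^ m)"
    by (simp add: power_mult_distrib sum_distrib_left)
  finally show ?thesis using a by simp
qed

end

section \<open>The affine chart\<close>

context drinfeld
begin

definition on_curve :: "'a \<Rightarrow> 'a \<Rightarrow> bool" where
  "on_curve x z \<longleftrightarrow> z ^ (q + 1) = x - x ^ q"

text \<open>The equation of the curve is monic in the outer variable z. Division by it therefore
  stays within polynomials and leaves a remainder of degree at most q in z, the reduced form of a
  function on the chart.\<close>

definition curve_poly :: "'a poly poly" where
  "curve_poly = polyZ ^ (q + 1) + (polyX ^ q - polyX)"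

lemma ev_curve_poly [simp]: "on_curve x z \<Longrightarrow> ev curve_poly x z = 0"
  by (simp add: curve_poly_def on_curve_def)

text \<open>The value is (q + 1) z^q + (q x^(q-1) - 1) z^q, which is 0 because q vanishes in the
  field. Thus \<open>der q\<close> preserves the ideal of the curve.\<close>

lemma ev_der_curve_poly [simp]: "ev (der q curve_poly) x z = 0"
  by (simp add: curve_poly_def der_power del: power_Suc)

lemma degree_curve_poly: "degree curve_poly = q + 1" and monic_curve_poly: "lead_coeff curve_poly = 1"
proof -
  have "curve_poly = monom 1 (q + 1) + [:[:0, 1:] ^ q - [:0, 1:]:]"
    by (simp add: curve_poly_def polyZ_def polyX_def monom_altdef poly_const_pow del: power_Suc)
  then show "degree curve_poly = q + 1" "lead_coeff curve_poly = 1"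
    by (simp_all add: degree_add_eq_left degree_monom_eq lead_coeff_add_le)
qed

lemma curve_division: obtains m c where "b = curve_poly * m + c" "degree c \<le> q"
proof -
  obtain m c where mc: "pseudo_divmod b curve_poly = (m, c)"
    by fastforce
  have "curve_poly \<noteq> 0"
    using degree_curve_poly by auto
  from pseudo_divmod[OF this mc] have "b = curve_poly * m + c" "c = 0 \<or> degree c < q + 1"
    using monic_curve_poly degree_curve_poly by simp_all
  then show ?thesis by (intro that[of m c]) auto
qed

lemma fibre_nonempty: "\<exists>z. on_curve x z"
  unfolding on_curve_def by (rule nth_root_exists) simp

lemma finite_fibre: "finite {z. on_curve x z}"
proof -
  have "{z. on_curve x z} = {z. poly (monom 1 (q + 1) - [:x - x ^ q:]) z = 0}"
    by (simp add: on_curve_def poly_monom)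
  moreover have "monom 1 (q + 1) - [:x - x ^ q:] \<noteq> 0"
    by (metis degree_monom_eq degree_pCons_0 eq_iff_diff_eq_0 one_neq_zero add_is_0)
  ultimately show ?thesis
    by (metis poly_roots_finite)
qed

text \<open>This is the independence of 1, z, ..., z^q on a fibre of q + 1 points. It allows
  coefficients in z to be compared at one fixed x, where they need not depend polynomially on
  x.\<close>

lemma fibre_coeffs_zero:
  fixes c :: "nat \<Rightarrow> 'a"
  assumes "x ^ q \<noteq> x" "\<And>z. on_curve x z \<Longrightarrow> (\<Sum>i\<le>q. c i * z ^ i) = 0" "i \<le> q"
  shows "c i = 0"
proof -
  define f where "f = (\<Sum>i\<le>q. monom (c i) i)"
  have "degree f \<le> q"
    unfolding f_def by (intro degree_sum_le) (auto intro: order.trans[OF degree_monom_le])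
  then have "f = 0"
    using assms by (intro poly_zero_on_fibre[of "x - x ^ q"]) (auto simp: f_def poly_sum poly_monom on_curve_def)
  then have "coeff f i = 0" by simp
  then show ?thesis
    using \<open>i \<le> q\<close> by (simp add: f_def coeff_sum)
qed

lemma ev_reduced: "degree b \<le> q \<Longrightarrow> ev b x z = (\<Sum>i\<le>q. poly (coeff b i) x * z ^ i)"
  unfolding ev_altdef by (intro sum.mono_neutral_left) (auto simp: coeff_eq_0)

lemma reduced_eq_0:
  assumes "degree c \<le> q" and "\<And>x z. on_curve x z \<Longrightarrow> x ^ q \<noteq> x \<Longrightarrow> ev c x z = 0"
  shows "c = 0"
proof (rule poly_eqI)
  fix i
  have "poly (coeff c i) x = poly 0 x" if "x ^ q \<noteq> x" for x
  proof (cases "i \<le> q")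
    case True
    show ?thesis
      using fibre_coeffs_zero[of x "\<lambda>i. poly (coeff c i) x" i] that assms True
      by (simp add: ev_reduced)
  next
    case False
    then show ?thesis using assms(1) by (simp add: coeff_eq_0)
  qed
  then show "coeff c i = coeff 0 i"
    using poly_eqI_outside_Fq[of "coeff c i" 0] by simp
qed

lemma vanishing_imp_multiple:
  assumes "\<And>x z. on_curve x z \<Longrightarrow> x ^ q \<noteq> x \<Longrightarrow> ev b x z = 0"
  obtains m where "b = curve_poly * m"
proof -
  obtain m c where mc: "b = curve_poly * m + c" "degree c \<le> q"
    by (rule curve_division)
  then have "c = 0"
    using assms by (intro reduced_eq_0) auto
  then show ?thesis using mc that[of m] by simp
qed

text \<open>Such a b is a multiple of \<open>curve_poly\<close>, and the product rule keeps its
  derivative zero on the curve. Hence \<open>der q\<close> is well defined on functions on the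
  curve.\<close>

lemma vanishing_everywhere:
  assumes "\<And>x z. on_curve x z \<Longrightarrow> x ^ q \<noteq> x \<Longrightarrow> ev b x z = 0" "on_curve x z"
  shows "ev b x z = 0" "ev (der q b) x z = 0"
proof -
  obtain m where "b = curve_poly * m"
    using assms(1) by (rule vanishing_imp_multiple)
  then show "ev b x z = 0" "ev (der q b) x z = 0"
    using assms(2) by simp_all
qed

lemma on_curve_root_of_unity: "\<zeta> ^ (q + 1) = 1 \<Longrightarrow> on_curve x (\<zeta> * z) \<longleftrightarrow> on_curve x z"
  by (simp add: on_curve_def power_mult_distrib del: power_Suc)

text \<open>The norm of the coordinate ring over the polynomials in \<open>x\<close>, for the Galois group of the
  \<open>(q + 1)\<close>-st roots of unity.\<close>

lemma norm_exists:
  obtains n b' where "\<And>x z. on_curve x z \<Longrightarrow> poly n x = ev b x z * ev b' x z"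
    and "\<And>x. (\<And>z. on_curve x z \<Longrightarrow> ev b x z \<noteq> 0) \<Longrightarrow> poly n x \<noteq> 0"
proof -
  define U where "U = {\<zeta>::'a. \<zeta> ^ (q + 1) = 1}"
  have "card U = q + 1"
    unfolding U_def by (rule card_fibre) simp
  then have fin: "finite U" by (intro card_ge_0_finite) simp
  have U1: "1 \<in> U" and Umult: "\<xi> \<in> U \<Longrightarrow> \<zeta> \<in> U \<Longrightarrow> \<xi> * \<zeta> \<in> U" for \<xi> \<zeta>
    by (simp_all add: U_def power_mult_distrib del: power_Suc)
  define twist :: "'a \<Rightarrow> 'a poly poly \<Rightarrow> 'a poly poly"
    where "twist \<zeta> b = pcompose b [:0, [:\<zeta>:]:]" for \<zeta> b
  have ev_twist: "ev (twist \<zeta> b) x z = ev b x (\<zeta> * z)" for \<zeta> b x z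
    by (simp add: twist_def ev_def poly_pcompose mult.commute)
  have coeff_twist: "coeff (twist \<zeta> b) k = smult (\<zeta> ^ k) (coeff b k)" for \<zeta> b k
    by (simp add: twist_def coeff_pcompose_linear poly_const_pow)
  define c where "c = (\<Prod>\<zeta>\<in>U. twist \<zeta> b)"
  have ev_c: "ev c x z = (\<Prod>\<zeta>\<in>U. ev b x (\<zeta> * z))" for x z
    by (simp add: c_def ev_twist)
  have inv: "twist \<xi> c = c" if "\<xi> \<in> U" for \<xi>
  proof -
    have "\<xi> \<noteq> 0" using that by (auto simp: U_def)
    then have inj: "inj_on ((*) \<xi>) U" by (auto intro: inj_onI)
    have "(*) \<xi> ` U = U"
      using inj fin Umult[OF that] by (intro endo_inj_surj) auto
    then have "c = (\<Prod>\<zeta>\<in>U. twist (\<xi> * \<zeta>) b)"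
      using prod.reindex[OF inj, of "\<lambda>\<zeta>. twist \<zeta> b"] by (simp add: c_def)
    also have "\<dots> = twist \<xi> c"
      by (simp add: c_def twist_def pcompose_prod pcompose_assoc[symmetric] pcompose_pCons mult.commute)
    finally show ?thesis by simp
  qed
  \<comment> \<open>Invariance of c forces \<xi>^k = 1 for all q + 1 roots of unity \<xi>. With m =
    k mod (q + 1) they would all be roots of z^m - 1, which is too many for 0 < m \<le> q.\<close>
  have dvd: "(q + 1) dvd k" if "coeff c k \<noteq> 0" for k
  proof (rule ccontr)
    assume "\<not> (q + 1) dvd k"
    define m where "m = k mod (q + 1)"
    have m: "m > 0" "m \<le> q"
      using \<open>\<not> (q + 1) dvd k\<close> by (auto simp: m_def dvd_eq_mod_eq_0 intro: Suc_leI less_Suc_eq_le[THEN iffD1])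
    have "\<xi> ^ m = 1" if "\<xi> \<in> U" for \<xi>
    proof -
      have "smult (\<xi> ^ k) (coeff c k) = coeff c k"
        using inv[OF that] coeff_twist by metis
      then have "smult (\<xi> ^ k - 1) (coeff c k) = 0"
        by (simp add: smult_diff_left)
      then have "\<xi> ^ k = 1"
        using \<open>coeff c k \<noteq> 0\<close> by simp
      moreover have "\<xi> ^ k = (\<xi> ^ (q + 1)) ^ (k div (q + 1)) * \<xi> ^ m"
        unfolding m_def power_mult[symmetric] power_add[symmetric] by (simp only: mult_div_mod_eq)
      ultimately show ?thesis using that by (simp add: U_def del: power_Suc)
    qed
    moreover have "degree (monom (1::'a) m - 1) \<le> q"
      using m by (intro degree_diff_le) (auto simp: degree_monom_eq)
    ultimately have "monom (1::'a) m - 1 = 0"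
      using m by (intro poly_zero_on_fibre[of 1]) (auto simp: U_def poly_monom)
    then have "poly (monom (1::'a) m - 1) 0 = 0" by simp
    then show False using m by (simp add: poly_monom zero_power)
  qed
  \<comment> \<open>Only powers of z^(q+1) survive in c. Substituting x - x^q for each of them gives
    a polynomial in x alone.\<close>
  define n where "n = (\<Sum>k\<le>degree c. if (q + 1) dvd k then coeff c k * ([:0, 1:] - [:0, 1:] ^ q) ^ (k div (q + 1)) else 0)"
  have n: "poly n x = ev c x z" if "on_curve x z" for x z
  proof -
    have "poly (coeff c k) x * (x - x ^ q) ^ (k div (q + 1)) = poly (coeff c k) x * z ^ k"
      if "(q + 1) dvd k" for k
    proof -
      have "z ^ k = (z ^ (q + 1)) ^ (k div (q + 1))"
        unfolding power_mult[symmetric] using that by (simp only: dvd_mult_div_cancel)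
      then show ?thesis
        using \<open>on_curve x z\<close> by (simp add: on_curve_def)
    qed
    moreover have "coeff c k = 0" if "\<not> (q + 1) dvd k" for k
      using dvd that by blast
    ultimately have "poly (if (q + 1) dvd k then coeff c k * ([:0, 1:] - [:0, 1:] ^ q) ^ (k div (q + 1)) else 0) x
        = poly (coeff c k) x * z ^ k" for k
      by simp
    then show ?thesis
      unfolding n_def ev_altdef poly_sum by (intro sum.cong refl)
  qed
  define b' where "b' = (\<Prod>\<zeta>\<in>U - {1}. twist \<zeta> b)"
  have "ev c x z = ev b x z * ev b' x z" for x z
    using prod.remove[OF fin U1, of "\<lambda>\<zeta>. ev b x (\<zeta> * z)"] by (simp add: ev_c b'_def ev_twist)
  \<comment> \<open>The roots of unity permute the points of the fibre over x. If b vanishes at none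
    of these points, then no conjugate of b does either.\<close>
  moreover have "poly n x \<noteq> 0" if nz: "\<And>z. on_curve x z \<Longrightarrow> ev b x z \<noteq> 0" for x
  proof -
    obtain z where z: "on_curve x z" using fibre_nonempty by blast
    then have "ev b x (\<zeta> * z) \<noteq> 0" if "\<zeta> \<in> U" for \<zeta>
      using nz that by (auto simp: U_def on_curve_root_of_unity simp del: power_Suc)
    then show ?thesis
      using n[OF z] fin by (simp add: ev_c)
  qed
  ultimately show ?thesis
    using n that by metis
qed

text \<open>When a works on S and b at the new point, a + t b works on both as soon as t avoids the
  finitely many values -a/b. The field is infinite, so such a constant t exists; where b is 0, the
  value of a remains.\<close>

lemma common_nonvanishing:
  fixes I :: "'a poly poly set"
  assumes "finite S" "\<And>x z. (x, z) \<in> S \<Longrightarrow> \<exists>b\<in>I. ev b x z \<noteq> 0" "0 \<in> I"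
    and closed: "\<And>a b c. a \<in> I \<Longrightarrow> b \<in> I \<Longrightarrow> a + c * b \<in> I"
  shows "\<exists>b\<in>I. \<forall>(x, z)\<in>S. ev b x z \<noteq> 0"
  using assms(1,2)
proof (induction S rule: finite_induct)
  case empty
  then show ?case using \<open>0 \<in> I\<close> by auto
next
  case (insert P S)
  obtain a where a: "a \<in> I" "\<And>x z. (x, z) \<in> S \<Longrightarrow> ev a x z \<noteq> 0"
    using insert.IH insert.prems by blast
  obtain b where b: "b \<in> I" "ev b (fst P) (snd P) \<noteq> 0"
    using insert.prems[of "fst P" "snd P"] by auto
  have "finite ((\<lambda>(x, z). - ev a x z / ev b x z) ` insert P S)"
    using insert.hyps by simp
  then obtain t where t: "t \<notin> (\<lambda>(x, z). - ev a x z / ev b x z) ` insert P S"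
    using infinite_UNIV_alg_closed[where 'a='a] by (metis ex_new_if_finite)
  have "ev (a + [:[:t:]:] * b) x z \<noteq> 0" if "(x, z) \<in> insert P S" for x z
  proof (cases "ev b x z = 0")
    case True
    then have "(x, z) \<in> S" using b that by auto
    then show ?thesis using True a by simp
  next
    case False
    have "t \<noteq> - ev a x z / ev b x z" using t that by force
    then show ?thesis
      using False by (auto simp: field_simps add_eq_0_iff)
  qed
  then show ?case
    using closed[OF a(1) b(1), of "[:[:t:]:]"] by blast
qed

text \<open>The polynomials b for which w b is polynomial on the curve form an ideal without common
  zeros there. Its elements depending on x alone have no common root; one of least degree divides
  all the others, so it has no root and must be a nonzero constant. Dividing by that constant makes
  w polynomial.\<close>

lemma locally_fraction_imp_poly:
  fixes w :: "'a \<Rightarrow> 'a \<Rightarrow> 'a"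
  assumes loc: "\<And>x z. on_curve x z \<Longrightarrow>
    \<exists>a b. ev b x z \<noteq> 0 \<and> (\<forall>u v. on_curve u v \<longrightarrow> w u v * ev b u v = ev a u v)"
  obtains a where "\<And>x z. on_curve x z \<Longrightarrow> w x z = ev a x z"
proof -
  define I where "I = {b. \<exists>a. \<forall>u v. on_curve u v \<longrightarrow> w u v * ev b u v = ev a u v}"
  have I: "a + c * b \<in> I" if ab: "a \<in> I" "b \<in> I" for a b c
  proof -
    obtain a' b' where "\<And>u v. on_curve u v \<Longrightarrow> w u v * ev a u v = ev a' u v"
      "\<And>u v. on_curve u v \<Longrightarrow> w u v * ev b u v = ev b' u v"
      using ab by (auto simp: I_def)
    then have "w u v * ev (a + c * b) u v = ev (a' + c * b') u v" if "on_curve u v" for u v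
      using that by (simp add: algebra_simps)
    then show ?thesis unfolding I_def by blast
  qed
  have I0: "0 \<in> I" by (auto simp: I_def intro: exI[of _ 0])
  define J where "J = {n. [:n:] \<in> I}"
  have J: "m + c * n \<in> J" if "m \<in> J" "n \<in> J" for m n c
  proof -
    have "[:m:] + [:c:] * [:n:] \<in> I"
      using that by (intro I) (simp_all add: J_def)
    moreover have "[:m:] + [:c:] * [:n:] = [:m + c * n:]"
      by simp
    ultimately show ?thesis
      unfolding J_def by (simp only: mem_Collect_eq)
  qed
  \<comment> \<open>A fibre is finite, so one denominator b is nonzero at all its points. The norm
    of b is a multiple of b on the curve, hence again a denominator, and it is nonzero at this
    x.\<close>
  have J_nz: "\<exists>n\<in>J. poly n x \<noteq> 0" for x
  proof -
    have fin: "finite ((\<lambda>z. (x, z)) ` {z. on_curve x z})"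
      using finite_fibre by simp
    have "\<exists>b\<in>I. ev b y z \<noteq> 0" if "(y, z) \<in> (\<lambda>z. (x, z)) ` {z. on_curve x z}" for y z
      using loc[of x z] that unfolding I_def by auto
    from common_nonvanishing[OF fin this I0 I]
    obtain b where b: "b \<in> I" "\<And>z. on_curve x z \<Longrightarrow> ev b x z \<noteq> 0" by auto
    obtain n b' where n: "\<And>x z. on_curve x z \<Longrightarrow> poly n x = ev b x z * ev b' x z"
      "\<And>x. (\<And>z. on_curve x z \<Longrightarrow> ev b x z \<noteq> 0) \<Longrightarrow> poly n x \<noteq> 0"
      by (rule norm_exists[of b]) blast
    obtain a where "\<And>u v. on_curve u v \<Longrightarrow> w u v * ev b u v = ev a u v"
      using b(1) by (auto simp: I_def)
    then have "w u v * ev [:n:] u v = ev (a * b') u v" if "on_curve u v" for u v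
      using that n(1)[OF that] by (simp flip: mult.assoc)
    then have "n \<in> J" unfolding J_def I_def by blast
    then show ?thesis using n(2) b(2) by blast
  qed
  have "\<exists>n. n \<in> J \<and> n \<noteq> 0"
    using J_nz[of 0] by auto
  then obtain n where n: "n \<in> J" "n \<noteq> 0" "\<And>m. m \<in> J \<Longrightarrow> m \<noteq> 0 \<Longrightarrow> degree n \<le> degree m"
    using ex_has_least_nat[of "\<lambda>n. n \<in> J \<and> n \<noteq> 0" _ degree] by blast
  have "degree n = 0"
  proof (rule ccontr)
    assume "degree n \<noteq> 0"
    then obtain x where x: "poly n x = 0"
      using alg_closed_imp_poly_has_root[of n] by auto
    obtain m where m: "m \<in> J" "poly m x \<noteq> 0"
      using J_nz by blast
    have "m mod n = m + (- (m div n)) * n"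
      by (simp add: minus_div_mult_eq_mod[symmetric])
    then have "m mod n \<in> J" using J[OF m(1) n(1), of "- (m div n)"] by simp
    then have "m mod n = 0"
      using n(3)[of "m mod n"] degree_mod_less[OF n(2), of m] by (metis not_le)
    then have "n dvd m" by auto
    then show False using x m by (auto elim!: dvdE)
  qed
  then obtain c where c: "n = [:c:]" by (metis degree_eq_zeroE)
  then obtain a where a: "\<And>u v. on_curve u v \<Longrightarrow> w u v * c = ev a u v"
    using n(1) by (auto simp: J_def I_def)
  have "w u v = ev ([:[:inverse c:]:] * a) u v" if "on_curve u v" for u v
    using a[OF that] n(2) c by (simp add: field_simps)
  then show ?thesis using that by blast
qed

end

no_notation fps_nth (infixl "$" 75)

section \<open>Homogeneous functions and points\<close>

lemma homogeneous_add:
  assumes "A \<in> homogeneous d" "B \<in> homogeneous d"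
  shows "(\<lambda>v. A v + B v) \<in> homogeneous d"
proof -
  obtain a b where "\<And>v. A v = (\<Sum>i\<le>d. \<Sum>j\<le>d - i. a i j * (v$1)^i * (v$2)^j * (v$3)^(d - i - j))"
    "\<And>v. B v = (\<Sum>i\<le>d. \<Sum>j\<le>d - i. b i j * (v$1)^i * (v$2)^j * (v$3)^(d - i - j))"
    using assms unfolding homogeneous_def by auto
  then have "A v + B v = (\<Sum>i\<le>d. \<Sum>j\<le>d - i. (a i j + b i j) * (v$1)^i * (v$2)^j * (v$3)^(d - i - j))" for v
    by (simp add: sum.distrib algebra_simps)
  then show ?thesis unfolding homogeneous_def
    by (intro CollectI exI[of _ "\<lambda>i j. a i j + b i j"]) auto
qed

lemma homogeneous_scale:
  assumes "A \<in> homogeneous d"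
  shows "(\<lambda>v. c * A v) \<in> homogeneous d"
proof -
  obtain a where "\<And>v. A v = (\<Sum>i\<le>d. \<Sum>j\<le>d - i. a i j * (v$1)^i * (v$2)^j * (v$3)^(d - i - j))"
    using assms unfolding homogeneous_def by auto
  then have "c * A v = (\<Sum>i\<le>d. \<Sum>j\<le>d - i. (c * a i j) * (v$1)^i * (v$2)^j * (v$3)^(d - i - j))" for v
    by (simp add: sum_distrib_left algebra_simps)
  then show ?thesis unfolding homogeneous_def
    by (intro CollectI exI[of _ "\<lambda>i j. c * a i j"]) auto
qed

lemma homogeneous_0: "(\<lambda>v. 0) \<in> homogeneous d"
  unfolding homogeneous_def by (intro CollectI exI[of _ "\<lambda>i j. 0"]) auto

lemma homogeneous_sum:
  "(\<And>s. s \<in> S \<Longrightarrow> A s \<in> homogeneous d) \<Longrightarrow> (\<lambda>v. \<Sum>s\<in>S. A s v) \<in> homogeneous d"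
  by (induction S rule: infinite_finite_induct) (auto intro: homogeneous_0 homogeneous_add)

lemma homogeneous_monomial:
  assumes "i + j + k = d"
  shows "(\<lambda>v. (v$1)^i * (v$2)^j * (v$3)^k) \<in> homogeneous d"
proof -
  have "(\<Sum>i'\<le>d. \<Sum>j'\<le>d - i'. (if i' = i \<and> j' = j then 1 else 0) * x^i' * y^j' * z^(d - i' - j'))
      = x^i * y^j * z^k" for x y z :: 'a
  proof -
    have "(if i' = i \<and> j' = j then 1 else 0) * x^i' * y^j' * z^(d - i' - j')
        = (if j' = j then if i' = i then x^i * y^j * z^k else 0 else 0)" for i' j'
      using assms by auto
    moreover have "(\<Sum>j'\<le>d - i'. if j' = j then if i' = i then x^i * y^j * z^k else 0 else 0)
        = (if i' = i then x^i * y^j * z^k else 0)" for i'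
      using assms by (auto simp: sum.delta')
    ultimately show ?thesis
      using assms by simp
  qed
  then show ?thesis unfolding homogeneous_def
    by (intro CollectI exI[of _ "\<lambda>i' j'. if i' = i \<and> j' = j then 1 else 0"]) auto
qed

lemma homogeneous_mult:
  assumes "A \<in> homogeneous d" "B \<in> homogeneous e"
  shows "(\<lambda>v. A v * B v) \<in> homogeneous (d + e)"
proof -
  obtain a b where A: "\<And>v. A v = (\<Sum>i\<le>d. \<Sum>j\<le>d - i. a i j * (v$1)^i * (v$2)^j * (v$3)^(d - i - j))"
    and B: "\<And>v. B v = (\<Sum>i\<le>e. \<Sum>j\<le>e - i. b i j * (v$1)^i * (v$2)^j * (v$3)^(e - i - j))"
    using assms unfolding homogeneous_def by auto
  have "(\<lambda>v. A v * B v) = (\<lambda>v. \<Sum>i\<le>d. \<Sum>k\<le>e. \<Sum>j\<le>d - i. \<Sum>l\<le>e - k. (a i j * b k l) *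
     ((v$1)^(i + k) * (v$2)^(j + l) * (v$3)^((d - i - j) + (e - k - l))))"
    by (simp only: A B sum_product power_add mult_ac)
  also have "\<dots> \<in> homogeneous (d + e)"
    by (intro homogeneous_sum homogeneous_scale homogeneous_monomial) auto
  finally show ?thesis .
qed

lemma homogeneous_coord:
  "(\<lambda>v. v$1) \<in> homogeneous 1" "(\<lambda>v. v$2) \<in> homogeneous 1" "(\<lambda>v. v$3) \<in> homogeneous 1"
  using homogeneous_monomial[of 1 0 0 1] homogeneous_monomial[of 0 1 0 1] homogeneous_monomial[of 0 0 1 1]
  by simp_all

lemma homogeneous_const: "(\<lambda>v. c) \<in> homogeneous 0"
  using homogeneous_scale[OF homogeneous_monomial[of 0 0 0 0], of c] by simp

lemma homogeneous_power: "A \<in> homogeneous d \<Longrightarrow> (\<lambda>v. A v ^ n) \<in> homogeneous (n * d)"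
proof (induction n)
  case 0
  then show ?case using homogeneous_const[of 1] by simp
next
  case (Suc n)
  then show ?case using homogeneous_mult[of A d "\<lambda>v. A v ^ n" "n * d"] by simp
qed

lemma homogeneous_scaling:
  assumes "A \<in> homogeneous d"
  shows "A (c *s v) = c ^ d * A v"
proof -
  obtain a where A: "\<And>v. A v = (\<Sum>i\<le>d. \<Sum>j\<le>d - i. a i j * (v$1)^i * (v$2)^j * (v$3)^(d - i - j))"
    using assms unfolding homogeneous_def by auto
  have "c ^ d * (a i j * (v$1)^i * (v$2)^j * (v$3)^(d - i - j)) =
    a i j * ((c *s v)$1)^i * ((c *s v)$2)^j * ((c *s v)$3)^(d - i - j)" if "i \<le> d" "j \<le> d - i" for i j
  proof -
    have "c ^ d = c ^ i * c ^ j * c ^ (d - i - j)"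
      using that by (simp flip: power_add)
    then show ?thesis by (simp add: power_mult_distrib mult_ac)
  qed
  then show ?thesis
    by (simp only: A sum_distrib_left) (intro sum.cong refl, metis atMost_iff)
qed

section \<open>Projective points and quotients of forms\<close>

definition ppoint :: "'a::field^3 \<Rightarrow> 'a point" where
  "ppoint v = {c *s v | c. c \<noteq> 0}"

lemma ppoint_self: "v \<in> ppoint v"
  unfolding ppoint_def by (intro CollectI exI[of _ 1]) simp

lemma ppoint_scale: "c \<noteq> 0 \<Longrightarrow> ppoint (c *s v) = ppoint v"
proof (intro equalityI subsetI)
  assume c: "c \<noteq> 0"
  fix w
  show "w \<in> ppoint v" if "w \<in> ppoint (c *s v)"
    using that c by (auto simp: ppoint_def vector_smult_assoc)
  show "w \<in> ppoint (c *s v)" if "w \<in> ppoint v"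
  proof -
    from that obtain k where "w = k *s v" "k \<noteq> 0" by (auto simp: ppoint_def)
    then show ?thesis
      using c unfolding ppoint_def by (intro CollectI exI[of _ "k / c"]) (simp add: vector_smult_assoc)
  qed
qed

lemma proj_plane_altdef: "proj_plane = {ppoint v | v. v \<noteq> 0}"
  unfolding proj_plane_def ppoint_def by simp

definition rep :: "'a::field point \<Rightarrow> 'a^3" where
  "rep P = (SOME v. v \<in> P)"

text \<open>The chosen representative cancels when both arguments are homogeneous of the same
  degree. This gives a total function on points, as \<open>regular_at\<close> expects.\<close>

definition proj_quot :: "('a::field^3 \<Rightarrow> 'a) \<Rightarrow> ('a^3 \<Rightarrow> 'a) \<Rightarrow> 'a point \<Rightarrow> 'a" where
  "proj_quot A B P = A (rep P) / B (rep P)"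

lemma proj_quot_ppoint:
  assumes "A \<in> homogeneous d" "B \<in> homogeneous d"
  shows "proj_quot A B (ppoint v) = A v / B v"
proof -
  have "rep (ppoint v) \<in> ppoint v"
    unfolding rep_def by (rule someI[of "\<lambda>w. w \<in> ppoint v"], rule ppoint_self)
  then obtain c where "c \<noteq> 0" "rep (ppoint v) = c *s v"
    by (auto simp: ppoint_def)
  then show ?thesis
    using assms by (simp add: proj_quot_def homogeneous_scaling)
qed

lemma ball_ppoint_nonzero:
  "A \<in> homogeneous d \<Longrightarrow> (\<forall>v\<in>ppoint w. A v \<noteq> 0) \<longleftrightarrow> A w \<noteq> 0"
  using ppoint_self[of w] by (auto simp: ppoint_def homogeneous_scaling)

lemma zariski_open_nonzero:
  "A \<in> homogeneous d \<Longrightarrow> zariski_open V {P\<in>V. \<forall>v\<in>P. A v \<noteq> 0}"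
  unfolding zariski_open_def by (intro exI[of _ "{A}"]) auto

lemma regular_at_proj_quot:
  assumes "V \<subseteq> proj_plane" "A \<in> homogeneous d" "B \<in> homogeneous d" "ppoint w \<in> V" "B w \<noteq> 0"
    and "\<And>v. ppoint v \<in> V \<Longrightarrow> B v \<noteq> 0 \<Longrightarrow> f (ppoint v) = A v / B v"
  shows "regular_at V f (ppoint w)"
proof -
  let ?U = "{P\<in>V. \<forall>v\<in>P. B v \<noteq> 0}"
  have "B v \<noteq> 0 \<and> f Q = A v / B v" if Q: "Q \<in> ?U" and v: "v \<in> Q" for Q v
  proof -
    obtain u c where "Q = ppoint u" "v = c *s u" "c \<noteq> 0"
      using assms(1) Q v by (auto simp: proj_plane_altdef ppoint_def)
    then have "Q = ppoint v"
      by (simp add: ppoint_scale)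
    then show ?thesis
      using Q v assms(6) by auto
  qed
  moreover have "zariski_open V ?U" "ppoint w \<in> ?U"
    using zariski_open_nonzero[OF assms(3)] assms(4,5) ball_ppoint_nonzero[OF assms(3), of w] by simp_all
  ultimately show ?thesis
    unfolding regular_at_def using assms(2,3) by blast
qed


section \<open>The linear action on the plane\<close>

definition lin_act :: "'a::field^2^2 \<Rightarrow> 'a^3 \<Rightarrow> 'a^3" where
  "lin_act g v = vector [g$1$1 * v$1 + g$1$2 * v$2, g$2$1 * v$1 + g$2$2 * v$2, v$3]"

lemma lin_act_nth [simp]:
  "lin_act g v $ 1 = g$1$1 * v$1 + g$1$2 * v$2"
  "lin_act g v $ 2 = g$2$1 * v$1 + g$2$2 * v$2"
  "lin_act g v $ 3 = v$3"
  by (simp_all add: lin_act_def)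

lemma vec3_eq_iff: "v = w \<longleftrightarrow> v$1 = w$1 \<and> v$2 = w$2 \<and> v$3 = w$3" for v w :: "'a^3"
  by (simp add: vec_eq_iff forall_3)

lemma vec3_zero_iff: "v = 0 \<longleftrightarrow> v$1 = 0 \<and> v$2 = 0 \<and> v$3 = 0" for v :: "'a::zero^3"
  by (simp add: vec3_eq_iff)

lemma mat2_mult_nth:
  fixes g h :: "'a::semiring_1^2^2"
  shows "(g ** h) $ i $ j = g$i$1 * h$1$j + g$i$2 * h$2$j"
  by (simp add: matrix_matrix_mult_def sum_2)

lemma lin_act_mult: "lin_act (g ** h) v = lin_act g (lin_act h v)"
  by (simp add: vec3_eq_iff mat2_mult_nth algebra_simps)

lemma lin_act_one: "lin_act (mat 1) v = v"
  by (simp add: vec3_eq_iff mat_def)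

lemma lin_act_scale: "lin_act g (c *s v) = c *s lin_act g v"
  by (simp add: vec3_eq_iff algebra_simps)

lemma point_act_ppoint: "point_act g (ppoint v) = ppoint (lin_act g v)"
proof -
  have "point_act g (ppoint v) = {lin_act g (c *s v) | c. c \<noteq> 0}"
    unfolding point_act_def lin_act_def ppoint_def by blast
  then show ?thesis by (simp add: lin_act_scale ppoint_def)
qed

lemma lin_act_nonzero:
  assumes "det g \<noteq> 0" "v \<noteq> 0"
  shows "lin_act g v \<noteq> 0"
proof
  assume *: "lin_act g v = 0"
  then have 1: "g$1$1 * v$1 + g$1$2 * v$2 = 0" and 2: "g$2$1 * v$1 + g$2$2 * v$2 = 0" and 3: "v$3 = 0"
    by (auto simp: vec3_zero_iff)
  \<comment> \<open>Cramer's rule, written as the adjugate of g applied to the first two coordinates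
    of the image.\<close>
  have "det g * v$1 = g$2$2 * (g$1$1 * v$1 + g$1$2 * v$2) - g$1$2 * (g$2$1 * v$1 + g$2$2 * v$2)"
    "det g * v$2 = g$1$1 * (g$2$1 * v$1 + g$2$2 * v$2) - g$2$1 * (g$1$1 * v$1 + g$1$2 * v$2)"
    by (simp_all add: det_2 algebra_simps)
  then show False
    using assms 3 unfolding 1 2 by (auto simp: vec3_zero_iff)
qed

lemma homogeneous_lin_act:
  assumes "A \<in> homogeneous d"
  shows "(\<lambda>v. A (lin_act g v)) \<in> homogeneous d"
proof -
  obtain a where A: "\<And>v. A v = (\<Sum>i\<le>d. \<Sum>j\<le>d - i. a i j * ((v$1)^i * (v$2)^j * (v$3)^(d - i - j)))"
    using assms unfolding homogeneous_def by (auto simp: mult.assoc)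
  have "(\<lambda>v. lin_act g v $ 1 ^ i * lin_act g v $ 2 ^ j * lin_act g v $ 3 ^ (d - i - j)) \<in> homogeneous d"
    if "i \<le> d" "j \<le> d - i" for i j
  proof -
    have "(\<lambda>v. lin_act g v $ 1) \<in> homogeneous 1" "(\<lambda>v. lin_act g v $ 2) \<in> homogeneous 1"
      "(\<lambda>v. lin_act g v $ 3) \<in> homogeneous 1"
      unfolding lin_act_nth
      by (intro homogeneous_add homogeneous_scale homogeneous_coord)+
    from homogeneous_mult[OF homogeneous_mult[OF homogeneous_power[OF this(1), of i]
        homogeneous_power[OF this(2), of j]] homogeneous_power[OF this(3), of "d - i - j"]]
    show ?thesis using that by simp
  qed
  then have "(\<lambda>v. \<Sum>i\<le>d. \<Sum>j\<le>d - i. a i j *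
      (lin_act g v $ 1 ^ i * lin_act g v $ 2 ^ j * lin_act g v $ 3 ^ (d - i - j))) \<in> homogeneous d"
    by (intro homogeneous_sum homogeneous_scale) (simp del: lin_act_nth)
  then show ?thesis
    by (simp only: A)
qed

lemma vector3_nth [simp]:
  "(vector [x, y, z] :: 'a::zero^3) $ 1 = x" "(vector [x, y, z] :: 'a^3) $ 2 = y"
  "(vector [x, y, z] :: 'a^3) $ 3 = z"
  by (simp_all add: vector_3)

section \<open>Forms in X, Y, Z and polynomials on the chart Y = 1\<close>

lemma dehomogenize:
  assumes "A \<in> homogeneous d"
  obtains b where "\<And>x z. ev b x z = A (vector [x, 1, z])"
proof -
  obtain a where A: "\<And>v. A v = (\<Sum>i\<le>d. \<Sum>j\<le>d - i. a i j * (v$1)^i * (v$2)^j * (v$3)^(d - i - j))"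
    using assms unfolding homogeneous_def by auto
  have "ev (\<Sum>i\<le>d. \<Sum>j\<le>d - i. [:[:a i j:]:] * polyX ^ i * polyZ ^ (d - i - j)) x z = A (vector [x, 1, z])" for x z
    by (simp add: A mult.assoc)
  then show ?thesis by (rule that)
qed

text \<open>Powers of Y pad a homogenisation to any larger degree. The claim covers all large
  degrees because a numerator and a denominator must be brought to one common degree.\<close>

lemma homogenize_ge: "\<exists>d0. \<forall>d\<ge>d0. \<exists>A\<in>homogeneous d. \<forall>x z. A (vector [x, 1, z]) = ev b x z"
proof (induction b rule: poly_const_poly_induct)
  case (const c)
  have "(\<lambda>v. c * (v$2)^d) \<in> homogeneous d" for d
    using homogeneous_scale[OF homogeneous_power[OF homogeneous_coord(2), of d], of c] by simp
  then have "\<exists>A\<in>homogeneous d. \<forall>x z. A (vector [x, 1, z]) = c" for d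
    by (rule bexI[rotated]) simp
  then show ?case by simp
next
  case X
  have hom: "(\<lambda>v. v$1 * (v$2)^d) \<in> homogeneous (Suc d)" for d
    using homogeneous_mult[OF homogeneous_coord(1) homogeneous_power[OF homogeneous_coord(2), of d]] by simp
  have ex: "\<exists>A\<in>homogeneous d. \<forall>x z. A (vector [x, 1, z]) = x" if d: "d \<ge> 1" for d
  proof -
    obtain e where "d = Suc e" using d by (cases d) auto
    then show ?thesis
      using hom[of e] by (intro bexI[of _ "\<lambda>v. v$1 * (v$2)^e"]) auto
  qed
  show ?case unfolding ev_X ev_Z by (intro exI[of _ 1] allI impI) (rule ex)
next
  case Z
  have hom: "(\<lambda>v. v$3 * (v$2)^d) \<in> homogeneous (Suc d)" for d
    using homogeneous_mult[OF homogeneous_coord(3) homogeneous_power[OF homogeneous_coord(2), of d]] by simp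
  have ex: "\<exists>A\<in>homogeneous d. \<forall>x z. A (vector [x, 1, z]) = z" if d: "d \<ge> 1" for d
  proof -
    obtain e where "d = Suc e" using d by (cases d) auto
    then show ?thesis
      using hom[of e] by (intro bexI[of _ "\<lambda>v. v$3 * (v$2)^e"]) auto
  qed
  show ?case unfolding ev_X ev_Z by (intro exI[of _ 1] allI impI) (rule ex)
next
  case (add a b)
  obtain d0 where a: "\<And>d. d \<ge> d0 \<Longrightarrow> \<exists>A\<in>homogeneous d. \<forall>x z. A (vector [x, 1, z]) = ev a x z"
    using add(1) by blast
  obtain d1 where b: "\<And>d. d \<ge> d1 \<Longrightarrow> \<exists>A\<in>homogeneous d. \<forall>x z. A (vector [x, 1, z]) = ev b x z"
    using add(2) by blast
  show ?case
  proof (intro exI[of _ "max d0 d1"] allI impI)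
    fix d assume "max d0 d1 \<le> d"
    then obtain A B where "A \<in> homogeneous d" "B \<in> homogeneous d"
      "\<And>x z. A (vector [x, 1, z]) = ev a x z" "\<And>x z. B (vector [x, 1, z]) = ev b x z"
      using a[of d] b[of d] by auto
    then show "\<exists>A\<in>homogeneous d. \<forall>x z. A (vector [x, 1, z]) = ev (a + b) x z"
      by (intro bexI[of _ "\<lambda>v. A v + B v"] homogeneous_add) auto
  qed
next
  case (mult a b)
  obtain d0 where a: "\<And>d. d \<ge> d0 \<Longrightarrow> \<exists>A\<in>homogeneous d. \<forall>x z. A (vector [x, 1, z]) = ev a x z"
    using mult(1) by blast
  obtain d1 where b: "\<And>d. d \<ge> d1 \<Longrightarrow> \<exists>A\<in>homogeneous d. \<forall>x z. A (vector [x, 1, z]) = ev b x z"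
    using mult(2) by blast
  show ?case
  proof (intro exI[of _ "d0 + d1"] allI impI)
    fix d assume d: "d0 + d1 \<le> d"
    then obtain A B where "A \<in> homogeneous d0" "B \<in> homogeneous (d - d0)"
      "\<And>x z. A (vector [x, 1, z]) = ev a x z" "\<And>x z. B (vector [x, 1, z]) = ev b x z"
      using a[of d0] b[of "d - d0"] by (auto simp: le_diff_conv2)
    then show "\<exists>A\<in>homogeneous d. \<forall>x z. A (vector [x, 1, z]) = ev (a * b) x z"
      using homogeneous_mult[of A d0 B "d - d0"] d
      by (intro bexI[of _ "\<lambda>v. A v * B v"]) auto
  qed
qed

lemma homogenize2:
  obtains d A B where "A \<in> homogeneous d" "B \<in> homogeneous d"
    "\<And>x z. A (vector [x, 1, z]) = ev a x z" "\<And>x z. B (vector [x, 1, z]) = ev b x z"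
proof -
  obtain d0 where d0: "\<forall>d\<ge>d0. \<exists>A\<in>homogeneous d. \<forall>x z. A (vector [x, 1, z]) = ev a x z"
    using homogenize_ge[of a] by (rule exE)
  obtain d1 where d1: "\<forall>d\<ge>d1. \<exists>A\<in>homogeneous d. \<forall>x z. A (vector [x, 1, z]) = ev b x z"
    using homogenize_ge[of b] by (rule exE)
  obtain A where A: "A \<in> homogeneous (max d0 d1)" "\<forall>x z. A (vector [x, 1, z]) = ev a x z"
    using d0[rule_format, of "max d0 d1"] by auto
  obtain B where B: "B \<in> homogeneous (max d0 d1)" "\<forall>x z. B (vector [x, 1, z]) = ev b x z"
    using d1[rule_format, of "max d0 d1"] by auto
  show ?thesis using that[OF A(1) B(1)] A(2) B(2) by blast
qed


section \<open>The Drinfeld curve\<close>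

context drinfeld
begin

abbreviation C :: "'a point set" where "C \<equiv> drinfeld_curve q"

definition pt :: "'a \<Rightarrow> 'a \<Rightarrow> 'a point" where
  "pt x z = ppoint (vector [x, 1, z])"

lemma C_proj_plane: "C \<subseteq> proj_plane"
  unfolding drinfeld_curve_def by blast

lemma ppoint_in_C:
  "ppoint v \<in> C \<longleftrightarrow> v \<noteq> 0 \<and> v$1 * (v$2)^q - (v$1)^q * v$2 = (v$3)^(q + 1)"
proof -
  have "(\<forall>w\<in>ppoint v. w$1 * (w$2)^q - (w$1)^q * w$2 - (w$3)^(q + 1) = 0)
    \<longleftrightarrow> v$1 * (v$2)^q - (v$1)^q * v$2 - (v$3)^(q + 1) = 0"
  proof -
    have scale: "(c *s v)$1 * ((c *s v)$2)^q - ((c *s v)$1)^q * (c *s v)$2 - ((c *s v)$3)^(q + 1) =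
      c^(q + 1) * (v$1 * (v$2)^q - (v$1)^q * v$2 - (v$3)^(q + 1))" for c
      by (simp add: power_mult_distrib algebra_simps)
    show ?thesis
    proof
      assume "\<forall>w\<in>ppoint v. w$1 * (w$2)^q - (w$1)^q * w$2 - (w$3)^(q + 1) = 0"
      then show "v$1 * (v$2)^q - (v$1)^q * v$2 - (v$3)^(q + 1) = 0"
        using ppoint_self by blast
    next
      assume v: "v$1 * (v$2)^q - (v$1)^q * v$2 - (v$3)^(q + 1) = 0"
      show "\<forall>w\<in>ppoint v. w$1 * (w$2)^q - (w$1)^q * w$2 - (w$3)^(q + 1) = 0"
      proof
        fix w assume "w \<in> ppoint v"
        then obtain c where w: "w = c *s v" unfolding ppoint_def by blast
        show "w$1 * (w$2)^q - (w$1)^q * w$2 - (w$3)^(q + 1) = 0"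
          unfolding w scale v by simp
      qed
    qed
  qed
  moreover have "ppoint v \<in> proj_plane \<longleftrightarrow> v \<noteq> 0"
  proof
    assume "ppoint v \<in> proj_plane"
    then obtain w where w: "ppoint v = ppoint w" "w \<noteq> 0" by (auto simp: proj_plane_altdef)
    have "v \<in> ppoint w" unfolding w(1)[symmetric] by (rule ppoint_self)
    then obtain c where "v = c *s w" "c \<noteq> 0" unfolding ppoint_def by blast
    then show "v \<noteq> 0" using w(2) by (simp add: vector_mul_eq_0)
  qed (auto simp: proj_plane_altdef)
  ultimately show ?thesis
    unfolding drinfeld_curve_def mem_Collect_eq by (metis eq_iff_diff_eq_0)
qed

lemma C_cases:
  assumes "P \<in> C"
  obtains v where "P = ppoint v" "v \<noteq> 0" "v$1 * (v$2)^q - (v$1)^q * v$2 = (v$3)^(q + 1)"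
proof -
  obtain v where "P = ppoint v"
    using assms C_proj_plane by (auto simp: proj_plane_altdef)
  then show ?thesis using assms that ppoint_in_C by blast
qed

lemma pt_in_C [simp]: "pt x z \<in> C \<longleftrightarrow> on_curve x z"
  by (auto simp: pt_def ppoint_in_C vec3_zero_iff on_curve_def simp del: power_Suc)

lemma ppoint_eq_pt: "v$2 \<noteq> 0 \<Longrightarrow> ppoint v = pt (v$1 / v$2) (v$3 / v$2)"
proof -
  assume "v$2 \<noteq> 0"
  then have "v = v$2 *s vector [v$1 / v$2, 1, v$3 / v$2]"
    by (simp add: vec3_eq_iff)
  then have "ppoint v = ppoint (v$2 *s vector [v$1 / v$2, 1, v$3 / v$2])"
    by (rule arg_cong)
  also have "\<dots> = pt (v$1 / v$2) (v$3 / v$2)"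
    using \<open>v$2 \<noteq> 0\<close> unfolding pt_def by (rule ppoint_scale)
  finally show ?thesis .
qed

lemma homogeneous_at_ppoint:
  assumes "A \<in> homogeneous d" "v$2 \<noteq> 0"
  shows "A v = (v$2) ^ d * A (vector [v$1 / v$2, 1, v$3 / v$2])"
proof -
  have "v = v$2 *s vector [v$1 / v$2, 1, v$3 / v$2]"
    using assms by (simp add: vec3_eq_iff)
  then have "A v = A (v$2 *s vector [v$1 / v$2, 1, v$3 / v$2])"
    by (rule arg_cong)
  then show ?thesis
    by (simp add: homogeneous_scaling[OF assms(1)])
qed

definition xc :: "'a point \<Rightarrow> 'a" where "xc = proj_quot (\<lambda>v. v$1) (\<lambda>v. v$2)"

definition zc :: "'a point \<Rightarrow> 'a" where "zc = proj_quot (\<lambda>v. v$3) (\<lambda>v. v$2)"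

lemma xc_pt [simp]: "xc (pt x z) = x" and zc_pt [simp]: "zc (pt x z) = z"
  unfolding xc_def zc_def pt_def by (simp_all add: proj_quot_ppoint[OF homogeneous_coord(1,2)] proj_quot_ppoint[OF homogeneous_coord(3,2)])

lemma zariski_openD:
  assumes "zariski_open C U" "pt x z \<in> U"
  obtains b where "ev b x z \<noteq> 0" "\<And>u v. on_curve u v \<Longrightarrow> ev b u v \<noteq> 0 \<Longrightarrow> pt u v \<in> U"
proof -
  obtain S where S: "S \<subseteq> (\<Union>d. homogeneous d)" "U = {P\<in>C. \<exists>A\<in>S. \<forall>v\<in>P. A v \<noteq> 0}"
    using assms(1) unfolding zariski_open_def by auto
  then obtain A where A: "A \<in> S" "\<forall>v\<in>pt x z. A v \<noteq> 0" using assms(2) by auto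
  then obtain d where d: "A \<in> homogeneous d" using S by auto
  obtain b where b: "\<And>x z. ev b x z = A (vector [x, 1, z])"
    using dehomogenize[OF d] by blast
  have iff: "(\<forall>w\<in>pt u v. A w \<noteq> 0) \<longleftrightarrow> ev b u v \<noteq> 0" for u v
    unfolding pt_def ball_ppoint_nonzero[OF d] b ..
  show ?thesis
  proof (rule that)
    show "ev b x z \<noteq> 0" using A(2) iff by blast
    show "pt u v \<in> U" if "on_curve u v" "ev b u v \<noteq> 0" for u v
      unfolding S(2) using that A(1) iff by auto
  qed
qed

lemma zariski_openI: "zariski_open C {pt u v | u v. on_curve u v \<and> ev b u v \<noteq> 0}"
proof -
  obtain d A B where A: "A \<in> homogeneous d" "B \<in> homogeneous d"
    "\<And>x z. A (vector [x, 1, z]) = ev b x z" "\<And>x z. B (vector [x, 1, z]) = ev 1 x z"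
    by (rule homogenize2[of b 1]) (rule that)
  \<comment> \<open>The extra factor Y removes the point outside the chart, where A may well be
    nonzero.\<close>
  have "(\<lambda>v. A v * v$2) \<in> homogeneous (d + 1)"
    by (rule homogeneous_mult[OF A(1) homogeneous_coord(2)])
  note 1 = zariski_open_nonzero[OF this, of C] and 2 = ball_ppoint_nonzero[OF this]
  have "{P \<in> C. \<forall>v\<in>P. A v * v$2 \<noteq> 0} = {pt u v | u v. on_curve u v \<and> ev b u v \<noteq> 0}"
  proof (intro equalityI subsetI)
    fix P assume P: "P \<in> {P \<in> C. \<forall>v\<in>P. A v * v$2 \<noteq> 0}"
    then obtain v where v: "P = ppoint v" by (auto elim: C_cases)
    with P 2 have "A v \<noteq> 0" "v$2 \<noteq> 0" by auto
    then have "P = pt (v$1 / v$2) (v$3 / v$2)" "ev b (v$1 / v$2) (v$3 / v$2) \<noteq> 0"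
      using v ppoint_eq_pt[of v] A(3) homogeneous_at_ppoint[OF A(1), of v] by auto
    then show "P \<in> {pt u v | u v. on_curve u v \<and> ev b u v \<noteq> 0}"
      using P by auto
  next
    fix P assume "P \<in> {pt u v | u v. on_curve u v \<and> ev b u v \<noteq> 0}"
    then obtain u v where uv: "P = pt u v" "on_curve u v" "ev b u v \<noteq> 0" by auto
    then have "\<forall>w\<in>P. A w * w$2 \<noteq> 0"
      unfolding uv(1) pt_def 2 A(3) by simp
    then show "P \<in> {P \<in> C. \<forall>v\<in>P. A v * v$2 \<noteq> 0}" using uv by auto
  qed
  then show ?thesis using 1 by simp
qed

text \<open>The equation f = a/b without division, on the entire locus where b is nonzero. That
  locus serves as the neighbourhood, so germs of regular functions on the chart become pairs of
  polynomials with no mention of an open set.\<close>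

definition rational_near :: "('a \<Rightarrow> 'a \<Rightarrow> 'a) \<Rightarrow> 'a poly poly \<Rightarrow> 'a poly poly \<Rightarrow> bool" where
  "rational_near f a b \<longleftrightarrow> (\<forall>u v. on_curve u v \<longrightarrow> ev b u v \<noteq> 0 \<longrightarrow> f u v * ev b u v = ev a u v)"

lemma regular_at_iff:
  assumes "on_curve x z"
  shows "regular_at C f (pt x z) \<longleftrightarrow> (\<exists>a b. ev b x z \<noteq> 0 \<and> rational_near (\<lambda>u v. f (pt u v)) a b)"
proof
  assume "regular_at C f (pt x z)"
  then obtain U d A B where U: "zariski_open C U" "pt x z \<in> U" and AB: "A \<in> homogeneous d" "B \<in> homogeneous d"
    and f: "\<And>Q v. Q \<in> U \<Longrightarrow> v \<in> Q \<Longrightarrow> B v \<noteq> 0 \<and> f Q = A v / B v"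
    unfolding regular_at_def by metis
  obtain s where s: "ev s x z \<noteq> 0" "\<And>u v. on_curve u v \<Longrightarrow> ev s u v \<noteq> 0 \<Longrightarrow> pt u v \<in> U"
    using zariski_openD[OF U] by blast
  obtain a where a: "\<And>x z. ev a x z = A (vector [x, 1, z])"
    using dehomogenize[OF AB(1)] by blast
  obtain b where b: "\<And>x z. ev b x z = B (vector [x, 1, z])"
    using dehomogenize[OF AB(2)] by blast
  have *: "ev b u v \<noteq> 0 \<and> f (pt u v) = ev a u v / ev b u v" if "pt u v \<in> U" for u v
    using f[OF that, of "vector [u, 1, v]"] a b by (simp add: pt_def ppoint_self)
  \<comment> \<open>Multiplying both by s shrinks the locus of nonzero denominator to lie inside U,
    outside of which f is arbitrary.\<close>
  have "rational_near (\<lambda>u v. f (pt u v)) (s * a) (s * b)"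
    unfolding rational_near_def using * s by auto
  moreover have "ev (s * b) x z \<noteq> 0"
    using * U s by simp
  ultimately show "\<exists>a b. ev b x z \<noteq> 0 \<and> rational_near (\<lambda>u v. f (pt u v)) a b" by blast
next
  assume "\<exists>a b. ev b x z \<noteq> 0 \<and> rational_near (\<lambda>u v. f (pt u v)) a b"
  then obtain a b where ab: "ev b x z \<noteq> 0" "rational_near (\<lambda>u v. f (pt u v)) a b" by blast
  obtain d A B where A: "A \<in> homogeneous d" "B \<in> homogeneous d"
    "\<And>x z. A (vector [x, 1, z]) = ev a x z" "\<And>x z. B (vector [x, 1, z]) = ev b x z"
    by (rule homogenize2[of a b]) (rule that)
  \<comment> \<open>Again Y is multiplied in: nothing is known about f at the point outside the
    chart, so the denominator has to vanish there.\<close>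
  have hom: "(\<lambda>v. A v * v$2) \<in> homogeneous (d + 1)" "(\<lambda>v. B v * v$2) \<in> homogeneous (d + 1)"
    by (rule homogeneous_mult[OF A(1) homogeneous_coord(2)], rule homogeneous_mult[OF A(2) homogeneous_coord(2)])
  show "regular_at C f (pt x z)"
    unfolding pt_def
  proof (rule regular_at_proj_quot[OF C_proj_plane hom])
    fix v assume v: "ppoint v \<in> C" "B v * v$2 \<noteq> 0"
    let ?x = "v$1 / v$2" and ?z = "v$3 / v$2"
    have "v$2 \<noteq> 0" using v by auto
    then have pt: "ppoint v = pt ?x ?z" by (rule ppoint_eq_pt)
    have "A v = (v$2) ^ d * ev a ?x ?z" "B v = (v$2) ^ d * ev b ?x ?z"
      using A(3,4) homogeneous_at_ppoint[OF A(1) \<open>v$2 \<noteq> 0\<close>] homogeneous_at_ppoint[OF A(2) \<open>v$2 \<noteq> 0\<close>] by simp_all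
    moreover from this have "ev b ?x ?z \<noteq> 0" using v by auto
    moreover have "on_curve ?x ?z" using v pt by simp
    ultimately show "f (ppoint v) = A v * v$2 / (B v * v$2)"
      using ab(2) \<open>v$2 \<noteq> 0\<close> unfolding rational_near_def pt by (auto simp: field_simps)
  qed (use assms ab A in \<open>auto simp: pt_def[symmetric]\<close>)
qed

lemma regular_at_poly:
  assumes "on_curve x z" "\<And>u v. on_curve u v \<Longrightarrow> f (pt u v) = ev b u v"
  shows "regular_at C f (pt x z)"
proof -
  have "ev 1 x z \<noteq> 0 \<and> rational_near (\<lambda>u v. f (pt u v)) b 1"
    using assms by (simp add: rational_near_def)
  then show ?thesis
    using assms(1) regular_at_iff by blast
qed

end

section \<open>Tangent vectors\<close>

lemma tangent_add:
  assumes "D \<in> tangent_space V P" "regular_at V f P" "regular_at V h P"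
  shows "D (\<lambda>Q. f Q + h Q) = D f + D h"
  using assms unfolding tangent_space_def by blast

lemma tangent_mult:
  assumes "D \<in> tangent_space V P" "regular_at V f P" "regular_at V h P"
  shows "D (\<lambda>Q. f Q * h Q) = f P * D h + h P * D f"
  using assms unfolding tangent_space_def by blast

lemma tangent_scale:
  assumes "D \<in> tangent_space V P" "regular_at V f P"
  shows "D (\<lambda>Q. c * f Q) = c * D f"
  using assms unfolding tangent_space_def by blast

lemma tangent_germ:
  assumes "D \<in> tangent_space V P" "regular_at V f P" "regular_at V h P" "zariski_open V U" "P \<in> U"
    "\<And>Q. Q \<in> U \<Longrightarrow> f Q = h Q"
  shows "D f = D h"
  using assms unfolding tangent_space_def by blast

lemma tangent_nonregular:
  assumes "D \<in> tangent_space V P" "\<not> regular_at V f P"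
  shows "D f = 0"
  using assms unfolding tangent_space_def by blast

context drinfeld
begin

definition pfun :: "'a poly poly \<Rightarrow> 'a point \<Rightarrow> 'a" where
  "pfun b P = ev b (xc P) (zc P)"

lemma pfun_pt [simp]: "pfun b (pt x z) = ev b x z"
  by (simp add: pfun_def)

lemma regular_pfun: "on_curve x z \<Longrightarrow> regular_at C (pfun b) (pt x z)"
  by (rule regular_at_poly[of _ _ _ b]) simp_all

text \<open>On the curve x = x^q + z^(q+1). Applying D in characteristic p gives D x = z^q D z, and
  the derivation rules extend this to all polynomials. A tangent vector is therefore governed by its
  value on z.\<close>

lemma tangent_pfun:
  assumes D: "D \<in> tangent_space C (pt x z)" and xz: "on_curve x z"
  shows "D (pfun b) = ev (der q b) x z * D (pfun polyZ)"
proof -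
  note reg = regular_pfun[OF xz]
  have add: "D (pfun (a + b)) = D (pfun a) + D (pfun b)" for a b
    using tangent_add[OF D reg reg, of a b] by (simp add: pfun_def[abs_def])
  have mult: "D (pfun (a * b)) = ev a x z * D (pfun b) + ev b x z * D (pfun a)" for a b
    using tangent_mult[OF D reg reg, of a b] by (simp add: pfun_def[abs_def])
  have one: "D (pfun 1) = 0"
    using mult[of 1 1] by (simp only: mult_1 ev_1 add_cancel_right_right)
  have Dconst: "D (pfun [:[:c:]:]) = 0" for c
    using tangent_scale[OF D reg, of c 1] one by (simp add: pfun_def[abs_def])
  have power: "D (pfun (b ^ n)) = of_nat n * ev b x z ^ (n - 1) * D (pfun b)" for b n
  proof (induction n)
    case (Suc n)
    then show ?case by (cases n) (simp_all add: one mult algebra_simps)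
  qed (simp add: one)
  have "D (pfun polyX) = D (pfun (polyX ^ q + polyZ ^ (q + 1)))"
  proof (rule tangent_germ[OF D reg reg zariski_openI[of 1]])
    show "pt x z \<in> {pt u v |u v. on_curve u v \<and> ev 1 u v \<noteq> 0}"
      using xz by auto
  qed (auto simp: on_curve_def simp del: power_Suc)
  also have "\<dots> = z ^ q * D (pfun polyZ)"
    by (simp add: add power del: power_Suc)
  finally have X: "D (pfun polyX) = z ^ q * D (pfun polyZ)" .
  show ?thesis
  proof (induction b rule: poly_const_poly_induct)
    case (const c)
    then show ?case by (simp add: Dconst)
  qed (simp_all add: X add mult algebra_simps)
qed

section \<open>The tangent vector d/dz on quotients of polynomials\<close>

definition qder :: "'a poly poly \<Rightarrow> 'a poly poly \<Rightarrow> 'a \<Rightarrow> 'a \<Rightarrow> 'a" where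
  "qder a b x z = (ev (der q a) x z * ev b x z - ev a x z * ev (der q b) x z) / (ev b x z)\<^sup>2"

text \<open>Apply D to f b = a, which holds near the point, and solve for D f.\<close>

lemma tangent_rational:
  assumes D: "D \<in> tangent_space C (pt x z)" and xz: "on_curve x z"
    and ab: "ev b x z \<noteq> 0" "rational_near (\<lambda>u v. f (pt u v)) a b"
  shows "D f = qder a b x z * D (pfun polyZ)"
proof -
  have f: "regular_at C f (pt x z)"
    using ab xz regular_at_iff by blast
  have eq: "f (pt u v) * ev b u v = ev a u v" if "on_curve u v" "ev b u v \<noteq> 0" for u v
    using ab(2) that by (simp add: rational_near_def)
  let ?g = "\<lambda>Q. f Q * pfun b Q"
  have g: "regular_at C ?g (pt x z)"
    unfolding regular_at_iff[OF xz] using ab(1) eq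
    by (intro exI[of _ "a * b"] exI[of _ b]) (simp add: rational_near_def)
  have "D ?g = D (pfun a)"
  proof (rule tangent_germ[OF D g regular_pfun[OF xz] zariski_openI[of b]])
    show "pt x z \<in> {pt u v |u v. on_curve u v \<and> ev b u v \<noteq> 0}"
      using xz ab by auto
  qed (auto simp: eq)
  then have "f (pt x z) * D (pfun b) + ev b x z * D f = D (pfun a)"
    using tangent_mult[OF D f regular_pfun[OF xz], of b] by simp
  then have "ev b x z * D f = (ev (der q a) x z - f (pt x z) * ev (der q b) x z) * D (pfun polyZ)"
    unfolding tangent_pfun[OF D xz, of a] tangent_pfun[OF D xz, of b] by (simp add: algebra_simps)
  moreover have "f (pt x z) = ev a x z / ev b x z"
    using eq[OF xz ab(1)] ab(1) by (simp add: field_simps)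
  ultimately show ?thesis
    using ab(1) unfolding qder_def by (simp add: field_simps power2_eq_square)
qed

text \<open>The product of s b b' with a b' - a' b vanishes on the whole curve, hence so does its
  derivative. At the given point s b b' is nonzero and a b' - a' b is zero, so the derivative of a
  b' - a' b vanishes there. That is the equality of the two quotient rules, and it makes d/dz depend
  only on the germ.\<close>

lemma qder_unique:
  assumes xz: "on_curve x z" and "ev b x z \<noteq> 0" "ev b' x z \<noteq> 0" "ev s x z \<noteq> 0"
    and "rational_near f a b" "rational_near g a' b'"
    and "\<And>u v. on_curve u v \<Longrightarrow> ev s u v \<noteq> 0 \<Longrightarrow> f u v = g u v"
  shows "qder a b x z = qder a' b' x z"
proof -
  have 0: "ev (a * b' - a' * b) u v = 0" if "on_curve u v" "ev (s * b * b') u v \<noteq> 0" for u v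
  proof -
    have "f u v = g u v" using assms(7) that by simp
    moreover have "f u v * ev b u v = ev a u v" "g u v * ev b' u v = ev a' u v"
      using assms(5,6) that by (simp_all add: rational_near_def)
    ultimately have "f u v * ev b u v = ev a u v" "f u v * ev b' u v = ev a' u v" by simp_all
    then show ?thesis by (simp add: mult_ac flip: \<open>f u v * ev b u v = ev a u v\<close> \<open>f u v * ev b' u v = ev a' u v\<close>)
  qed
  have nz: "ev (s * b * b') x z \<noteq> 0" using assms by simp
  have "ev (s * b * b' * (a * b' - a' * b)) u v = 0" if "on_curve u v" for u v
    using 0[OF that] by (cases "ev (s * b * b') u v = 0") simp_all
  then have "ev (der q (s * b * b' * (a * b' - a' * b))) x z = 0"
    using vanishing_everywhere(2) xz by blast
  then have "ev (der q (s * b * b')) x z * ev (a * b' - a' * b) x z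
      + ev (s * b * b') x z * ev (der q (a * b' - a' * b)) x z = 0"
    by (subst (asm) der_mult) simp
  then have "ev (der q (a * b' - a' * b)) x z = 0"
    using 0[OF xz nz] nz by simp
  \<comment> \<open>The common value of the two quotients at the point; substituting a = t b and a'
    = t b' linearises both quotient rules.\<close>
  moreover define t where "t = ev a x z / ev b x z"
  then have a: "ev a x z = t * ev b x z" using assms by simp
  have a': "ev a' x z = t * ev b' x z"
    using 0[OF xz nz] assms unfolding t_def by (simp add: field_simps)
  ultimately have "(ev (der q a) x z - t * ev (der q b) x z) * ev b' x z
     = (ev (der q a') x z - t * ev (der q b') x z) * ev b x z"
    by (simp add: a algebra_simps)
  moreover have "qder a b x z = (ev (der q a) x z - t * ev (der q b) x z) / ev b x z"
    "qder a' b' x z = (ev (der q a') x z - t * ev (der q b') x z) / ev b' x z"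
    unfolding qder_def a a' using assms by (simp_all add: field_simps power2_eq_square)
  ultimately show ?thesis
    using assms by (simp add: frac_eq_eq)
qed

text \<open>The derivation d/dz at a chart point. The pair (a, b) is an arbitrary choice, harmless
  by \<open>qder_unique\<close>; the value 0 on non-regular functions is the convention of
  \<open>tangent_space\<close>.\<close>

definition tv :: "'a \<Rightarrow> 'a \<Rightarrow> ('a point \<Rightarrow> 'a) \<Rightarrow> 'a" where
  "tv x z f = (if regular_at C f (pt x z) then
     (case SOME (a, b). ev b x z \<noteq> 0 \<and> rational_near (\<lambda>u v. f (pt u v)) a b of (a, b) \<Rightarrow> qder a b x z)
     else 0)"

lemma tv_eq:
  assumes xz: "on_curve x z" and ab: "ev b x z \<noteq> 0" "rational_near (\<lambda>u v. f (pt u v)) a b"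
  shows "tv x z f = qder a b x z"
proof -
  let ?P = "\<lambda>(a, b). ev b x z \<noteq> 0 \<and> rational_near (\<lambda>u v. f (pt u v)) a b"
  have f: "regular_at C f (pt x z)"
    using ab xz regular_at_iff by blast
  define ab' where "ab' = (SOME ab. ?P ab)"
  have "?P ab'" unfolding ab'_def
    by (rule someI[of ?P "(a, b)"]) (use ab in simp)
  then obtain a' b' where ab': "ab' = (a', b')" "ev b' x z \<noteq> 0" "rational_near (\<lambda>u v. f (pt u v)) a' b'"
    by (cases ab') auto
  then have "tv x z f = qder a' b' x z"
    using f unfolding tv_def ab'_def[symmetric] by simp
  also have "\<dots> = qder a b x z"
    using qder_unique[OF xz ab'(2) ab(1), of 1] ab'(3) ab(2) by simp
  finally show ?thesis .
qed

lemma tv_in_tangent_space: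
  assumes xz: "on_curve x z"
  shows "tv x z \<in> tangent_space C (pt x z)"
proof -
  have 1: "tv x z (\<lambda>Q. f Q + h Q) = tv x z f + tv x z h \<and>
      tv x z (\<lambda>Q. f Q * h Q) = f (pt x z) * tv x z h + h (pt x z) * tv x z f"
    if fh: "regular_at C f (pt x z)" "regular_at C h (pt x z)" for f h
  proof -
    obtain a b where ab: "ev b x z \<noteq> 0" "rational_near (\<lambda>u v. f (pt u v)) a b"
      using fh(1) regular_at_iff[OF xz] by blast
    obtain c d where cd: "ev d x z \<noteq> 0" "rational_near (\<lambda>u v. h (pt u v)) c d"
      using fh(2) regular_at_iff[OF xz] by blast
    have eqf: "f (pt u v) * ev b u v = ev a u v" if "on_curve u v" "ev b u v \<noteq> 0" for u v
      using ab(2) that by (simp add: rational_near_def)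
    have eqh: "h (pt u v) * ev d u v = ev c u v" if "on_curve u v" "ev d u v \<noteq> 0" for u v
      using cd(2) that by (simp add: rational_near_def)
    have bd: "ev (b * d) x z \<noteq> 0" using ab cd by simp
    have sum: "rational_near (\<lambda>u v. f (pt u v) + h (pt u v)) (a * d + c * b) (b * d)"
      unfolding rational_near_def by (auto simp: algebra_simps simp flip: eqf eqh)
    have prod: "rational_near (\<lambda>u v. f (pt u v) * h (pt u v)) (a * c) (b * d)"
      unfolding rational_near_def by (auto simp: algebra_simps simp flip: eqf eqh)
    have f: "f (pt x z) = ev a x z / ev b x z" and h: "h (pt x z) = ev c x z / ev d x z"
      using eqf[OF xz ab(1)] eqh[OF xz cd(1)] ab(1) cd(1) by (simp_all add: field_simps)
    show ?thesis
      unfolding tv_eq[OF xz bd sum] tv_eq[OF xz bd prod] tv_eq[OF xz ab] tv_eq[OF xz cd] f h qder_def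
      using ab(1) cd(1) by (simp add: field_simps power2_eq_square)
  qed
  have 2: "tv x z (\<lambda>Q. c * f Q) = c * tv x z f" if f: "regular_at C f (pt x z)" for c f
  proof -
    obtain a b where ab: "ev b x z \<noteq> 0" "rational_near (\<lambda>u v. f (pt u v)) a b"
      using f regular_at_iff[OF xz] by blast
    have "rational_near (\<lambda>u v. c * f (pt u v)) ([:[:c:]:] * a) b"
      using ab(2) by (simp add: rational_near_def mult.assoc)
    from tv_eq[OF xz ab(1) this] show ?thesis
      unfolding tv_eq[OF xz ab] qder_def by (simp only: der_mult der_const) (simp add: algebra_simps)
  qed
  have 3: "tv x z f = tv x z h"
    if fh: "regular_at C f (pt x z)" "regular_at C h (pt x z)" and U: "zariski_open C U" "pt x z \<in> U"
      and eq: "\<forall>Q\<in>U. f Q = h Q" for f h U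
  proof -
    obtain a b where ab: "ev b x z \<noteq> 0" "rational_near (\<lambda>u v. f (pt u v)) a b"
      using fh(1) regular_at_iff[OF xz] by blast
    obtain c d where cd: "ev d x z \<noteq> 0" "rational_near (\<lambda>u v. h (pt u v)) c d"
      using fh(2) regular_at_iff[OF xz] by blast
    obtain s where s: "ev s x z \<noteq> 0" "\<And>u v. on_curve u v \<Longrightarrow> ev s u v \<noteq> 0 \<Longrightarrow> pt u v \<in> U"
      using zariski_openD[OF U] by blast
    show ?thesis
      unfolding tv_eq[OF xz ab] tv_eq[OF xz cd]
      using qder_unique[OF xz ab(1) cd(1) s(1) ab(2) cd(2)] s(2) eq by blast
  qed
  have 4: "tv x z f = 0" if "\<not> regular_at C f (pt x z)" for f
    using that by (simp add: tv_def)
  show ?thesis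
    unfolding tangent_space_def using 1 2 3 4 by blast
qed

lemma tv_Z [simp]: "on_curve x z \<Longrightarrow> tv x z (pfun polyZ) = 1"
  by (subst tv_eq[of _ _ 1 _ polyZ]) (simp_all add: rational_near_def qder_def)

text \<open>Together with \<open>tv_in_tangent_space\<close> and \<open>tv_Z\<close> this shows that
  the tangent space is the line spanned by \<open>tv x z\<close>, with coordinate D z.\<close>

lemma tangent_eq_tv:
  assumes D: "D \<in> tangent_space C (pt x z)" and xz: "on_curve x z"
  shows "D f = tv x z f * D (pfun polyZ)"
proof (cases "regular_at C f (pt x z)")
  case True
  then obtain a b where "ev b x z \<noteq> 0" "rational_near (\<lambda>u v. f (pt u v)) a b"
    using regular_at_iff[OF xz] by blast
  then show ?thesis
    using tangent_rational[OF D xz] tv_eq[OF xz] by metis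
next
  case False
  then show ?thesis
    using tangent_nonregular[OF D] by (simp add: tv_def)
qed


section \<open>Differential forms on the affine chart\<close>

text \<open>The coefficient f in \<omega> = f dz, since dz takes the value 1 on
  \<open>tv x z\<close>.\<close>

definition form_coeff :: "'a diff_form \<Rightarrow> 'a \<Rightarrow> 'a \<Rightarrow> 'a" where
  "form_coeff \<omega> x z = \<omega> (pt x z) (tv x z)"

lemma holomorphicD:
  assumes "\<omega> \<in> holomorphic_differentials V" "P \<in> V"
  obtains U n f h where "zariski_open V U" "P \<in> U"
    "\<And>i Q. i < (n::nat) \<Longrightarrow> Q \<in> U \<Longrightarrow> regular_at V (f i) Q \<and> regular_at V (h i) Q"
    "\<And>Q D. Q \<in> U \<Longrightarrow> D \<in> tangent_space V Q \<Longrightarrow> \<omega> Q D = (\<Sum>i<n. f i Q * D (h i))"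
proof -
  from assms have "\<exists>U. zariski_open V U \<and> P \<in> U \<and>
            (\<exists>(n::nat) f h. (\<forall>i<n. \<forall>Q\<in>U. regular_at V (f i) Q \<and> regular_at V (h i) Q) \<and>
               (\<forall>Q\<in>U. \<forall>D\<in>tangent_space V Q. \<omega> Q D = (\<Sum>i<n. f i Q * D (h i))))"
    unfolding holomorphic_differentials_def by blast
  then obtain U n f h where "zariski_open V U" "P \<in> U"
    "\<forall>i<n. \<forall>Q\<in>U. regular_at V (f i) Q \<and> regular_at V (h i) Q"
    "\<forall>Q\<in>U. \<forall>D\<in>tangent_space V Q. \<omega> Q D = (\<Sum>i<n::nat. f i Q * D (h i))"
    by (elim exE conjE)
  then show ?thesis using that by blast
qed

lemma holomorphic_eq_coeff:
  assumes \<omega>: "\<omega> \<in> holomorphic_differentials C" and xz: "on_curve x z"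
    and D: "D \<in> tangent_space C (pt x z)"
  shows "\<omega> (pt x z) D = form_coeff \<omega> x z * D (pfun polyZ)"
proof -
  have "pt x z \<in> C" using xz by simp
  obtain U n f h where U: "pt x z \<in> U" and eq:
    "\<And>Q D. Q \<in> U \<Longrightarrow> D \<in> tangent_space C Q \<Longrightarrow> \<omega> Q D = (\<Sum>i<n::nat. f i Q * D (h i))"
    by (rule holomorphicD[OF \<omega> \<open>pt x z \<in> C\<close>]) (rule that)
  have "\<omega> (pt x z) D = (\<Sum>i<n. f i (pt x z) * D (h i))"
    by (rule eq[OF U D])
  also have "\<dots> = (\<Sum>i<n. f i (pt x z) * tv x z (h i)) * D (pfun polyZ)"
    unfolding sum_distrib_right
    by (intro sum.cong refl) (simp add: tangent_eq_tv[OF D xz, of "h _"] mult.assoc)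
  also have "(\<Sum>i<n. f i (pt x z) * tv x z (h i)) = form_coeff \<omega> x z"
    unfolding form_coeff_def by (rule eq[OF U tv_in_tangent_space[OF xz], symmetric])
  finally show ?thesis .
qed

section \<open>Coefficients of holomorphic forms are polynomials on the chart\<close>

lemma rational_near_add:
  assumes "rational_near f a b" "rational_near g c d"
  shows "rational_near (\<lambda>u v. f u v + g u v) (a * d + c * b) (b * d)"
  unfolding rational_near_def
proof (intro allI impI)
  fix u v assume "on_curve u v" "ev (b * d) u v \<noteq> 0"
  then have "f u v * ev b u v = ev a u v" "g u v * ev d u v = ev c u v"
    using assms by (auto simp: rational_near_def)
  then show "(f u v + g u v) * ev (b * d) u v = ev (a * d + c * b) u v"
    by (simp add: algebra_simps flip: \<open>f u v * ev b u v = ev a u v\<close> \<open>g u v * ev d u v = ev c u v\<close>)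
qed

lemma rational_near_mult:
  assumes "rational_near f a b" "rational_near g c d"
  shows "rational_near (\<lambda>u v. f u v * g u v) (a * c) (b * d)"
  unfolding rational_near_def
proof (intro allI impI)
  fix u v assume "on_curve u v" "ev (b * d) u v \<noteq> 0"
  then have "f u v * ev b u v = ev a u v" "g u v * ev d u v = ev c u v"
    using assms by (auto simp: rational_near_def)
  then show "f u v * g u v * ev (b * d) u v = ev (a * c) u v"
    by (simp add: algebra_simps flip: \<open>f u v * ev b u v = ev a u v\<close> \<open>g u v * ev d u v = ev c u v\<close>)
qed

lemma rational_near_sum:
  assumes "\<And>i. i < n \<Longrightarrow> \<exists>a b. ev b x z \<noteq> 0 \<and> rational_near (f i) a b"
  shows "\<exists>a b. ev b x z \<noteq> 0 \<and> rational_near (\<lambda>u v. \<Sum>i<n::nat. f i u v) a b"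
  using assms
proof (induction n)
  case 0
  then show ?case by (intro exI[of _ 0] exI[of _ 1]) (simp add: rational_near_def)
next
  case (Suc n)
  obtain a b where ab: "ev b x z \<noteq> 0" "rational_near (\<lambda>u v. \<Sum>i<n. f i u v) a b"
    using Suc by auto
  obtain c d where cd: "ev d x z \<noteq> 0" "rational_near (f n) c d"
    using Suc.prems[of n] by auto
  have "ev (b * d) x z \<noteq> 0" using ab cd by simp
  then show ?case
    using rational_near_add[OF ab(2) cd(2)] unfolding sum.lessThan_Suc by blast
qed

text \<open>A local expression with functions f_i and h_i makes the coefficient the sum of the f_i
  times the z-derivatives of the h_i, a quotient of polynomials near each point. It then remains to
  glue these quotients.\<close>

lemma holomorphic_coeff_poly:
  assumes \<omega>: "\<omega> \<in> holomorphic_differentials C"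
  obtains a where "\<And>x z. on_curve x z \<Longrightarrow> form_coeff \<omega> x z = ev a x z"
proof -
  have "\<exists>a b. ev b x z \<noteq> 0 \<and> (\<forall>u v. on_curve u v \<longrightarrow> form_coeff \<omega> u v * ev b u v = ev a u v)"
    if xz: "on_curve x z" for x z
  proof -
    have "pt x z \<in> C" using xz by simp
    obtain U n f h where U: "zariski_open C U" "pt x z \<in> U" and
      reg: "\<And>i Q. i < (n::nat) \<Longrightarrow> Q \<in> U \<Longrightarrow> regular_at C (f i) Q \<and> regular_at C (h i) Q" and
      eq: "\<And>Q D. Q \<in> U \<Longrightarrow> D \<in> tangent_space C Q \<Longrightarrow> \<omega> Q D = (\<Sum>i<n. f i Q * D (h i))"
      by (rule holomorphicD[OF \<omega> \<open>pt x z \<in> C\<close>]) (rule that)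
    obtain s where s: "ev s x z \<noteq> 0" "\<And>u v. on_curve u v \<Longrightarrow> ev s u v \<noteq> 0 \<Longrightarrow> pt u v \<in> U"
      using zariski_openD[OF U] by blast
    have "\<exists>a b. ev b x z \<noteq> 0 \<and> rational_near (\<lambda>u v. f i (pt u v) * tv u v (h i)) a b" if i: "i < n" for i
    proof -
      obtain a b where ab: "ev b x z \<noteq> 0" "rational_near (\<lambda>u v. f i (pt u v)) a b"
        using reg[OF i U(2)] regular_at_iff[OF xz] by blast
      obtain c d where cd: "ev d x z \<noteq> 0" "rational_near (\<lambda>u v. h i (pt u v)) c d"
        using reg[OF i U(2)] regular_at_iff[OF xz] by blast
      have "rational_near (\<lambda>u v. tv u v (h i)) (der q c * d - c * der q d) (d\<^sup>2)"
        unfolding rational_near_def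
      proof (intro allI impI)
        fix u v assume uv: "on_curve u v" "ev (d\<^sup>2) u v \<noteq> 0"
        then have "ev d u v \<noteq> 0" by simp
        then show "tv u v (h i) * ev (d\<^sup>2) u v = ev (der q c * d - c * der q d) u v"
          by (simp add: tv_eq[OF uv(1) _ cd(2)] qder_def)
      qed
      from rational_near_mult[OF ab(2) this] show ?thesis
        using ab cd by (intro exI[of _ "a * (der q c * d - c * der q d)"] exI[of _ "b * d\<^sup>2"]) simp
    qed
    from rational_near_sum[of n x z "\<lambda>i u v. f i (pt u v) * tv u v (h i)", OF this]
    obtain a b where ab: "ev b x z \<noteq> 0"
      "rational_near (\<lambda>u v. \<Sum>i<n. f i (pt u v) * tv u v (h i)) a b" by blast
    \<comment> \<open>The common factor s b makes the identity trivial wherever the local expression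
      is not valid, so it holds on the whole curve, as the gluing lemma demands.\<close>
    have "form_coeff \<omega> u v * ev (s * b * (s * b)) u v = ev (s * b * (s * a)) u v" if uv: "on_curve u v" for u v
    proof (cases "ev (s * b) u v = 0")
      case False
      then have "form_coeff \<omega> u v = (\<Sum>i<n. f i (pt u v) * tv u v (h i))"
        unfolding form_coeff_def using eq s(2)[OF uv] tv_in_tangent_space[OF uv] by simp
      moreover have "(\<Sum>i<n. f i (pt u v) * tv u v (h i)) * ev b u v = ev a u v"
        using ab(2) uv False by (simp add: rational_near_def)
      ultimately show ?thesis by (simp add: mult_ac)
    qed auto
    then show ?thesis using s(1) ab(1) by (intro exI[of _ "s * b * (s * a)"] exI[of _ "s * b * (s * b)"]) simp
  qed
  then show ?thesis
    using locally_fraction_imp_poly[of "form_coeff \<omega>"] that by blast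
qed

end

section \<open>Pull-back under the group action\<close>

lemma zariski_open_Int:
  assumes "zariski_open V U" "zariski_open V U'"
  shows "zariski_open V (U \<inter> U')"
proof -
  obtain S where S: "S \<subseteq> (\<Union>d. homogeneous d)" "U = {P\<in>V. \<exists>A\<in>S. \<forall>v\<in>P. A v \<noteq> 0}"
    using assms(1) unfolding zariski_open_def by auto
  obtain S' where S': "S' \<subseteq> (\<Union>d. homogeneous d)" "U' = {P\<in>V. \<exists>A\<in>S'. \<forall>v\<in>P. A v \<noteq> 0}"
    using assms(2) unfolding zariski_open_def by auto
  define T where "T = {\<lambda>v. A v * B v | A B. A \<in> S \<and> B \<in> S'}"
  have "T \<subseteq> (\<Union>d. homogeneous d)"
    using S(1) S'(1) homogeneous_mult unfolding T_def by fastforce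
  moreover have "U \<inter> U' = {P\<in>V. \<exists>A\<in>T. \<forall>v\<in>P. A v \<noteq> 0}"
    unfolding S(2) S'(2) T_def by fastforce
  ultimately show ?thesis
    unfolding zariski_open_def by blast
qed

lemma regular_atI:
  assumes "zariski_open V U" "P \<in> U" "A \<in> homogeneous d" "B \<in> homogeneous d"
    and "\<And>Q v. Q \<in> U \<Longrightarrow> v \<in> Q \<Longrightarrow> B v \<noteq> 0" "\<And>Q v. Q \<in> U \<Longrightarrow> v \<in> Q \<Longrightarrow> f Q = A v / B v"
  shows "regular_at V f P"
  unfolding regular_at_def
proof (intro exI conjI)
  show "\<exists>A\<in>homogeneous d. \<exists>B\<in>homogeneous d. \<forall>Q\<in>U. \<forall>v\<in>Q. B v \<noteq> 0 \<and> f Q = A v / B v"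
    by (rule bexI[OF _ assms(3)], rule bexI[OF _ assms(4)]) (simp add: assms(5,6))
qed (fact assms)+

lemma regular_atE:
  assumes "regular_at V f P"
  obtains U d A B where "zariski_open V U" "P \<in> U" "A \<in> homogeneous d" "B \<in> homogeneous d"
    "\<And>Q v. Q \<in> U \<Longrightarrow> v \<in> Q \<Longrightarrow> B v \<noteq> 0" "\<And>Q v. Q \<in> U \<Longrightarrow> v \<in> Q \<Longrightarrow> f Q = A v / B v"
  using assms unfolding regular_at_def by (elim exE conjE bexE) simp

lemma regular_at_add:
  assumes "regular_at V f P" "regular_at V h P"
  shows "regular_at V (\<lambda>Q. f Q + h Q) P"
    and "regular_at V (\<lambda>Q. f Q * h Q) P"
proof -
  obtain U d A B where 1: "zariski_open V U" "P \<in> U" "A \<in> homogeneous d" "B \<in> homogeneous d"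
    "\<And>Q v. Q \<in> U \<Longrightarrow> v \<in> Q \<Longrightarrow> B v \<noteq> 0" "\<And>Q v. Q \<in> U \<Longrightarrow> v \<in> Q \<Longrightarrow> f Q = A v / B v"
    by (rule regular_atE[OF assms(1)]) (rule that)
  obtain U' d' A' B' where 2: "zariski_open V U'" "P \<in> U'" "A' \<in> homogeneous d'" "B' \<in> homogeneous d'"
    "\<And>Q v. Q \<in> U' \<Longrightarrow> v \<in> Q \<Longrightarrow> B' v \<noteq> 0" "\<And>Q v. Q \<in> U' \<Longrightarrow> v \<in> Q \<Longrightarrow> h Q = A' v / B' v"
    by (rule regular_atE[OF assms(2)]) (rule that)
  have U: "zariski_open V (U \<inter> U')" "P \<in> U \<inter> U'"
    using 1(1,2) 2(1,2) zariski_open_Int by auto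
  have B: "(\<lambda>v. B v * B' v) \<in> homogeneous (d + d')"
    by (rule homogeneous_mult[OF 1(4) 2(4)])
  show "regular_at V (\<lambda>Q. f Q + h Q) P"
  proof (rule regular_atI[OF U _ B])
    show "(\<lambda>v. A v * B' v + B v * A' v) \<in> homogeneous (d + d')"
      by (rule homogeneous_add[OF homogeneous_mult[OF 1(3) 2(4)] homogeneous_mult[OF 1(4) 2(3)]])
    fix Q v assume "Q \<in> U \<inter> U'" "v \<in> Q"
    then show "B v * B' v \<noteq> 0" "f Q + h Q = (A v * B' v + B v * A' v) / (B v * B' v)"
      using 1(5)[of Q v] 1(6)[of Q v] 2(5)[of Q v] 2(6)[of Q v] by (simp_all add: field_simps)
  qed
  show "regular_at V (\<lambda>Q. f Q * h Q) P"
  proof (rule regular_atI[OF U homogeneous_mult[OF 1(3) 2(3)] B])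
    fix Q v assume "Q \<in> U \<inter> U'" "v \<in> Q"
    then show "B v * B' v \<noteq> 0" "f Q * h Q = (A v * A' v) / (B v * B' v)"
      using 1(5)[of Q v] 1(6)[of Q v] 2(5)[of Q v] 2(6)[of Q v] by simp_all
  qed
qed

lemma regular_at_scale:
  assumes "regular_at V f P"
  shows "regular_at V (\<lambda>Q. c * f Q) P"
proof -
  obtain U d A B where 1: "zariski_open V U" "P \<in> U" "A \<in> homogeneous d" "B \<in> homogeneous d"
    "\<And>Q v. Q \<in> U \<Longrightarrow> v \<in> Q \<Longrightarrow> B v \<noteq> 0" "\<And>Q v. Q \<in> U \<Longrightarrow> v \<in> Q \<Longrightarrow> f Q = A v / B v"
    by (rule regular_atE[OF assms]) (rule that)
  show ?thesis
    by (rule regular_atI[OF 1(1,2) homogeneous_scale[OF 1(3), of c] 1(4,5)]) (simp_all add: 1(6))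
qed

lemma point_act_altdef: "point_act g P = lin_act g ` P"
  unfolding point_act_def lin_act_def ..

lemma point_act_mult: "point_act (g ** h) P = point_act g (point_act h P)"
  by (simp add: point_act_altdef image_image lin_act_mult)

lemma point_act_one: "point_act (mat 1) P = P"
  by (simp add: point_act_altdef lin_act_one)

context drinfeld
begin

abbreviation G :: "('a^2^2) monoid" where "G \<equiv> SL2 Fq"

lemma G_iff: "g \<in> carrier G \<longleftrightarrow>
    g$1$1 \<in> Fq \<and> g$1$2 \<in> Fq \<and> g$2$1 \<in> Fq \<and> g$2$2 \<in> Fq \<and> g$1$1 * g$2$2 - g$1$2 * g$2$1 = 1"
  by (auto simp: SL2_def forall_2 det_2)

lemma G_frob:
  assumes "g \<in> carrier G"
  shows "(g$i$1 * x + g$i$2 * y) ^ q = g$i$1 * x ^ q + g$i$2 * y ^ q"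
proof -
  have "(g$i$j) ^ q = g$i$j" for j
    using assms Fq_pow by (auto simp: SL2_def)
  then show ?thesis
    by (simp add: frob_add power_mult_distrib)
qed

text \<open>The q-th power fixes the entries of g, so X Y^q - X^q Y behaves like a 2 by 2
  determinant and is multiplied by det g = 1, while Z is fixed.\<close>

lemma point_act_C:
  assumes g: "g \<in> carrier G" and P: "P \<in> C"
  shows "point_act g P \<in> C"
proof -
  obtain v where v: "P = ppoint v" "v \<noteq> 0" "v$1 * (v$2)^q - (v$1)^q * v$2 = (v$3)^(q + 1)"
    by (rule C_cases[OF P])
  have det: "g$1$1 * g$2$2 - g$1$2 * g$2$1 = 1" using g by (simp add: G_iff)
  then have "lin_act g v \<noteq> 0"
    using v(2) by (intro lin_act_nonzero) (simp_all add: det_2)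
  moreover have "lin_act g v $ 1 * (lin_act g v $ 2)^q - (lin_act g v $ 1)^q * lin_act g v $ 2
      = (g$1$1 * g$2$2 - g$1$2 * g$2$1) * (v$1 * (v$2)^q - (v$1)^q * v$2)"
    by (simp only: lin_act_nth G_frob[OF g]) (simp add: algebra_simps)
  then have "lin_act g v $ 1 * (lin_act g v $ 2)^q - (lin_act g v $ 1)^q * lin_act g v $ 2 = (lin_act g v $ 3)^(q + 1)"
    unfolding det v(3) by simp
  ultimately show ?thesis
    unfolding v(1) point_act_ppoint ppoint_in_C by blast
qed

lemma zariski_open_act:
  assumes g: "g \<in> carrier G" and U: "zariski_open C U"
  shows "zariski_open C {P\<in>C. point_act g P \<in> U}"
proof -
  obtain S where S: "S \<subseteq> (\<Union>d. homogeneous d)" "U = {P\<in>C. \<exists>A\<in>S. \<forall>v\<in>P. A v \<noteq> 0}"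
    using U unfolding zariski_open_def by auto
  define T where "T = (\<lambda>A v. A (lin_act g v)) ` S"
  have "T \<subseteq> (\<Union>d. homogeneous d)"
    using S(1) homogeneous_lin_act unfolding T_def by fastforce
  moreover have "{P\<in>C. point_act g P \<in> U} = {P\<in>C. \<exists>A\<in>T. \<forall>v\<in>P. A v \<noteq> 0}"
    unfolding S(2) T_def using point_act_C[OF g] by (auto simp: point_act_altdef)
  ultimately show ?thesis
    unfolding zariski_open_def by blast
qed

lemma regular_at_act:
  assumes g: "g \<in> carrier G" and P: "P \<in> C" and f: "regular_at C f (point_act g P)"
  shows "regular_at C (f \<circ> point_act g) P"
proof -
  obtain U d A B where 1: "zariski_open C U" "point_act g P \<in> U" "A \<in> homogeneous d" "B \<in> homogeneous d"
    "\<And>Q v. Q \<in> U \<Longrightarrow> v \<in> Q \<Longrightarrow> B v \<noteq> 0" "\<And>Q v. Q \<in> U \<Longrightarrow> v \<in> Q \<Longrightarrow> f Q = A v / B v"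
    by (rule regular_atE[OF f]) (rule that)
  show ?thesis
  proof (rule regular_atI[OF zariski_open_act[OF g 1(1)] _ homogeneous_lin_act[OF 1(3), of g] homogeneous_lin_act[OF 1(4), of g]])
    show "P \<in> {P\<in>C. point_act g P \<in> U}" using P 1(2) by simp
    fix Q v assume "Q \<in> {P\<in>C. point_act g P \<in> U}" "v \<in> Q"
    then have "point_act g Q \<in> U" "lin_act g v \<in> point_act g Q" by (auto simp: point_act_altdef)
    then show "B (lin_act g v) \<noteq> 0" "(f \<circ> point_act g) Q = A (lin_act g v) / B (lin_act g v)"
      using 1(5,6) by simp_all
  qed
qed

lemma tangent_map_in:
  assumes g: "g \<in> carrier G" and P: "P \<in> C" and D: "D \<in> tangent_space C P"
  shows "tangent_map C (point_act g) P D \<in> tangent_space C (point_act g P)"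
proof -
  let ?T = "tangent_map C (point_act g) P D" and ?P = "point_act g P"
  note reg = regular_at_act[OF g P]
  have T: "?T f = D (f \<circ> point_act g)" if "regular_at C f ?P" for f
    using that by (simp add: tangent_map_def)
  have 1: "?T (\<lambda>Q. f Q + h Q) = ?T f + ?T h \<and> ?T (\<lambda>Q. f Q * h Q) = f ?P * ?T h + h ?P * ?T f"
    if "regular_at C f ?P" "regular_at C h ?P" for f h
    using tangent_add[OF D reg[OF that(1)] reg[OF that(2)]] tangent_mult[OF D reg[OF that(1)] reg[OF that(2)]]
      regular_at_add[OF that] that by (simp add: T o_def)
  have 2: "?T (\<lambda>Q. c * f Q) = c * ?T f" if "regular_at C f ?P" for c f
    using tangent_scale[OF D reg[OF that]] regular_at_scale[OF that] that by (simp add: T o_def)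
  have 3: "?T f = ?T h" if "regular_at C f ?P" "regular_at C h ?P" "zariski_open C U" "?P \<in> U"
    "\<forall>Q\<in>U. f Q = h Q" for f h U
    using tangent_germ[OF D reg[OF that(1)] reg[OF that(2)] zariski_open_act[OF g that(3)]] that P
    by (auto simp: T)
  have 4: "?T f = 0" if "\<not> regular_at C f ?P" for f
    using that by (simp add: tangent_map_def)
  show ?thesis
    unfolding tangent_space_def using 1 2 3 4 by blast
qed

lemma holomorphic_outside:
  "\<omega> \<in> holomorphic_differentials V \<Longrightarrow> \<not> (P \<in> V \<and> D \<in> tangent_space V P) \<Longrightarrow> \<omega> P D = 0"
  unfolding holomorphic_differentials_def by blast

lemma holomorphicI:
  assumes "\<And>P D. \<not> (P \<in> V \<and> D \<in> tangent_space V P) \<Longrightarrow> \<omega> P D = 0"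
    and "\<And>P. P \<in> V \<Longrightarrow> \<exists>U. zariski_open V U \<and> P \<in> U \<and>
            (\<exists>(n::nat) f h. (\<forall>i<n. \<forall>Q\<in>U. regular_at V (f i) Q \<and> regular_at V (h i) Q) \<and>
               (\<forall>Q\<in>U. \<forall>D\<in>tangent_space V Q. \<omega> Q D = (\<Sum>i<n. f i Q * D (h i))))"
  shows "\<omega> \<in> holomorphic_differentials V"
  unfolding holomorphic_differentials_def
  by (rule CollectI, rule conjI; intro allI impI ballI; rule assms)

abbreviation pull :: "'a^2^2 \<Rightarrow> 'a diff_form \<Rightarrow> 'a diff_form" where
  "pull g \<equiv> pullback C C (point_act g)"

lemma pull_eq:
  "P \<in> C \<Longrightarrow> D \<in> tangent_space C P \<Longrightarrow> pull g \<omega> P D = \<omega> (point_act g P) (tangent_map C (point_act g) P D)"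
  by (simp add: pullback_def)

lemma pull_holomorphic:
  assumes g: "g \<in> carrier G" and \<omega>: "\<omega> \<in> holomorphic_differentials C"
  shows "pull g \<omega> \<in> holomorphic_differentials C"
proof (rule holomorphicI)
  fix P assume P: "P \<in> C"
  obtain U n f h where U: "zariski_open C U" "point_act g P \<in> U" and
    reg: "\<And>i Q. i < (n::nat) \<Longrightarrow> Q \<in> U \<Longrightarrow> regular_at C (f i) Q \<and> regular_at C (h i) Q" and
    eq: "\<And>Q D. Q \<in> U \<Longrightarrow> D \<in> tangent_space C Q \<Longrightarrow> \<omega> Q D = (\<Sum>i<n. f i Q * D (h i))"
    by (rule holomorphicD[OF \<omega> point_act_C[OF g P]]) (rule that)
  let ?U = "{P\<in>C. point_act g P \<in> U}"
  have "zariski_open C ?U" "P \<in> ?U"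
    using zariski_open_act[OF g U(1)] U(2) P by auto
  moreover have "\<forall>i<n. \<forall>Q\<in>?U. regular_at C (f i \<circ> point_act g) Q \<and> regular_at C (h i \<circ> point_act g) Q"
    using reg regular_at_act[OF g] by blast
  moreover have "pull g \<omega> Q D = (\<Sum>i<n. (f i \<circ> point_act g) Q * D (h i \<circ> point_act g))"
    if Q: "Q \<in> ?U" and D: "D \<in> tangent_space C Q" for Q D
  proof -
    have "pull g \<omega> Q D = (\<Sum>i<n. f i (point_act g Q) * tangent_map C (point_act g) Q D (h i))"
      using Q D eq tangent_map_in[OF g _ D] by (simp add: pull_eq)
    also have "\<dots> = (\<Sum>i<n. (f i \<circ> point_act g) Q * D (h i \<circ> point_act g))"
      using reg Q by (intro sum.cong refl) (simp add: tangent_map_def)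
    finally show ?thesis .
  qed
  ultimately show "\<exists>U. zariski_open C U \<and> P \<in> U \<and>
            (\<exists>(n::nat) f h. (\<forall>i<n. \<forall>Q\<in>U. regular_at C (f i) Q \<and> regular_at C (h i) Q) \<and>
               (\<forall>Q\<in>U. \<forall>D\<in>tangent_space C Q. pull g \<omega> Q D = (\<Sum>i<n. f i Q * D (h i))))"
    by (intro exI[of _ ?U] exI[of _ n] exI[of _ "\<lambda>i. f i \<circ> point_act g"] exI[of _ "\<lambda>i. h i \<circ> point_act g"] conjI) simp_all
qed (auto simp: pullback_def)

lemma point_act_pt:
  assumes "g$2$1 * x + g$2$2 \<noteq> 0"
  shows "point_act g (pt x z) =
    pt ((g$1$1 * x + g$1$2) / (g$2$1 * x + g$2$2)) (z / (g$2$1 * x + g$2$2))"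
  using ppoint_eq_pt[of "lin_act g (vector [x, 1, z])"] assms
  by (simp add: pt_def[of x z] point_act_ppoint)

lemma power_q_diff_2: "c \<noteq> 0 \<Longrightarrow> c ^ q / c\<^sup>2 = c ^ (q - 2)" for c :: 'a
  using q_ge by (simp add: power_diff)

text \<open>The form \<open>dz\<close> is an automorphic form of weight \<open>q - 2\<close>.\<close>

lemma form_coeff_pull:
  assumes g: "g \<in> carrier G" and \<omega>: "\<omega> \<in> holomorphic_differentials C" and xz: "on_curve x z"
    and nz: "g$2$1 * x + g$2$2 \<noteq> 0"
  shows "form_coeff (pull g \<omega>) x z = form_coeff \<omega> ((g$1$1 * x + g$1$2) / (g$2$1 * x + g$2$2))
    (z / (g$2$1 * x + g$2$2)) * (g$2$1 * x + g$2$2) ^ (q - 2)"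
proof -
  let ?c = "g$2$1 * x + g$2$2"
  let ?x = "(g$1$1 * x + g$1$2) / ?c" and ?z = "z / ?c"
  let ?D = "tangent_map C (point_act g) (pt x z) (tv x z)"
  note act = point_act_pt[OF nz, of z]
  have P: "pt x z \<in> C" using xz by simp
  have xz': "on_curve ?x ?z"
    using point_act_C[OF g P] unfolding act by simp
  have D: "?D \<in> tangent_space C (pt ?x ?z)"
    using tangent_map_in[OF g P tv_in_tangent_space[OF xz]] unfolding act .
  have "?D (pfun polyZ) = tv x z (pfun polyZ \<circ> point_act g)"
    using regular_pfun[OF xz'] by (simp add: tangent_map_def act)
  also have "\<dots> = qder polyZ [:[:g$2$2, g$2$1:]:] x z"
  proof (rule tv_eq[OF xz])
    show "rational_near (\<lambda>u v. (pfun polyZ \<circ> point_act g) (pt u v)) polyZ [:[:g$2$2, g$2$1:]:]"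
      unfolding rational_near_def
    proof (intro allI impI)
      fix u v assume nz': "ev [:[:g$2$2, g$2$1:]:] u v \<noteq> 0"
      have c: "ev [:[:g$2$2, g$2$1:]:] u v = g$2$1 * u + g$2$2" by (simp add: algebra_simps)
      have "g$2$1 * u + g$2$2 \<noteq> 0" using nz' unfolding c .
      then show "(pfun polyZ \<circ> point_act g) (pt u v) * ev [:[:g$2$2, g$2$1:]:] u v = ev polyZ u v"
        unfolding c by (simp add: point_act_pt)
    qed
    show "ev [:[:g$2$2, g$2$1:]:] x z \<noteq> 0" using nz by (simp add: algebra_simps)
  qed
  also have "\<dots> = ?c ^ (q - 2)"
  proof -
    have b: "[:[:g$2$2, g$2$1:]:] = [:[:g$2$2:]:] + [:[:g$2$1:]:] * polyX"
      by (simp add: polyX_def)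
    have "ev (der q [:[:g$2$2, g$2$1:]:]) x z = g$2$1 * z ^ q"
      unfolding b by (simp only: der_add der_mult der_const der_X) simp
    then have "qder polyZ [:[:g$2$2, g$2$1:]:] x z = (g$2$1 * (x - z ^ (q + 1)) + g$2$2 * 1 ^ q) / ?c\<^sup>2"
      by (simp add: qder_def algebra_simps)
    also have "g$2$1 * (x - z ^ (q + 1)) + g$2$2 * 1 ^ q = ?c ^ q"
      using G_frob[OF g, of 2 x 1] xz by (simp add: on_curve_def del: power_Suc)
    finally show ?thesis using nz by (simp add: power_q_diff_2)
  qed
  finally have "?D (pfun polyZ) = ?c ^ (q - 2)" .
  moreover have "form_coeff (pull g \<omega>) x z = form_coeff \<omega> ?x ?z * ?D (pfun polyZ)"
    unfolding form_coeff_def[of "pull g \<omega>"] pull_eq[OF P tv_in_tangent_space[OF xz]] act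
    by (rule holomorphic_eq_coeff[OF \<omega> xz' D])
  ultimately show ?thesis by simp
qed

section \<open>The Weyl element and the point outside the chart\<close>

definition weyl :: "'a^2^2" where "weyl = vector [vector [0, 1], vector [-1, 0]]"

definition weyl_inv :: "'a^2^2" where "weyl_inv = vector [vector [0, -1], vector [1, 0]]"

lemma weyl_nth [simp]: "weyl$1$1 = 0" "weyl$1$2 = 1" "weyl$2$1 = -1" "weyl$2$2 = 0"
  "weyl_inv$1$1 = 0" "weyl_inv$1$2 = -1" "weyl_inv$2$1 = 1" "weyl_inv$2$2 = 0"
  by (simp_all add: weyl_def weyl_inv_def vector_2)

lemma weyl_in_G [simp]: "weyl \<in> carrier G" "weyl_inv \<in> carrier G"
  by (simp_all add: G_iff Fq_0 Fq_1 Fq_uminus)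

lemma weyl_mult_inv: "weyl ** weyl_inv = mat 1"
  by (simp add: vec_eq_iff forall_2 mat2_mult_nth mat_def)

text \<open>Both coefficients are polynomials on the chart, so agreement away from \<open>Fq\<close>
  extends to the fibres over \<open>Fq\<close>.\<close>

lemma form_coeff_cong:
  assumes \<omega>: "\<omega> \<in> holomorphic_differentials C" "\<omega>' \<in> holomorphic_differentials C"
    and eq: "\<And>x z. on_curve x z \<Longrightarrow> x ^ q \<noteq> x \<Longrightarrow> form_coeff \<omega> x z = form_coeff \<omega>' x z"
    and xz: "on_curve x z"
  shows "form_coeff \<omega> x z = form_coeff \<omega>' x z"
proof -
  obtain a a' where a: "\<And>x z. on_curve x z \<Longrightarrow> form_coeff \<omega> x z = ev a x z"
    and a': "\<And>x z. on_curve x z \<Longrightarrow> form_coeff \<omega>' x z = ev a' x z"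
    using holomorphic_coeff_poly[OF \<omega>(1)] holomorphic_coeff_poly[OF \<omega>(2)] by metis
  have "ev (a - a') x z = 0"
    using vanishing_everywhere(1)[of "a - a'"] eq a a' xz by simp
  then show ?thesis using a a' xz by simp
qed

text \<open>For Y = 0 the equation forces Z = 0, so [1:0:0] is the only point outside the chart. The
  Weyl element sends [0:1:0] to it.\<close>

lemma C_chart_cases:
  assumes "P \<in> C"
  obtains (chart) x z where "P = pt x z" "on_curve x z" | (infty) "P = point_act weyl (pt 0 0)"
proof -
  obtain v where v: "P = ppoint v" "v \<noteq> 0" "v$1 * (v$2)^q - (v$1)^q * v$2 = (v$3)^(q + 1)"
    by (rule C_cases[OF assms])
  show ?thesis
  proof (cases "v$2 = 0")
    case False
    then show ?thesis using chart assms v(1) ppoint_eq_pt by (metis pt_in_C)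
  next
    case True
    then have "v$3 = 0" using v(3) q_ge by (simp add: zero_power)
    then have "v$1 \<noteq> 0" using True v(2) by (simp add: vec3_zero_iff)
    have "v = v$1 *s vector [1, 0, 0]"
      using True \<open>v$3 = 0\<close> by (simp add: vec3_eq_iff)
    then have "P = ppoint (v$1 *s vector [1, 0, 0])"
      unfolding v(1) by (rule arg_cong)
    then have "P = ppoint (vector [1, 0, 0])"
      using ppoint_scale[OF \<open>v$1 \<noteq> 0\<close>] by simp
    moreover have "lin_act weyl (vector [0, 1, 0]) = vector [1, 0, 0]"
      by (simp add: vec3_eq_iff)
    ultimately show ?thesis
      using infty by (simp add: pt_def point_act_ppoint)
  qed
qed

text \<open>On the chart a form is its coefficient times dz. At [1:0:0] the two forms are compared
  through their pull-backs at the origin of the chart, whose coefficients agree for x outside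
  \<open>Fq\<close> by the transformation law and hence at x = 0 as well.\<close>

lemma holomorphic_eqI:
  assumes \<omega>: "\<omega> \<in> holomorphic_differentials C" "\<omega>' \<in> holomorphic_differentials C"
    and eq: "\<And>x z. on_curve x z \<Longrightarrow> x ^ q \<noteq> x \<Longrightarrow> form_coeff \<omega> x z = form_coeff \<omega>' x z"
  shows "\<omega> = \<omega>'"
proof (intro ext)
  fix P D
  show "\<omega> P D = \<omega>' P D"
  proof (cases "P \<in> C \<and> D \<in> tangent_space C P")
    case False
    then show ?thesis using \<omega> holomorphic_outside by metis
  next
    case True
    then have D: "D \<in> tangent_space C P" by simp
    from True have "P \<in> C" by simp
    then show ?thesis
    proof (cases rule: C_chart_cases)
      case (chart x z)
      then show ?thesis
        using holomorphic_eq_coeff[OF \<omega>(1)] holomorphic_eq_coeff[OF \<omega>(2)] form_coeff_cong[OF \<omega> eq] D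
        by metis
    next
      case infty
      let ?P = "pt 0 0" and ?D = "tangent_map C (point_act weyl_inv) P D"
      have oc: "on_curve 0 0" by (simp add: on_curve_def zero_power)
      then have P: "?P \<in> C" by simp
      have weyl: "point_act weyl (point_act weyl_inv Q) = Q" "point_act weyl_inv (point_act weyl Q) = Q" for Q :: "'a point"
      proof -
        have "weyl_inv ** weyl = mat 1" by (simp add: vec_eq_iff forall_2 mat2_mult_nth mat_def)
        then show "point_act weyl (point_act weyl_inv Q) = Q" "point_act weyl_inv (point_act weyl Q) = Q"
          using weyl_mult_inv by (simp_all flip: point_act_mult add: point_act_one)
      qed
      have D': "?D \<in> tangent_space C ?P"
        using tangent_map_in[OF weyl_in_G(2) \<open>P \<in> C\<close> D] unfolding infty weyl .
      \<comment> \<open>The tangent maps of the two Weyl elements are mutually inverse, so D is the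
        image of a tangent vector at the origin.\<close>
      have DD: "tangent_map C (point_act weyl) ?P ?D = D"
      proof
        fix f
        show "tangent_map C (point_act weyl) ?P ?D f = D f"
        proof (cases "regular_at C f P")
          case True
          then have 1: "regular_at C (f \<circ> point_act weyl) (point_act weyl_inv P)"
            using regular_at_act[OF weyl_in_G(1) P] by (simp add: infty weyl)
          have "tangent_map C (point_act weyl) ?P ?D f = D (f \<circ> point_act weyl \<circ> point_act weyl_inv)"
            using True 1 by (simp add: tangent_map_def infty weyl)
          also have "f \<circ> point_act weyl \<circ> point_act weyl_inv = f"
            by (simp add: fun_eq_iff weyl)
          finally show ?thesis .
        next
          case False
          then show ?thesis
            using tangent_nonregular[OF D] by (simp add: tangent_map_def infty)
        qed
      qed
      have pull: "form_coeff (pull weyl \<omega>) 0 0 = form_coeff (pull weyl \<omega>') 0 0"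
      proof (rule form_coeff_cong[OF pull_holomorphic[OF weyl_in_G(1) \<omega>(1)] pull_holomorphic[OF weyl_in_G(1) \<omega>(2)] _ oc])
        fix x z assume xz: "on_curve x z" "x ^ q \<noteq> x"
        then have "x \<noteq> 0" using q_ge by (auto simp: zero_power)
        moreover from this have "point_act weyl (pt x z) \<in> C" "point_act weyl (pt x z) = pt (1 / - x) (z / - x)"
          using point_act_C[OF weyl_in_G(1), of "pt x z"] xz(1) by (simp_all add: point_act_pt)
        ultimately show "form_coeff (pull weyl \<omega>) x z = form_coeff (pull weyl \<omega>') x z"
          using form_coeff_pull[OF weyl_in_G(1) \<omega>(1) xz(1)] form_coeff_pull[OF weyl_in_G(1) \<omega>(2) xz(1)]
            form_coeff_cong[OF \<omega> eq, of "1 / - x" "z / - x"] by simp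
      qed
      have "\<omega> P D = pull weyl \<omega> ?P ?D" "\<omega>' P D = pull weyl \<omega>' ?P ?D"
        unfolding pull_eq[OF P D'] DD infty[symmetric] by (rule refl)+
      then show ?thesis
        using holomorphic_eq_coeff[OF pull_holomorphic[OF weyl_in_G(1) \<omega>(1)] oc D']
          holomorphic_eq_coeff[OF pull_holomorphic[OF weyl_in_G(1) \<omega>(2)] oc D'] pull by simp
    qed
  qed
qed

end

section \<open>Global differential forms\<close>

context drinfeld
begin

text \<open>Comparing the expansions of \<open>\<omega>\<close> on the two standard charts bounds the degrees of its coefficients.\<close>

lemma holomorphic_coeffs:
  assumes \<omega>: "\<omega> \<in> holomorphic_differentials C"
  obtains c :: "nat \<Rightarrow> 'a poly" where "\<And>i. i \<le> q - 2 \<Longrightarrow> degree (c i) \<le> q - 2 - i"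
    and "\<And>x z. on_curve x z \<Longrightarrow> form_coeff \<omega> x z = (\<Sum>i\<le>q - 2. poly (c i) x * z ^ i)"
proof -
  have red: "\<exists>a. degree a \<le> q \<and> (\<forall>x z. on_curve x z \<longrightarrow> form_coeff \<eta> x z = ev a x z)"
    if \<eta>: "\<eta> \<in> holomorphic_differentials C" for \<eta>
  proof -
    obtain b where b: "\<And>x z. on_curve x z \<Longrightarrow> form_coeff \<eta> x z = ev b x z"
      using holomorphic_coeff_poly[OF \<eta>] by blast
    obtain m a where ma: "b = curve_poly * m + a" "degree a \<le> q"
      by (rule curve_division)
    have "form_coeff \<eta> x z = ev a x z" if "on_curve x z" for x z
      using b[OF that] that by (simp add: ma(1))
    then show ?thesis using ma(2) by blast
  qed
  obtain a where a: "degree a \<le> q" "\<And>x z. on_curve x z \<Longrightarrow> form_coeff \<omega> x z = ev a x z"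
    using red[OF \<omega>] by blast
  obtain a' where a': "degree a' \<le> q" "\<And>x z. on_curve x z \<Longrightarrow> form_coeff (pull weyl \<omega>) x z = ev a' x z"
    using red[OF pull_holomorphic[OF weyl_in_G(1) \<omega>]] by blast
  have bound: "i + degree (coeff a i) \<le> q - 2" if nz: "coeff a i \<noteq> 0" for i
  proof (rule ccontr)
    assume neg: "\<not> i + degree (coeff a i) \<le> q - 2"
    define n where "n = degree (coeff a i)"
    have n: "q - 2 < i + n" using neg by (simp add: n_def)
    have "i \<le> q" using nz a(1) by (metis le_degree order.trans)
    \<comment> \<open>At x = -t the denominator of the Weyl element is t, and the point moves to
      (1/t, z/t). Comparing the coefficients of z^i along the fibre over -t gives this relation
      between the two expansions.\<close>
    have eq: "poly (coeff a' i) (- t) * t ^ i = poly (coeff a i) (1 / t) * t ^ (q - 2)"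
      if t: "t ^ q \<noteq> t" for t
    proof -
      have "t \<noteq> 0" using t by (auto simp: zero_power)
      have t': "(- t) ^ q \<noteq> - t" using t by (simp add: frob_uminus)
      define d where "d = (\<lambda>i. poly (coeff a' i) (- t) - poly (coeff a i) (1 / t) * t ^ (q - 2) / t ^ i)"
      have "(\<Sum>i\<le>q. d i * z ^ i) = 0" if z: "on_curve (- t) z" for z
      proof -
        have "point_act weyl (pt (- t) z) = pt (1 / t) (z / t)"
          using \<open>t \<noteq> 0\<close> by (simp add: point_act_pt)
        then have oc: "on_curve (1 / t) (z / t)"
          using point_act_C[OF weyl_in_G(1), of "pt (- t) z"] z by simp
        have "ev a' (- t) z = ev a (1 / t) (z / t) * t ^ (q - 2)"
          using form_coeff_pull[OF weyl_in_G(1) \<omega> z] \<open>t \<noteq> 0\<close> a(2)[OF oc] a'(2)[OF z] by simp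
        then have "(\<Sum>i\<le>q. poly (coeff a' i) (- t) * z ^ i)
            = (\<Sum>i\<le>q. poly (coeff a i) (1 / t) * (z / t) ^ i) * t ^ (q - 2)"
          by (simp only: ev_reduced[OF a(1)] ev_reduced[OF a'(1)])
        also have "\<dots> = (\<Sum>i\<le>q. (poly (coeff a i) (1 / t) * t ^ (q - 2) / t ^ i) * z ^ i)"
          unfolding sum_distrib_right by (intro sum.cong refl) (simp add: power_divide)
        finally show ?thesis
          by (simp add: d_def left_diff_distrib sum_subtractf)
      qed
      then have "d i = 0"
        using fibre_coeffs_zero[OF t' _ \<open>i \<le> q\<close>, of d] by blast
      then show ?thesis
        using \<open>t \<noteq> 0\<close> by (simp add: d_def field_simps)
    qed
    \<comment> \<open>Multiplication by t^n turns a_i(1/t) into the reversed polynomial. In the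
      resulting identity the left side is divisible by t^(i+n) with i + n > q - 2, whereas on the
      right the coefficient of t^(q-2) is the leading coefficient of a_i.\<close>
    have "pcompose (coeff a' i) [:0, -1:] * monom 1 (i + n) = reflect_poly (coeff a i) * monom 1 (q - 2)"
    proof (rule poly_eqI_outside_Fq)
      fix t :: 'a assume t: "t ^ q \<noteq> t"
      then have "t \<noteq> 0" by (auto simp: zero_power)
      then have "poly (reflect_poly (coeff a i)) t = t ^ n * poly (coeff a i) (1 / t)"
        by (simp add: poly_reflect_poly_nz n_def inverse_eq_divide)
      then show "poly (pcompose (coeff a' i) [:0, -1:] * monom 1 (i + n)) t
          = poly (reflect_poly (coeff a i) * monom 1 (q - 2)) t"
        using eq[OF t] by (simp add: poly_pcompose poly_monom power_add mult_ac)
    qed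
    then have "coeff (pcompose (coeff a' i) [:0, -1:] * monom 1 (i + n)) (q - 2)
       = coeff (reflect_poly (coeff a i) * monom 1 (q - 2)) (q - 2)"
      by (rule arg_cong)
    then show False
      using n nz by (simp add: mult.commute[of _ "monom _ _"] coeff_monom_mult)
  qed
  have zero: "coeff a i = 0" if "i > q - 2" for i
    using bound[of i] that by linarith
  show ?thesis
  proof (rule that[of "coeff a"])
    show "degree (coeff a i) \<le> q - 2 - i" if "i \<le> q - 2" for i
      using bound[of i] that by (cases "coeff a i = 0") auto
    show "form_coeff \<omega> x z = (\<Sum>i\<le>q - 2. poly (coeff a i) x * z ^ i)" if "on_curve x z" for x z
      unfolding a(2)[OF that] ev_reduced[OF a(1)]
      by (intro sum.mono_neutral_right) (auto simp: zero)
  qed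
qed

text \<open>The form \<open>A/Y\<^sup>q\<^sup>-\<^sup>2 d(Z/Y) = A/X\<^sup>q\<^sup>-\<^sup>2 d(Z/X)\<close>; the two sides agree where both are defined.\<close>

definition form_of :: "('a^3 \<Rightarrow> 'a) \<Rightarrow> 'a diff_form" where
  "form_of A = (\<lambda>P D. if P \<in> C \<and> D \<in> tangent_space C P then
     (if rep P $ 2 \<noteq> 0 then proj_quot A (\<lambda>v. v$2 ^ (q - 2)) P * D (pfun polyZ)
      else proj_quot A (\<lambda>v. v$1 ^ (q - 2)) P * D (proj_quot (\<lambda>v. v$3) (\<lambda>v. v$1))) else 0)"

lemma rep_ppoint_nz: "(rep (ppoint v) $ i \<noteq> 0) \<longleftrightarrow> v $ i \<noteq> 0" for v :: "'a^3"
proof -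
  have "rep (ppoint v) \<in> ppoint v"
    unfolding rep_def by (rule someI[of "\<lambda>w. w \<in> ppoint v"], rule ppoint_self)
  then obtain c where "c \<noteq> 0" "rep (ppoint v) = c *s v"
    unfolding ppoint_def by blast
  then show ?thesis by simp
qed

lemma homogeneous_coord_power: "(\<lambda>v::'a^3. v$1 ^ n) \<in> homogeneous n" "(\<lambda>v::'a^3. v$2 ^ n) \<in> homogeneous n"
  using homogeneous_power[OF homogeneous_coord(1), of n] homogeneous_power[OF homogeneous_coord(2), of n] by simp_all

lemma form_of_pt:
  assumes A: "A \<in> homogeneous (q - 2)" and xz: "on_curve x z" and D: "D \<in> tangent_space C (pt x z)"
  shows "form_of A (pt x z) D = A (vector [x, 1, z]) * D (pfun polyZ)"
proof -
  have "rep (pt x z) $ 2 \<noteq> 0" unfolding pt_def rep_ppoint_nz by simp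
  moreover have "proj_quot A (\<lambda>v. v$2 ^ (q - 2)) (pt x z) = A (vector [x, 1, z])"
    unfolding pt_def by (simp add: proj_quot_ppoint[OF A homogeneous_coord_power(2)])
  ultimately show ?thesis
    using xz D by (simp add: form_of_def)
qed

lemma form_coeff_form_of:
  "A \<in> homogeneous (q - 2) \<Longrightarrow> on_curve x z \<Longrightarrow> form_coeff (form_of A) x z = A (vector [x, 1, z])"
  unfolding form_coeff_def by (simp add: form_of_pt tv_in_tangent_space)

text \<open>The formula defining \<open>form_of\<close> switches from point to point, and every
  neighbourhood X \<noteq> 0 of the point [1:0:0] meets both cases. Holomorphy there rests on d(Z/X)
  = (X/Y)^(q-2) d(Z/Y).\<close>

lemma form_of_holomorphic:
  assumes A: "A \<in> homogeneous (q - 2)"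
  shows "form_of A \<in> holomorphic_differentials C"
proof (rule holomorphicI)
  fix P assume P: "P \<in> C"
  obtain w where w: "P = ppoint w" "w \<noteq> 0" "w$1 * (w$2)^q - (w$1)^q * w$2 = (w$3)^(q + 1)"
    by (rule C_cases[OF P])
  let ?h = "proj_quot (\<lambda>v. v$3) (\<lambda>v::'a^3. v$1)"
  have local: "\<exists>U. zariski_open C U \<and> P \<in> U \<and>
            (\<exists>(n::nat) f h. (\<forall>i<n. \<forall>Q\<in>U. regular_at C (f i) Q \<and> regular_at C (h i) Q) \<and>
               (\<forall>Q\<in>U. \<forall>D\<in>tangent_space C Q. form_of A Q D = (\<Sum>i<n. f i Q * D (h i))))"
    if U: "zariski_open C U" "P \<in> U" and reg: "\<And>Q. Q \<in> U \<Longrightarrow> regular_at C f Q" "\<And>Q. Q \<in> U \<Longrightarrow> regular_at C h Q"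
      and eq: "\<And>Q D. Q \<in> U \<Longrightarrow> D \<in> tangent_space C Q \<Longrightarrow> form_of A Q D = f Q * D h" for U f h
    by (intro exI[of _ U] exI[of _ 1] exI[of _ "\<lambda>i. f"] exI[of _ "\<lambda>i. h"] conjI) (simp_all add: U reg eq)
  show "\<exists>U. zariski_open C U \<and> P \<in> U \<and>
            (\<exists>(n::nat) f h. (\<forall>i<n. \<forall>Q\<in>U. regular_at C (f i) Q \<and> regular_at C (h i) Q) \<and>
               (\<forall>Q\<in>U. \<forall>D\<in>tangent_space C Q. form_of A Q D = (\<Sum>i<n. f i Q * D (h i))))"
  proof (cases "w$2 = 0")
    case False
    show ?thesis
    proof (rule local[of "{pt u v | u v. on_curve u v \<and> ev 1 u v \<noteq> 0}" "proj_quot A (\<lambda>v. v$2 ^ (q - 2))" "pfun polyZ", OF zariski_openI])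
      have "P = pt (w$1 / w$2) (w$3 / w$2)" using w(1) False ppoint_eq_pt by simp
      then show "P \<in> {pt u v | u v. on_curve u v \<and> ev 1 u v \<noteq> 0}" using P by auto
    next
      fix Q assume "Q \<in> {pt u v | u v. on_curve u v \<and> ev 1 u v \<noteq> 0}"
      then obtain u v where uv: "Q = pt u v" "on_curve u v" by blast
      show "regular_at C (pfun polyZ) Q"
        unfolding uv(1) by (rule regular_pfun[OF uv(2)])
      show "regular_at C (proj_quot A (\<lambda>v. v$2 ^ (q - 2))) Q"
        unfolding uv(1) pt_def
        by (rule regular_at_proj_quot[OF C_proj_plane A homogeneous_coord_power(2)])
          (use uv in \<open>simp_all add: pt_def[symmetric] proj_quot_ppoint[OF A homogeneous_coord_power(2)]\<close>)
      fix D assume "D \<in> tangent_space C Q"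
      then show "form_of A Q D = proj_quot A (\<lambda>v. v$2 ^ (q - 2)) Q * D (pfun polyZ)"
        unfolding uv(1) form_of_def using uv(2) rep_ppoint_nz[of "vector [u, 1, v]" 2] by (simp add: pt_def[symmetric])
    qed
  next
    case True
    then have "w$3 = 0" using w(3) q_ge by (simp add: zero_power)
    then have "w$1 \<noteq> 0" using True w(2) by (simp add: vec3_zero_iff)
    show ?thesis
    proof (rule local[of "{P\<in>C. \<forall>v\<in>P. v$1 \<noteq> 0}" "proj_quot A (\<lambda>v. v$1 ^ (q - 2))" ?h, OF zariski_open_nonzero[OF homogeneous_coord(1)]])
      show "P \<in> {P\<in>C. \<forall>v\<in>P. v$1 \<noteq> 0}"
        using P w(1) \<open>w$1 \<noteq> 0\<close> ball_ppoint_nonzero[OF homogeneous_coord(1), of w] by blast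
    next
      fix Q assume Q: "Q \<in> {P\<in>C. \<forall>v\<in>P. v$1 \<noteq> 0}"
      then have "Q \<in> C" by simp
      then obtain v where v: "Q = ppoint v" by (rule C_cases)
      have v1: "v$1 \<noteq> 0" using Q v ppoint_self[of v] by simp
      show "regular_at C ?h Q"
        unfolding v using \<open>Q \<in> C\<close> v1
        by (intro regular_at_proj_quot[OF C_proj_plane homogeneous_coord(3,1)])
          (simp_all add: v proj_quot_ppoint[OF homogeneous_coord(3,1)])
      show "regular_at C (proj_quot A (\<lambda>v. v$1 ^ (q - 2))) Q"
        unfolding v using \<open>Q \<in> C\<close> v1
        by (intro regular_at_proj_quot[OF C_proj_plane A homogeneous_coord_power(1)])
          (simp_all add: v proj_quot_ppoint[OF A homogeneous_coord_power(1)])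
      fix D assume D: "D \<in> tangent_space C Q"
      show "form_of A Q D = proj_quot A (\<lambda>v. v$1 ^ (q - 2)) Q * D ?h"
      proof (cases "v$2 = 0")
        case True
        then have "rep Q $ 2 = 0" using rep_ppoint_nz[of v 2] v by simp
        then show ?thesis using D \<open>Q \<in> C\<close> by (simp add: form_of_def)
      next
        case False
        let ?x = "v$1 / v$2" and ?z = "v$3 / v$2"
        have Qpt: "Q = pt ?x ?z" unfolding v by (rule ppoint_eq_pt[OF False])
        then have xz: "on_curve ?x ?z" using \<open>Q \<in> C\<close> by simp
        have x: "?x \<noteq> 0" using False v1 by simp
        have "rational_near (\<lambda>u v. ?h (pt u v)) polyZ polyX"
          by (simp add: rational_near_def pt_def proj_quot_ppoint[OF homogeneous_coord(3,1)])
        then have "tv ?x ?z ?h = qder polyZ polyX ?x ?z"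
          using x by (intro tv_eq[OF xz]) simp_all
        \<comment> \<open>The quotient rule for z/x with dx = z^q dz; on the curve the numerator is
          x^q.\<close>
        also have "\<dots> = (?x - ?z ^ (q + 1)) / ?x\<^sup>2"
          by (simp add: qder_def)
        also have "?x - ?z ^ (q + 1) = ?x ^ q"
          using xz unfolding on_curve_def by (simp del: power_Suc)
        finally have "tv ?x ?z ?h = ?x ^ (q - 2)"
          using power_q_diff_2[OF x] by simp
        then have h: "D ?h = ?x ^ (q - 2) * D (pfun polyZ)"
          using tangent_eq_tv[OF _ xz, of D ?h] D Qpt by simp
        have "proj_quot A (\<lambda>v. v$1 ^ (q - 2)) Q = A (vector [?x, 1, ?z]) / ?x ^ (q - 2)"
          unfolding Qpt pt_def by (simp add: proj_quot_ppoint[OF A homogeneous_coord_power(1)])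
        moreover have "form_of A Q D = A (vector [?x, 1, ?z]) * D (pfun polyZ)"
          using form_of_pt[OF A xz] D Qpt by simp
        ultimately show ?thesis
          unfolding h using x by simp
      qed
    qed
  qed
qed (auto simp: form_of_def)

end

section \<open>Symmetric powers as spaces of polynomial functions\<close>

text \<open>An element of the symmetric algebra as a polynomial function. The field being infinite,
  binary forms are determined by their values (\<open>Sym_eqI\<close>), so the module axioms for
  \<open>Sym_power\<close> reduce to identities between functions.\<close>

definition sev :: "('a::field, 'n::finite) sym_algebra \<Rightarrow> 'a^'n \<Rightarrow> 'a" where
  "sev p v = (\<Sum>m\<in>Poly_Mapping.keys p. Poly_Mapping.lookup p m * (\<Prod>i\<in>UNIV. v $ i ^ Poly_Mapping.lookup m i))"

lemma sev_superset:
  assumes "finite F" "Poly_Mapping.keys p \<subseteq> F"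
  shows "sev p v = (\<Sum>m\<in>F. Poly_Mapping.lookup p m * (\<Prod>i\<in>UNIV. v $ i ^ Poly_Mapping.lookup m i))"
  unfolding sev_def using assms by (intro sum.mono_neutral_left) (auto simp: in_keys_iff)

lemma sev_0 [simp]: "sev 0 v = 0"
  by (simp add: sev_def)

lemma sev_add [simp]: "sev (p + p') v = sev p v + sev p' v"
proof -
  let ?F = "Poly_Mapping.keys p \<union> Poly_Mapping.keys p'"
  have "Poly_Mapping.keys (p + p') \<subseteq> ?F" by (rule Poly_Mapping.keys_add)
  then show ?thesis
    by (simp add: sev_superset[of ?F] lookup_add distrib_right sum.distrib)
qed

lemma sev_sum [simp]: "sev (sum f S) v = (\<Sum>s\<in>S. sev (f s) v)"
  by (induction S rule: infinite_finite_induct) simp_all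

lemma sev_single [simp]:
  "sev (Poly_Mapping.single m c) v = c * (\<Prod>i\<in>UNIV. v $ i ^ Poly_Mapping.lookup m i)"
  by (subst sev_superset[of "{m}"]) auto

lemma poly_mapping_eq_sum_single:
  "p = (\<Sum>m\<in>Poly_Mapping.keys p. Poly_Mapping.single m (Poly_Mapping.lookup p m))"
  by (rule poly_mapping_eqI) (auto simp: lookup_sum lookup_single when_def in_keys_iff)

lemma sev_mult [simp]: "sev (p * p') v = sev p v * sev p' v"
proof -
  have single: "sev (Poly_Mapping.single m c * Poly_Mapping.single n d) v
      = sev (Poly_Mapping.single m c) v * sev (Poly_Mapping.single n d) v" for m n c d
    by (simp add: mult_single lookup_add power_add prod.distrib)
  have "sev (p * p') v = sev ((\<Sum>m\<in>Poly_Mapping.keys p. Poly_Mapping.single m (Poly_Mapping.lookup p m)) *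
      (\<Sum>n\<in>Poly_Mapping.keys p'. Poly_Mapping.single n (Poly_Mapping.lookup p' n))) v"
    by (simp only: poly_mapping_eq_sum_single[symmetric])
  also have "\<dots> = sev (\<Sum>m\<in>Poly_Mapping.keys p. Poly_Mapping.single m (Poly_Mapping.lookup p m)) v *
      sev (\<Sum>n\<in>Poly_Mapping.keys p'. Poly_Mapping.single n (Poly_Mapping.lookup p' n)) v"
    unfolding sum_product sev_sum single ..
  finally show ?thesis
    by (simp only: poly_mapping_eq_sum_single[symmetric])
qed

lemma sev_1 [simp]: "sev 1 v = 1"
  using sev_single[of 0 1 v] by simp

lemma sev_power [simp]: "sev (p ^ n) v = sev p v ^ n"
  by (induction n) simp_all

lemma sev_prod [simp]: "sev (prod f S) v = (\<Prod>s\<in>S. sev (f s) v)"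
  by (induction S rule: infinite_finite_induct) simp_all

lemma sev_scale [simp]: "sev (sym_scale c p) v = c * sev p v"
  by (simp add: sym_scale_def)

lemma sev_sym_lin: "sev (sym_lin w) v = (\<Sum>i\<in>UNIV. w $ i * v $ i)"
proof -
  have "(\<Prod>j\<in>UNIV. v $ j ^ Poly_Mapping.lookup (Poly_Mapping.single i 1) j) = v $ i" for i
  proof -
    have "(\<Prod>j\<in>UNIV. v $ j ^ Poly_Mapping.lookup (Poly_Mapping.single i 1) j) = (\<Prod>j\<in>UNIV. if j = i then v $ i else 1)"
      by (intro prod.cong) (auto simp: lookup_single when_def)
    then show ?thesis by simp
  qed
  then show ?thesis by (simp add: sym_lin_def)
qed

text \<open>The i-th basis vector is replaced by the linear form given by the i-th row of A, whose
  value at v is the i-th entry of A v. So the right action on row vectors is composition with v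
  \<mapsto> A v, which is what pull-back of forms on the plane does.\<close>

lemma sev_act [simp]: "sev (sym_act p A) v = sev p (A *v v)"
proof -
  have "sev (sym_lin (axis i 1 v* A)) v = (A *v v) $ i" for i
    by (simp add: sev_sym_lin vector_matrix_mult_def matrix_vector_mult_def axis_def
        if_distrib[of "\<lambda>c. c * _"] cong: if_cong)
  then show ?thesis
    unfolding sym_act_def by (simp add: sev_def[of p])
qed

abbreviation Sym :: "nat \<Rightarrow> ('a::field, 'n::finite) sym_algebra set" where
  "Sym k \<equiv> carrier (Sym_power k)"

lemma Sym_iff: "p \<in> Sym k \<longleftrightarrow> (\<forall>m\<in>Poly_Mapping.keys p. (\<Sum>i\<in>UNIV. Poly_Mapping.lookup m i) = k)"
  by (simp add: Sym_power_def)

lemma Sym_0: "0 \<in> Sym k"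
  by (simp add: Sym_iff)

lemma Sym_add: "p \<in> Sym k \<Longrightarrow> p' \<in> Sym k \<Longrightarrow> p + p' \<in> Sym k"
  using Poly_Mapping.keys_add[of p p'] by (auto simp: Sym_iff)

lemma Sym_sum: "(\<And>s. s \<in> S \<Longrightarrow> f s \<in> Sym k) \<Longrightarrow> sum f S \<in> Sym k"
  by (induction S rule: infinite_finite_induct) (auto intro: Sym_0 Sym_add)

lemma Sym_mult: "p \<in> Sym k \<Longrightarrow> p' \<in> Sym l \<Longrightarrow> p * p' \<in> Sym (k + l)"
  using Poly_Mapping.keys_mult[of p p'] by (fastforce simp: Sym_iff lookup_add sum.distrib)

lemma Sym_single: "(\<Sum>i\<in>UNIV. Poly_Mapping.lookup m i) = k \<Longrightarrow> Poly_Mapping.single m c \<in> Sym k"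
  by (auto simp: Sym_iff split: if_splits)

lemma Sym_1: "1 \<in> Sym 0"
  using Sym_single[of 0 0 1] by simp

lemma Sym_power_closed: "p \<in> Sym k \<Longrightarrow> p ^ n \<in> Sym (n * k)"
  by (induction n) (auto intro: Sym_1 Sym_mult)

lemma Sym_prod: "finite S \<Longrightarrow> (\<And>s. s \<in> S \<Longrightarrow> f s \<in> Sym (d s)) \<Longrightarrow> prod f S \<in> Sym (\<Sum>s\<in>S. d s)"
  by (induction S rule: finite_induct) (auto intro: Sym_1 Sym_mult)

lemma Sym_scale: "p \<in> Sym k \<Longrightarrow> sym_scale c p \<in> Sym k"
  using Sym_mult[of "Poly_Mapping.single 0 c" 0 p k] Sym_single[of 0 0 c] by (simp add: sym_scale_def)

lemma Sym_lin: "sym_lin v \<in> Sym 1"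
  unfolding sym_lin_def by (intro Sym_sum Sym_single) (simp add: lookup_single when_def)

lemma Sym_act: "p \<in> Sym k \<Longrightarrow> sym_act p A \<in> Sym k"
proof -
  assume p: "p \<in> Sym k"
  have "(\<Prod>i\<in>UNIV. sym_lin (axis i 1 v* A) ^ Poly_Mapping.lookup m i) \<in> Sym k"
    if "m \<in> Poly_Mapping.keys p" for m
  proof -
    have "(\<Prod>i\<in>UNIV. sym_lin (axis i 1 v* A) ^ Poly_Mapping.lookup m i)
        \<in> Sym (\<Sum>i\<in>UNIV. Poly_Mapping.lookup m i * 1)"
      by (intro Sym_prod Sym_power_closed Sym_lin) simp
    then show ?thesis using p that by (simp add: Sym_iff[of p])
  qed
  then show ?thesis
    unfolding sym_act_def by (intro Sym_sum Sym_scale)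
qed

lemma vector_space_sym_scale: "vector_space sym_scale"
proof
  fix a b :: "'a" and x y :: "('a, 'n::finite) sym_algebra"
  have "Poly_Mapping.single 0 (a * b) = Poly_Mapping.single 0 a * (Poly_Mapping.single 0 b :: ('a, 'n) sym_algebra)"
    by (simp add: mult_single)
  then show "sym_scale a (sym_scale b x) = sym_scale (a * b) x"
    by (simp add: sym_scale_def mult.assoc)
qed (simp_all add: sym_scale_def single_add algebra_simps)

section \<open>Binary forms as polynomials in one variable\<close>

lemma prod_2_vec: "(\<Prod>i\<in>(UNIV::2 set). f i) = f 1 * f 2"
  by (simp add: UNIV_2)

definition mono2 :: "nat \<Rightarrow> nat \<Rightarrow> 2 \<Rightarrow>\<^sub>0 nat" where
  "mono2 i j = Poly_Mapping.single 1 i + Poly_Mapping.single 2 j"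

lemma lookup_mono2 [simp]: "Poly_Mapping.lookup (mono2 i j) 1 = i" "Poly_Mapping.lookup (mono2 i j) 2 = j"
  by (simp_all add: mono2_def lookup_add lookup_single)

lemma mono2_eqI: "Poly_Mapping.lookup m 1 = i \<Longrightarrow> Poly_Mapping.lookup m 2 = j \<Longrightarrow> m = mono2 i j"
  by (rule poly_mapping_eqI) (metis exhaust_2 lookup_mono2)

lemma Sym2_iff: "p \<in> Sym k \<longleftrightarrow> (\<forall>m\<in>Poly_Mapping.keys p. Poly_Mapping.lookup m 1 + Poly_Mapping.lookup m (2::2) = k)"
  by (simp add: Sym_iff sum_2)

text \<open>Setting y = 1. On forms of a known degree k nothing is lost
  (\<open>upoly_inject\<close>), and \<open>hpoly k\<close> is the inverse.\<close>

definition upoly :: "('a::field, 2) sym_algebra \<Rightarrow> 'a poly" where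
  "upoly p = (\<Sum>m\<in>Poly_Mapping.keys p. monom (Poly_Mapping.lookup p m) (Poly_Mapping.lookup m 1))"

lemma vector2_nth [simp]: "(vector [x, y] :: 'a::zero^2) $ 1 = x" "(vector [x, y] :: 'a^2) $ 2 = y"
  by (simp_all add: vector_2)

lemma poly_upoly: "poly (upoly p) x = sev p (vector [x, 1])"
  by (simp add: upoly_def sev_def poly_sum poly_monom prod_2_vec)

lemma coeff_upoly:
  assumes "p \<in> Sym k"
  shows "coeff (upoly p) i = (if i \<le> k then Poly_Mapping.lookup p (mono2 i (k - i)) else 0)"
proof -
  have "coeff (upoly p) i = (\<Sum>m\<in>Poly_Mapping.keys p. if m = mono2 i (k - i) \<and> i \<le> k then Poly_Mapping.lookup p m else 0)"
    unfolding upoly_def coeff_sum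
  proof (intro sum.cong refl)
    fix m assume "m \<in> Poly_Mapping.keys p"
    then have "Poly_Mapping.lookup m 1 + Poly_Mapping.lookup m 2 = k"
      using assms by (simp add: Sym2_iff)
    then have "Poly_Mapping.lookup m 1 = i \<longleftrightarrow> m = mono2 i (k - i) \<and> i \<le> k"
      using mono2_eqI[of m i "k - i"] by (metis diff_add_inverse le_add1 lookup_mono2(1))
    then show "coeff (monom (Poly_Mapping.lookup p m) (Poly_Mapping.lookup m 1)) i
        = (if m = mono2 i (k - i) \<and> i \<le> k then Poly_Mapping.lookup p m else 0)"
      by simp
  qed
  also have "\<dots> = (if i \<le> k then Poly_Mapping.lookup p (mono2 i (k - i)) else 0)"
    by (auto simp: sum.delta in_keys_iff)
  finally show ?thesis .
qed

lemma degree_upoly: "p \<in> Sym k \<Longrightarrow> degree (upoly p) \<le> k"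
  by (rule degree_le) (simp add: coeff_upoly)

lemma upoly_inject:
  assumes "p \<in> Sym k" "p' \<in> Sym k" "upoly p = upoly p'"
  shows "p = p'"
proof (rule poly_mapping_eqI)
  fix m :: "2 \<Rightarrow>\<^sub>0 nat"
  show "Poly_Mapping.lookup p m = Poly_Mapping.lookup p' m"
  proof (cases "Poly_Mapping.lookup m 1 + Poly_Mapping.lookup m 2 = k")
    case True
    then have "m = mono2 (Poly_Mapping.lookup m 1) (k - Poly_Mapping.lookup m 1)" "Poly_Mapping.lookup m 1 \<le> k"
      using mono2_eqI[of m "Poly_Mapping.lookup m 1" "k - Poly_Mapping.lookup m 1"] by auto
    then show ?thesis
      using coeff_upoly[OF assms(1), of "Poly_Mapping.lookup m 1"]
        coeff_upoly[OF assms(2), of "Poly_Mapping.lookup m 1"] assms(3) by simp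
  next
    case False
    then have "m \<notin> Poly_Mapping.keys p" "m \<notin> Poly_Mapping.keys p'"
      using assms(1,2) by (auto simp: Sym2_iff)
    then show ?thesis by (simp add: in_keys_iff)
  qed
qed

definition hpoly :: "nat \<Rightarrow> 'a::field poly \<Rightarrow> ('a, 2) sym_algebra" where
  "hpoly k f = (\<Sum>i\<le>k. Poly_Mapping.single (mono2 i (k - i)) (coeff f i))"

lemma hpoly_Sym: "hpoly k f \<in> Sym k"
  unfolding hpoly_def by (intro Sym_sum Sym_single) (simp add: sum_2)

lemma sev_hpoly: "sev (hpoly k f) v = (\<Sum>i\<le>k. coeff f i * v$1 ^ i * v$2 ^ (k - i))"
  by (simp add: hpoly_def prod_2_vec mult.assoc)

lemma upoly_hpoly: "degree f \<le> k \<Longrightarrow> upoly (hpoly k f) = f"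
proof (rule poly_eqI)
  fix i assume f: "degree f \<le> k"
  have inj: "mono2 j (k - j) = mono2 i (k - i) \<longleftrightarrow> j = i" for j
    by (metis lookup_mono2(1))
  have "i \<le> k \<Longrightarrow> Poly_Mapping.lookup (hpoly k f) (mono2 i (k - i)) = coeff f i"
    by (simp add: hpoly_def lookup_sum lookup_single when_def inj sum.delta)
  then show "coeff (upoly (hpoly k f)) i = coeff f i"
    using f by (simp add: coeff_upoly[OF hpoly_Sym] coeff_eq_0)
qed

lemma homogeneous_sev:
  fixes p :: "('a::field, 2) sym_algebra"
  assumes "p \<in> Sym k"
  shows "(\<lambda>v. sev p (vector [v$1, v$2])) \<in> homogeneous k"
proof -
  have "(\<lambda>v. v$1 ^ Poly_Mapping.lookup m 1 * v$2 ^ Poly_Mapping.lookup m 2 * v$3 ^ 0) \<in> homogeneous k"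
    if "m \<in> Poly_Mapping.keys p" for m
    using that assms by (intro homogeneous_monomial) (simp add: Sym2_iff)
  then show ?thesis
    unfolding sev_def by (intro homogeneous_sum homogeneous_scale) (simp add: prod_2_vec)
qed


section \<open>Modules\<close>

lemma right_FG_moduleD:
  assumes "right_FG_module G M"
  shows "group G" "vector_space (scale M)" "Modules.module.subspace (scale M) (carrier M)"
    "\<And>g u. g \<in> carrier G \<Longrightarrow> u \<in> carrier M \<Longrightarrow> act M u g \<in> carrier M"
    "\<And>g u v. g \<in> carrier G \<Longrightarrow> u \<in> carrier M \<Longrightarrow> v \<in> carrier M \<Longrightarrow> act M (u + v) g = act M u g + act M v g"
    "\<And>g c u. g \<in> carrier G \<Longrightarrow> u \<in> carrier M \<Longrightarrow> act M (scale M c u) g = scale M c (act M u g)"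
    "\<And>u. u \<in> carrier M \<Longrightarrow> act M u \<one>\<^bsub>G\<^esub> = u"
    "\<And>g h u. g \<in> carrier G \<Longrightarrow> h \<in> carrier G \<Longrightarrow> u \<in> carrier M \<Longrightarrow> act M u (g \<otimes>\<^bsub>G\<^esub> h) = act M (act M u g) h"
  using assms unfolding right_FG_module_def by blast+

lemma subspace_iff:
  assumes "vector_space s"
  shows "Modules.module.subspace s S \<longleftrightarrow>
    0 \<in> S \<and> (\<forall>x\<in>S. \<forall>y\<in>S. x + y \<in> S) \<and> (\<forall>c. \<forall>x\<in>S. s c x \<in> S)"
proof -
  interpret vector_space s by fact
  show ?thesis by (rule subspace_def)
qed

text \<open>The scalar action of \<open>FG_direct_sum\<close> uses \<open>scale (M i)\<close> at
  every index, including those outside I, and the vector space axioms are required on the whole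
  function type. Hence each \<open>M i\<close> is taken to be a module.\<close>

lemma right_FG_module_direct_sum:
  fixes M :: "'i \<Rightarrow> ('a::field, 'v::ab_group_add, 'g) fg_module"
  assumes M: "\<And>i. right_FG_module G (M i)"
  shows "right_FG_module G (FG_direct_sum I M)"
proof -
  note MD = right_FG_moduleD[OF M]
  let ?N = "FG_direct_sum I M"
  have vs: "vector_space (scale ?N)"
  proof
    fix a b and x y :: "'i \<Rightarrow> 'v"
    interpret vector_space "scale (M i)" for i by (rule MD(2))
    show "scale ?N a (x + y) = scale ?N a x + scale ?N a y"
      "scale ?N (a + b) x = scale ?N a x + scale ?N b x"
      "scale ?N a (scale ?N b x) = scale ?N (a * b) x"
      "scale ?N 1 x = x"
      by (simp_all add: FG_direct_sum_def fun_eq_iff scale_right_distrib scale_left_distrib)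
  qed
  have sub: "0 \<in> carrier (M i)" "x \<in> carrier (M i) \<Longrightarrow> y \<in> carrier (M i) \<Longrightarrow> x + y \<in> carrier (M i)"
    "x \<in> carrier (M i) \<Longrightarrow> scale (M i) c x \<in> carrier (M i)" for i x y c
    using MD(3)[of i, unfolded subspace_iff[OF MD(2)]] by simp_all
  have scale0: "scale (M i) c 0 = 0" for i c
  proof -
    interpret vector_space "scale (M i)" by (rule MD(2))
    show ?thesis by simp
  qed
  have act0: "act (M i) 0 g = 0" if "g \<in> carrier G" for i g
    using MD(5)[OF that sub(1) sub(1), of i] by simp
  have fin: "finite {i. f i \<noteq> 0}" if "finite {i. u i \<noteq> 0}" "\<And>i. u i = 0 \<Longrightarrow> f i = 0" for u f :: "'i \<Rightarrow> 'v"
    using that by (auto intro: finite_subset[OF _ that(1)])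
  have fin2: "finite {i. u i + v i \<noteq> 0}" if "finite {i. u i \<noteq> 0}" "finite {i. v i \<noteq> 0}" for u v :: "'i \<Rightarrow> 'v"
    by (rule finite_subset[OF _ finite_UnI[OF that]]) auto
  have car: "u \<in> carrier ?N \<longleftrightarrow> (\<forall>i\<in>I. u i \<in> carrier (M i)) \<and> (\<forall>i. i \<notin> I \<longrightarrow> u i = 0) \<and> finite {i. u i \<noteq> 0}" for u
    by (simp add: FG_direct_sum_def)
  have sel: "scale ?N c u = (\<lambda>i. scale (M i) c (u i))" "act ?N u g = (\<lambda>i. if i \<in> I then act (M i) (u i) g else 0)" for c u g
    by (simp_all add: FG_direct_sum_def)
  have inN: "u i \<in> carrier (M i)" if "u \<in> carrier ?N" for u i
    using that sub(1) unfolding car by (cases "i \<in> I") auto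
  have one: "\<one>\<^bsub>G\<^esub> \<in> carrier G" using MD(1) by (simp add: group_def monoid.one_closed)
  show ?thesis
    unfolding right_FG_module_def
  proof (intro conjI ballI allI)
    show "Modules.module.subspace (scale ?N) (carrier ?N)"
      unfolding subspace_iff[OF vs]
    proof (intro conjI ballI allI)
      show "0 \<in> carrier ?N" using sub(1) by (simp add: car)
      show "x + y \<in> carrier ?N" if "x \<in> carrier ?N" "y \<in> carrier ?N" for x y
        using that sub(2) fin2[of x y] by (simp add: car)
      show "scale ?N c x \<in> carrier ?N" if "x \<in> carrier ?N" for c x
        using that sub(3) fin[of x "\<lambda>i. scale (M i) c (x i)"] by (simp add: car sel scale0)
    qed
    show "act ?N u g \<in> carrier ?N" if "g \<in> carrier G" "u \<in> carrier ?N" for g u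
      using that MD(4) fin[of u "\<lambda>i. if i \<in> I then act (M i) (u i) g else 0"] by (simp add: car sel act0)
    show "act ?N (u + v) g = act ?N u g + act ?N v g" if "g \<in> carrier G" "u \<in> carrier ?N" "v \<in> carrier ?N" for g u v
      by (rule ext) (simp add: sel MD(5)[OF that(1) inN[OF that(2)] inN[OF that(3)]])
    show "act ?N (scale ?N c u) g = scale ?N c (act ?N u g)" if "g \<in> carrier G" "u \<in> carrier ?N" for g c u
      by (rule ext) (simp add: sel MD(6)[OF that(1) inN[OF that(2)]] scale0)
    show "act ?N u \<one>\<^bsub>G\<^esub> = u" if "u \<in> carrier ?N" for u
      using that by (intro ext) (simp add: sel MD(7)[OF inN[OF that]] car)
    show "act ?N u (g \<otimes>\<^bsub>G\<^esub> h) = act ?N (act ?N u g) h"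
      if "g \<in> carrier G" "h \<in> carrier G" "u \<in> carrier ?N" for g h u
      by (rule ext) (simp add: sel MD(8)[OF that(1,2) inN[OF that(3)]])
  qed (fact MD(1) vs)+
qed

text \<open>Transport of structure: only the vector space axioms of \<open>M\<close> have to be checked.\<close>

lemma FG_isomorphic_transport:
  assumes N: "right_FG_module G N" and vs: "vector_space (scale M)"
    and bij: "bij_betw f (carrier N) (carrier M)"
    and add: "\<And>u v. u \<in> carrier N \<Longrightarrow> v \<in> carrier N \<Longrightarrow> f (u + v) = f u + f v"
    and scale: "\<And>c u. u \<in> carrier N \<Longrightarrow> f (scale N c u) = scale M c (f u)"
    and act: "\<And>g u. g \<in> carrier G \<Longrightarrow> u \<in> carrier N \<Longrightarrow> f (act N u g) = act M (f u) g"
  shows "FG_isomorphic G M N"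
proof -
  note ND = right_FG_moduleD[OF N]
  have sub: "0 \<in> carrier N" "\<And>x y. x \<in> carrier N \<Longrightarrow> y \<in> carrier N \<Longrightarrow> x + y \<in> carrier N"
    "\<And>c x. x \<in> carrier N \<Longrightarrow> scale N c x \<in> carrier N"
    using ND(3)[unfolded subspace_iff[OF ND(2)]] by simp_all
  have im: "f x \<in> carrier M" if "x \<in> carrier N" for x
    using bij that by (auto simp: bij_betw_def)
  have E: "\<exists>x\<in>carrier N. y = f x" if "y \<in> carrier M" for y
    using bij that by (auto simp: bij_betw_def)
  have f0: "f 0 = 0" using add[OF sub(1) sub(1)] by simp
  have addM: "f x + f y \<in> carrier M" if "x \<in> carrier N" "y \<in> carrier N" for x y
    using im[OF sub(2)[OF that]] add[OF that] by simp
  have scaleM: "scale M c (f x) \<in> carrier M" if "x \<in> carrier N" for c x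
    using im[OF sub(3)[OF that]] scale[OF that] by simp
  have actM: "act M (f x) g \<in> carrier M" if "g \<in> carrier G" "x \<in> carrier N" for g x
    using im[OF ND(4)[OF that]] act[OF that] by simp
  have M1: "Modules.module.subspace (scale M) (carrier M)"
    unfolding subspace_iff[OF vs]
  proof (intro conjI ballI allI)
    show "0 \<in> carrier M" using im[OF sub(1)] f0 by simp
    show "x + y \<in> carrier M" if x: "x \<in> carrier M" and y: "y \<in> carrier M" for x y
    proof -
      obtain a b where "a \<in> carrier N" "x = f a" "b \<in> carrier N" "y = f b"
        using E[OF x] E[OF y] by (elim bexE)
      then show ?thesis using addM[of a b] by simp
    qed
    show "scale M c x \<in> carrier M" if x: "x \<in> carrier M" for c x
    proof -
      obtain a where "a \<in> carrier N" "x = f a" using E[OF x] by (elim bexE)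
      then show ?thesis using scaleM[of a c] by simp
    qed
  qed
  have M2: "act M u g \<in> carrier M" if g: "g \<in> carrier G" and u: "u \<in> carrier M" for g u
  proof -
    obtain a where "a \<in> carrier N" "u = f a" using E[OF u] by (elim bexE)
    then show ?thesis using actM[OF g, of a] by simp
  qed
  have M3: "act M (u + v) g = act M u g + act M v g"
    if g: "g \<in> carrier G" and u: "u \<in> carrier M" and v: "v \<in> carrier M" for g u v
  proof -
    obtain x y where xy: "x \<in> carrier N" "u = f x" "y \<in> carrier N" "v = f y"
      using E[OF u] E[OF v] by (elim bexE)
    have "act M (f x + f y) g = f (act N (x + y) g)"
      by (simp only: act[OF g sub(2)[OF xy(1,3)]] add[OF xy(1,3)])
    also have "\<dots> = act M (f x) g + act M (f y) g"
      by (simp only: ND(5)[OF g xy(1,3)] add[OF ND(4)[OF g xy(1)] ND(4)[OF g xy(3)]] act[OF g xy(1)] act[OF g xy(3)])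
    finally show ?thesis by (simp only: xy)
  qed
  have M4: "act M (scale M c u) g = scale M c (act M u g)"
    if g: "g \<in> carrier G" and u: "u \<in> carrier M" for g c u
  proof -
    obtain x where x: "x \<in> carrier N" "u = f x"
      using E[OF u] by (elim bexE)
    have "act M (scale M c (f x)) g = f (act N (scale N c x) g)"
      by (simp only: act[OF g sub(3)[OF x(1)]] scale[OF x(1)])
    also have "\<dots> = scale M c (act M (f x) g)"
      by (simp only: ND(6)[OF g x(1)] scale[OF ND(4)[OF g x(1)]] act[OF g x(1)])
    finally show ?thesis by (simp only: x)
  qed
  have M5: "act M u \<one>\<^bsub>G\<^esub> = u" if u: "u \<in> carrier M" for u
  proof -
    obtain x where x: "x \<in> carrier N" "u = f x"
      using E[OF u] by (elim bexE)
    have "\<one>\<^bsub>G\<^esub> \<in> carrier G" using ND(1) by (simp add: group_def monoid.one_closed)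
    then show ?thesis using act[of "\<one>\<^bsub>G\<^esub>" x] ND(7)[OF x(1)] x by simp
  qed
  have M6: "act M u (g \<otimes>\<^bsub>G\<^esub> h) = act M (act M u g) h"
    if g: "g \<in> carrier G" and h: "h \<in> carrier G" and u: "u \<in> carrier M" for g h u
  proof -
    obtain x where x: "x \<in> carrier N" "u = f x"
      using E[OF u] by (elim bexE)
    have gh: "g \<otimes>\<^bsub>G\<^esub> h \<in> carrier G" using ND(1) g h by (simp add: group_def monoid.m_closed)
    have "act M (f x) (g \<otimes>\<^bsub>G\<^esub> h) = f (act N (act N x g) h)"
      by (simp only: act[OF gh x(1), symmetric] ND(8)[OF g h x(1)])
    also have "\<dots> = act M (act M (f x) g) h"
      by (simp only: act[OF h ND(4)[OF g x(1)]] act[OF g x(1)])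
    finally show ?thesis by (simp only: x)
  qed
  have M: "right_FG_module G M"
    unfolding right_FG_module_def
    by (intro conjI ballI allI; fact ND(1) vs M1 M2 M3 M4 M5 M6)
  \<comment> \<open>The given f runs from N to M, whereas the isomorphism asked for goes from M to
    N.\<close>
  define h where "h = inv_into (carrier N) f"
  have h: "bij_betw h (carrier M) (carrier N)"
    unfolding h_def by (rule bij_betw_inv_into[OF bij])
  have hf: "h (f u) = u" if "u \<in> carrier N" for u
    using bij that by (simp add: h_def bij_betw_def inv_into_f_f)
  have h1: "h (u + v) = h u + h v" if u: "u \<in> carrier M" and v: "v \<in> carrier M" for u v
  proof -
    obtain x y where xy: "x \<in> carrier N" "u = f x" "y \<in> carrier N" "v = f y"
      using E[OF u] E[OF v] by (elim bexE)
    then show ?thesis using hf[OF sub(2)[OF xy(1,3)]] add[OF xy(1,3)] hf by simp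
  qed
  have h2: "h (scale M c u) = scale N c (h u)" if u: "u \<in> carrier M" for c u
  proof -
    obtain x where x: "x \<in> carrier N" "u = f x"
      using E[OF u] by (elim bexE)
    then show ?thesis using hf[OF sub(3)[OF x(1)]] scale[OF x(1)] hf by simp
  qed
  have h3: "h (act M u g) = act N (h u) g" if g: "g \<in> carrier G" and u: "u \<in> carrier M" for g u
  proof -
    obtain x where x: "x \<in> carrier N" "u = f x"
      using E[OF u] by (elim bexE)
    then show ?thesis using hf[OF ND(4)[OF g x(1)]] act[OF g x(1)] hf by simp
  qed
  show ?thesis
    unfolding FG_isomorphic_def
    by (intro conjI exI[of _ h] ballI allI; fact M N h h1 h2 h3)
qed

context drinfeld
begin

lemma group_G: "group G"
proof (rule groupI)
  show "\<exists>h\<in>carrier G. h \<otimes>\<^bsub>G\<^esub> g = \<one>\<^bsub>G\<^esub>" if g: "g \<in> carrier G" for g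
  proof (rule bexI)
    let ?h = "vector [vector [g$2$2, - (g$1$2)], vector [- (g$2$1), g$1$1]] :: 'a^2^2"
    have det: "g$1$1 * g$2$2 = 1 + g$1$2 * g$2$1"
      using g by (simp add: G_iff algebra_simps)
    show "?h \<in> carrier G"
      using g by (simp add: G_iff Fq_uminus algebra_simps)
    show "?h \<otimes>\<^bsub>G\<^esub> g = \<one>\<^bsub>G\<^esub>"
      using det by (simp add: SL2_def vec_eq_iff forall_2 mat2_mult_nth mat_def algebra_simps)
  qed
  show "x \<otimes>\<^bsub>G\<^esub> y \<in> carrier G" if "x \<in> carrier G" "y \<in> carrier G" for x y
    using that by (auto simp: SL2_def det_mul mat2_mult_nth intro!: Fq_add Fq_mult)
  show "\<one>\<^bsub>G\<^esub> \<in> carrier G"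
    unfolding G_iff by (simp add: SL2_def mat_def Fq_0 Fq_1)
qed (simp_all add: SL2_def matrix_mul_assoc)

lemma Sym_eqI:
  fixes u :: "('a, 2) sym_algebra"
  assumes "u \<in> Sym k" "w \<in> Sym k" "\<And>v. sev u v = sev w v"
  shows "u = w"
  using assms by (intro upoly_inject[of u k w] poly_eqI_outside_Fq) (simp_all add: poly_upoly)

lemma right_FG_module_Sym: "right_FG_module G (Sym_power k :: ('a, ('a, 2) sym_algebra, 'a^2^2) fg_module)"
proof -
  have sel: "scale (Sym_power k) = sym_scale" "act (Sym_power k) = sym_act"
    by (simp_all add: Sym_power_def)
  have "Modules.module.subspace sym_scale (Sym k :: ('a, 2) sym_algebra set)"
    unfolding subspace_iff[OF vector_space_sym_scale] using Sym_0 Sym_add Sym_scale by blast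
  moreover have "sym_act (u + v) g = sym_act u g + sym_act v g" if "u \<in> Sym k" "v \<in> Sym k"
    for g and u v :: "('a, 2) sym_algebra"
    using that by (intro Sym_eqI[of _ k]) (simp_all add: Sym_act Sym_add)
  moreover have "sym_act (sym_scale c u) g = sym_scale c (sym_act u g)" if "u \<in> Sym k"
    for g c and u :: "('a, 2) sym_algebra"
    using that by (intro Sym_eqI[of _ k]) (simp_all add: Sym_act Sym_scale)
  moreover have "sym_act u \<one>\<^bsub>G\<^esub> = u" if "u \<in> Sym k" for u :: "('a, 2) sym_algebra"
    using that by (intro Sym_eqI[of _ k]) (simp_all add: Sym_act SL2_def)
  moreover have "sym_act u (g \<otimes>\<^bsub>G\<^esub> h) = sym_act (sym_act u g) h" if "u \<in> Sym k"
    for g h and u :: "('a, 2) sym_algebra"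
    using that by (intro Sym_eqI[of _ k]) (simp_all add: Sym_act SL2_def matrix_vector_mul_assoc)
  ultimately show ?thesis
    unfolding right_FG_module_def sel using group_G vector_space_sym_scale Sym_act by blast
qed

section \<open>The isomorphism with the sum of the symmetric powers\<close>

definition hsum :: "(nat \<Rightarrow> ('a, 2) sym_algebra) \<Rightarrow> 'a^3 \<Rightarrow> 'a" where
  "hsum u v = (\<Sum>k\<le>q - 2. v$3 ^ (q - 2 - k) * sev (u k) (vector [v$1, v$2]))"

abbreviation V_sum :: "('a, nat \<Rightarrow> ('a, 2) sym_algebra, 'a^2^2) fg_module" where
  "V_sum \<equiv> FG_direct_sum {0..q - 2} Sym_power"

lemma V_sum_sel:
  "scale V_sum c u = (\<lambda>k. sym_scale c (u k))"
  "act V_sum u g = (\<lambda>k. if k \<le> q - 2 then sym_act (u k) g else 0)"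
  by (simp_all add: FG_direct_sum_def Sym_power_def fun_eq_iff)

lemma V_sum_carrier: "u \<in> carrier V_sum \<longleftrightarrow> (\<forall>k\<le>q - 2. u k \<in> Sym k) \<and> (\<forall>k>q - 2. u k = 0)"
proof -
  have "finite {i. u i \<noteq> 0}" if "\<forall>k>q - 2. u k = 0" for u :: "nat \<Rightarrow> ('a, 2) sym_algebra"
    by (rule finite_subset[of _ "{..q - 2}"]) (use that not_le in auto)
  then show ?thesis
    by (auto simp: FG_direct_sum_def not_le)
qed

lemma homogeneous_hsum:
  assumes "u \<in> carrier V_sum"
  shows "hsum u \<in> homogeneous (q - 2)"
proof -
  have "(\<lambda>v. v$3 ^ (q - 2 - k) * sev (u k) (vector [v$1, v$2])) \<in> homogeneous (q - 2)"
    if k: "k \<le> q - 2" for k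
    using homogeneous_mult[OF homogeneous_power[OF homogeneous_coord(3), of "q - 2 - k"] homogeneous_sev[of "u k" k]]
      assms k by (simp add: V_sum_carrier del: diff_diff_left)
  then have "(\<lambda>v. \<Sum>k\<le>q - 2. v$3 ^ (q - 2 - k) * sev (u k) (vector [v$1, v$2])) \<in> homogeneous (q - 2)"
    by (intro homogeneous_sum) simp
  then show ?thesis by (simp add: hsum_def[abs_def])
qed

lemma hsum_chart:
  "hsum u (vector [x, 1, z]) = (\<Sum>i\<le>q - 2. poly (upoly (u (q - 2 - i))) x * z ^ i)"
  unfolding hsum_def poly_upoly
  by (rule sum.reindex_bij_witness[of _ "\<lambda>i. q - 2 - i" "\<lambda>i. q - 2 - i"]) (auto simp: mult.commute simp del: diff_diff_left)

lemma form_coeff_hsum: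
  assumes "u \<in> carrier V_sum" "on_curve x z"
  shows "form_coeff (form_of (hsum u)) x z = (\<Sum>i\<le>q - 2. poly (upoly (u (q - 2 - i))) x * z ^ i)"
  using assms by (simp add: form_coeff_form_of homogeneous_hsum hsum_chart)

lemma form_of_hsum_inj: "inj_on (\<lambda>u. form_of (hsum u)) (carrier V_sum)"
proof (rule inj_onI, rule ext)
  fix u w k
  assume u: "u \<in> carrier V_sum" and w: "w \<in> carrier V_sum" and eq: "form_of (hsum u) = form_of (hsum w)"
  show "u k = w k"
  proof (cases "k \<le> q - 2")
    case False
    then show ?thesis using u w by (simp add: V_sum_carrier)
  next
    case True
    have "upoly (u k) = upoly (w k)"
    proof (rule poly_eqI_outside_Fq)
      fix x :: 'a assume x: "x ^ q \<noteq> x"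
      \<comment> \<open>Extended by 0 beyond q - 2, because the fibre argument concerns all
        exponents up to q.\<close>
      define d where "d = (\<lambda>i. if i \<le> q - 2 then poly (upoly (u (q - 2 - i))) x - poly (upoly (w (q - 2 - i))) x else 0)"
      have "(\<Sum>i\<le>q. d i * z ^ i) = 0" if z: "on_curve x z" for z
      proof -
        have "(\<Sum>i\<le>q. d i * z ^ i) = (\<Sum>i\<le>q - 2. d i * z ^ i)"
          by (rule sum.mono_neutral_right) (auto simp: d_def)
        also have "\<dots> = (\<Sum>i\<le>q - 2. poly (upoly (u (q - 2 - i))) x * z ^ i)
            - (\<Sum>i\<le>q - 2. poly (upoly (w (q - 2 - i))) x * z ^ i)"
          unfolding sum_subtractf[symmetric] by (intro sum.cong refl) (simp add: d_def left_diff_distrib)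
        also have "\<dots> = 0"
          using form_coeff_hsum[OF u z] form_coeff_hsum[OF w z] eq by simp
        finally show ?thesis .
      qed
      then have "d (q - 2 - k) = 0"
        using fibre_coeffs_zero[OF x, of d "q - 2 - k"] by simp
      then show "poly (upoly (u k)) x = poly (upoly (w k)) x"
        using True by (simp add: d_def del: diff_diff_left)
    qed
    then show ?thesis
      using u w True upoly_inject[of "u k" k "w k"] by (simp add: V_sum_carrier)
  qed
qed

lemma form_of_hsum_surj: "(\<lambda>u. form_of (hsum u)) ` carrier V_sum = holomorphic_differentials C"
proof (intro equalityI subsetI)
  fix \<omega> assume "\<omega> \<in> (\<lambda>u. form_of (hsum u)) ` carrier V_sum"
  then show "\<omega> \<in> holomorphic_differentials C"
    using form_of_holomorphic homogeneous_hsum by blast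
next
  fix \<omega> assume \<omega>: "\<omega> \<in> holomorphic_differentials C"
  obtain c :: "nat \<Rightarrow> 'a poly" where deg: "\<And>i. i \<le> q - 2 \<Longrightarrow> degree (c i) \<le> q - 2 - i"
    and c: "\<And>x z. on_curve x z \<Longrightarrow> form_coeff \<omega> x z = (\<Sum>i\<le>q - 2. poly (c i) x * z ^ i)"
    using holomorphic_coeffs[OF \<omega>] by blast
  \<comment> \<open>The indices are reversed: the coefficient of z^i has degree at most q - 2 - i in
    x, so it homogenises to an element of V^(q-2-i).\<close>
  define u where "u = (\<lambda>k. if k \<le> q - 2 then hpoly k (c (q - 2 - k)) else 0)"
  have u: "u \<in> carrier V_sum"
    by (simp add: V_sum_carrier u_def hpoly_Sym)
  have up: "upoly (u (q - 2 - i)) = c i" if "i \<le> q - 2" for i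
    using deg[OF that] that by (simp add: u_def upoly_hpoly del: diff_diff_left)
  have "form_of (hsum u) = \<omega>"
  proof (rule holomorphic_eqI[OF form_of_holomorphic[OF homogeneous_hsum[OF u]] \<omega>])
    fix x z assume xz: "on_curve x z"
    show "form_coeff (form_of (hsum u)) x z = form_coeff \<omega> x z"
      unfolding form_coeff_hsum[OF u xz] c[OF xz] by (intro sum.cong refl) (simp add: up del: diff_diff_left)
  qed
  then show "\<omega> \<in> (\<lambda>u. form_of (hsum u)) ` carrier V_sum"
    using u by blast
qed

text \<open>Outside \<open>Fq\<close> the denominator c is nonzero and the transformation law
  applies. By homogeneity its factor c^(q-2) moves the point normalised to Y = 1 back to the linear
  image of (x, 1, z), where g acts on each \<open>u k\<close> and leaves Z alone.\<close>

lemma form_of_hsum_act: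
  assumes g: "g \<in> carrier G" and u: "u \<in> carrier V_sum"
  shows "form_of (hsum (act V_sum u g)) = pull g (form_of (hsum u))"
proof -
  have ug: "act V_sum u g \<in> carrier V_sum"
    using u by (simp add: V_sum_carrier V_sum_sel Sym_act)
  note hol = form_of_holomorphic[OF homogeneous_hsum[OF u]] and hol' = form_of_holomorphic[OF homogeneous_hsum[OF ug]]
  show ?thesis
  proof (rule holomorphic_eqI[OF hol' pull_holomorphic[OF g hol]])
    fix x z assume xz: "on_curve x z" and x: "x ^ q \<noteq> x"
    define c where "c = g$2$1 * x + g$2$2"
    have nz: "c \<noteq> 0"
    proof
      assume 0: "c = 0"
      then have "g$2$1 \<noteq> 0"
        using g by (auto simp: G_iff c_def)
      then have "x = - g$2$2 / g$2$1"
        using 0 by (simp add: c_def field_simps eq_neg_iff_add_eq_0)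
      then have "x \<in> Fq"
        using g by (simp add: G_iff Fq_divide Fq_uminus)
      then show False using x by (simp add: Fq_iff)
    qed
    let ?x = "(g$1$1 * x + g$1$2) / c" and ?z = "z / c"
    have P: "pt x z \<in> C" using xz by simp
    have xz': "on_curve ?x ?z"
      using point_act_C[OF g P] point_act_pt[of g x z] nz by (simp add: c_def)
    have "form_coeff (pull g (form_of (hsum u))) x z = hsum u (vector [?x, 1, ?z]) * c ^ (q - 2)"
      using form_coeff_pull[OF g hol xz] nz form_coeff_form_of[OF homogeneous_hsum[OF u] xz'] by (simp add: c_def)
    also have "\<dots> = hsum u (c *s vector [?x, 1, ?z])"
      by (simp add: homogeneous_scaling[OF homogeneous_hsum[OF u]])
    also have "c *s vector [?x, 1, ?z] = lin_act g (vector [x, 1, z])"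
      using nz by (simp add: vec3_eq_iff c_def)
    also have "hsum u (lin_act g (vector [x, 1, z])) = hsum (act V_sum u g) (vector [x, 1, z])"
    proof -
      have "g *v vector [x, 1] = vector [g$1$1 * x + g$1$2, g$2$1 * x + g$2$2]"
        by (simp add: vec_eq_iff forall_2 matrix_vector_mult_def sum_2)
      then show ?thesis
        unfolding hsum_def by (intro sum.cong refl) (simp add: V_sum_sel)
    qed
    also have "\<dots> = form_coeff (form_of (hsum (act V_sum u g))) x z"
      by (simp add: form_coeff_form_of[OF homogeneous_hsum[OF ug] xz])
    finally show "form_coeff (form_of (hsum (act V_sum u g))) x z = form_coeff (pull g (form_of (hsum u))) x z"
      by simp
  qed
qed

lemma H0_isomorphic: "FG_isomorphic G (H0_drinfeld q) V_sum"
proof (rule FG_isomorphic_transport[of _ _ _ "\<lambda>u. form_of (hsum u)"])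
  show "right_FG_module G V_sum"
    by (rule right_FG_module_direct_sum[OF right_FG_module_Sym])
  show "vector_space (scale (H0_drinfeld q :: ('a, 'a diff_form, 'a^2^2) fg_module))"
    by unfold_locales (simp_all add: H0_drinfeld_def fun_eq_iff algebra_simps)
  show "bij_betw (\<lambda>u. form_of (hsum u)) (carrier V_sum) (carrier (H0_drinfeld q))"
    using form_of_hsum_inj form_of_hsum_surj by (simp add: bij_betw_def H0_drinfeld_def)
  show "form_of (hsum (u + v)) = form_of (hsum u) + form_of (hsum v)" for u v
    by (auto simp: fun_eq_iff form_of_def proj_quot_def hsum_def sum.distrib algebra_simps add_divide_distrib)
  show "form_of (hsum (scale V_sum c u)) = scale (H0_drinfeld q) c (form_of (hsum u))" for c u
    by (auto simp: fun_eq_iff form_of_def proj_quot_def hsum_def H0_drinfeld_def V_sum_sel sum_distrib_left mult_ac)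
  show "form_of (hsum (act V_sum u g)) = act (H0_drinfeld q) (form_of (hsum u)) g"
    if "g \<in> carrier G" "u \<in> carrier V_sum" for g u
    using form_of_hsum_act[OF that] by (simp add: H0_drinfeld_def)
qed

end

section \<open>Submodules\<close>

lemma FG_submoduleD:
  assumes "right_FG_module G M" "FG_submodule G M W"
  shows "\<And>w. w \<in> W \<Longrightarrow> w \<in> carrier M" "0 \<in> W" "\<And>x y. x \<in> W \<Longrightarrow> y \<in> W \<Longrightarrow> x + y \<in> W"
    "\<And>c x. x \<in> W \<Longrightarrow> scale M c x \<in> W" "\<And>g x. g \<in> carrier G \<Longrightarrow> x \<in> W \<Longrightarrow> act M x g \<in> W"
  using assms(2)[unfolded FG_submodule_def subspace_iff[OF right_FG_moduleD(2)[OF assms(1)]]]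
  by auto

lemma FG_submoduleI:
  assumes "right_FG_module G M"
    and "\<And>w. w \<in> W \<Longrightarrow> w \<in> carrier M" "0 \<in> W" "\<And>x y. x \<in> W \<Longrightarrow> y \<in> W \<Longrightarrow> x + y \<in> W"
    "\<And>c x. x \<in> W \<Longrightarrow> scale M c x \<in> W" "\<And>g x. g \<in> carrier G \<Longrightarrow> x \<in> W \<Longrightarrow> act M x g \<in> W"
  shows "FG_submodule G M W"
  unfolding FG_submodule_def subspace_iff[OF right_FG_moduleD(2)[OF assms(1)]]
  using assms(2-) by (intro conjI subsetI ballI allI) simp_all

lemma right_FG_module_sub:
  assumes "right_FG_module G M"
  shows "0 \<in> carrier M" "\<And>x y. x \<in> carrier M \<Longrightarrow> y \<in> carrier M \<Longrightarrow> x + y \<in> carrier M"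
    "\<And>c x. x \<in> carrier M \<Longrightarrow> scale M c x \<in> carrier M"
  using right_FG_moduleD(3)[OF assms, unfolded subspace_iff[OF right_FG_moduleD(2)[OF assms]]]
  by simp_all

lemma span_least:
  assumes "vector_space s" "Modules.module.subspace s T" "B \<subseteq> T"
  shows "Modules.module.span s B \<subseteq> T"
proof -
  interpret vector_space s by fact
  show ?thesis using assms(2,3) by (intro span_minimal)
qed

lemma FG_semisimple_iff:
  assumes M: "right_FG_module G M"
  shows "FG_semisimple G M \<longleftrightarrow> carrier M \<subseteq> Modules.module.span (scale M) (\<Union>{W. simple_FG_submodule G M W})"
proof -
  have "\<Union>{W. simple_FG_submodule G M W} \<subseteq> carrier M"
    by (auto simp: simple_FG_submodule_def FG_submodule_def)
  then have "Modules.module.span (scale M) (\<Union>{W. simple_FG_submodule G M W}) \<subseteq> carrier M"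
    by (rule span_least[OF right_FG_moduleD(2,3)[OF M]])
  then show ?thesis
    using M unfolding FG_semisimple_def by auto
qed

section \<open>Transport of simple submodules and semi-simplicity along an isomorphism\<close>

locale FG_iso =
  fixes G :: "('g, 'x) monoid_scheme" and M :: "('a::field, 'v::ab_group_add, 'g) fg_module"
    and N :: "('a, 'w::ab_group_add, 'g) fg_module" and f
  assumes M: "right_FG_module G M" and N: "right_FG_module G N"
    and bij: "bij_betw f (carrier M) (carrier N)"
    and f_add: "\<And>u v. u \<in> carrier M \<Longrightarrow> v \<in> carrier M \<Longrightarrow> f (u + v) = f u + f v"
    and f_scale: "\<And>c u. u \<in> carrier M \<Longrightarrow> f (scale M c u) = scale N c (f u)"
    and f_act: "\<And>g u. g \<in> carrier G \<Longrightarrow> u \<in> carrier M \<Longrightarrow> f (act M u g) = act N (f u) g"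
begin

lemma f_in: "x \<in> carrier M \<Longrightarrow> f x \<in> carrier N"
  using bij by (auto simp: bij_betw_def)

lemma f_inj: "x \<in> carrier M \<Longrightarrow> y \<in> carrier M \<Longrightarrow> f x = f y \<Longrightarrow> x = y"
  using bij by (auto simp: bij_betw_def inj_on_def)

lemma f_surj: "y \<in> carrier N \<Longrightarrow> \<exists>x\<in>carrier M. y = f x"
  using bij by (auto simp: bij_betw_def)

lemma f_0: "f 0 = 0"
  using f_add[OF right_FG_module_sub(1)[OF M] right_FG_module_sub(1)[OF M]] by simp

lemma image_submodule:
  assumes S: "FG_submodule G M S"
  shows "FG_submodule G N (f ` S)"
proof (rule FG_submoduleI[OF N])
  note SD = FG_submoduleD[OF M S]
  show "w \<in> carrier N" if "w \<in> f ` S" for w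
    using that SD(1) f_in by auto
  show "0 \<in> f ` S"
    using SD(2) f_0 by (metis imageI)
  show "x + y \<in> f ` S" if "x \<in> f ` S" "y \<in> f ` S" for x y
  proof -
    obtain a b where "a \<in> S" "x = f a" "b \<in> S" "y = f b" using \<open>x \<in> f ` S\<close> \<open>y \<in> f ` S\<close> by (elim imageE)
    then show ?thesis using f_add[OF SD(1) SD(1), of a b] SD(3)[of a b] by (simp add: rev_image_eqI)
  qed
  show "scale N c x \<in> f ` S" if "x \<in> f ` S" for c x
  proof -
    obtain a where "a \<in> S" "x = f a" using \<open>x \<in> f ` S\<close> by (elim imageE)
    then show ?thesis using f_scale[OF SD(1), of a c] SD(4)[of a c] by (simp add: rev_image_eqI)
  qed
  show "act N x g \<in> f ` S" if g: "g \<in> carrier G" and x: "x \<in> f ` S" for g x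
  proof -
    obtain a where "a \<in> S" "x = f a" using x by (elim imageE)
    then show ?thesis using f_act[OF g SD(1), of a] SD(5)[OF g, of a] by (simp add: rev_image_eqI)
  qed
qed

lemma preimage_submodule:
  assumes U: "FG_submodule G N U"
  shows "FG_submodule G M {x \<in> carrier M. f x \<in> U}"
proof (rule FG_submoduleI[OF M])
  note UD = FG_submoduleD[OF N U] and MS = right_FG_module_sub[OF M]
  show "0 \<in> {x \<in> carrier M. f x \<in> U}" using MS(1) UD(2) by (simp add: f_0)
  show "x + y \<in> {x \<in> carrier M. f x \<in> U}" if "x \<in> {x \<in> carrier M. f x \<in> U}" "y \<in> {x \<in> carrier M. f x \<in> U}" for x y
    using that MS(2) UD(3) by (simp add: f_add)
  show "scale M c x \<in> {x \<in> carrier M. f x \<in> U}" if "x \<in> {x \<in> carrier M. f x \<in> U}" for c x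
    using that MS(3) UD(4) by (simp add: f_scale)
  show "act M x g \<in> {x \<in> carrier M. f x \<in> U}" if "g \<in> carrier G" "x \<in> {x \<in> carrier M. f x \<in> U}" for g x
    using that right_FG_moduleD(4)[OF M] UD(5) by (simp add: f_act)
qed simp

lemma image_simple:
  assumes S: "simple_FG_submodule G M S"
  shows "simple_FG_submodule G N (f ` S)"
  unfolding simple_FG_submodule_def
proof (intro conjI allI impI)
  have sub: "FG_submodule G M S" and "S \<noteq> {0}"
    and min: "\<And>U. FG_submodule G M U \<Longrightarrow> U \<subseteq> S \<Longrightarrow> U = {0} \<or> U = S"
    using S unfolding simple_FG_submodule_def by blast+
  note SD = FG_submoduleD[OF M sub]
  show "FG_submodule G N (f ` S)" by (rule image_submodule[OF sub])
  obtain s where s: "s \<in> S" "s \<noteq> 0" using \<open>S \<noteq> {0}\<close> SD(2) by blast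
  then have "f s \<noteq> 0" using f_inj[of s 0] SD(1) right_FG_module_sub(1)[OF M] by (auto simp: f_0)
  then show "f ` S \<noteq> {0}" using s by blast
  fix U assume U: "FG_submodule G N U \<and> U \<subseteq> f ` S"
  let ?U = "{x \<in> carrier M. f x \<in> U}"
  have US: "?U \<subseteq> S"
  proof
    fix x assume x: "x \<in> ?U"
    then obtain s where "s \<in> S" "f x = f s" using U by blast
    then show "x \<in> S" using f_inj[of x s] x SD(1) by simp
  qed
  have im: "U = f ` ?U"
  proof (intro equalityI subsetI)
    fix y assume "y \<in> U"
    then obtain s where "s \<in> S" "y = f s" using U by blast
    then show "y \<in> f ` ?U" using \<open>y \<in> U\<close> SD(1) by auto
  qed auto
  have "?U = {0} \<or> ?U = S"
    by (rule min[OF preimage_submodule[OF conjunct1[OF U]] US])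
  then show "U = {0} \<or> U = f ` S"
  proof (elim disjE)
    assume "?U = {0}"
    then have "U = f ` {0}" using im by (rule subst)
    then show ?thesis by (simp add: f_0)
  next
    assume "?U = S"
    then have "U = f ` S" using im by (rule subst)
    then show ?thesis ..
  qed
qed

text \<open>The preimage of the span of the simple submodules of N is a subspace of M. It contains
  every simple submodule of M, since images of these are simple, and so it is all of M.\<close>

lemma semisimple_imp:
  assumes "FG_semisimple G M"
  shows "FG_semisimple G N"
  unfolding FG_semisimple_iff[OF N]
proof
  let ?X = "Modules.module.span (scale N) (\<Union>{W. simple_FG_submodule G N W})"
  interpret VN: vector_space "scale N" by (rule right_FG_moduleD(2)[OF N])
  let ?T = "{x \<in> carrier M. f x \<in> ?X}"
  note MS = right_FG_module_sub[OF M]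
  have "Modules.module.subspace (scale M) ?T"
    unfolding subspace_iff[OF right_FG_moduleD(2)[OF M]]
  proof (intro conjI ballI allI)
    show "0 \<in> ?T" using MS(1) by (simp add: f_0 VN.span_zero)
    show "x + y \<in> ?T" if "x \<in> ?T" "y \<in> ?T" for x y
      using that MS(2) by (simp add: f_add VN.span_add)
    show "scale M c x \<in> ?T" if "x \<in> ?T" for c x
      using that MS(3) by (simp add: f_scale VN.span_scale)
  qed
  moreover have "\<Union>{W. simple_FG_submodule G M W} \<subseteq> ?T"
  proof
    fix x assume "x \<in> \<Union>{W. simple_FG_submodule G M W}"
    then obtain W where W: "simple_FG_submodule G M W" "x \<in> W" by blast
    then have "x \<in> carrier M" unfolding simple_FG_submodule_def FG_submodule_def by blast
    moreover have "f x \<in> ?X"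
      by (rule VN.span_base) (use image_simple[OF W(1)] W(2) in blast)
    ultimately show "x \<in> ?T" by simp
  qed
  ultimately have "carrier M \<subseteq> ?T"
    using span_least[OF right_FG_moduleD(2)[OF M]] assms unfolding FG_semisimple_iff[OF M] by (metis (no_types, lifting) order.trans)
  then show "y \<in> ?X" if "y \<in> carrier N" for y
    using f_surj[OF that] by blast
qed

end

lemma FG_isomorphicE:
  assumes "FG_isomorphic G M N"
  obtains f where "FG_iso G M N f"
proof -
  obtain f where "bij_betw f (carrier M) (carrier N)"
    "\<forall>u\<in>carrier M. \<forall>v\<in>carrier M. f (u + v) = f u + f v"
    "\<forall>c. \<forall>u\<in>carrier M. f (scale M c u) = scale N c (f u)"
    "\<forall>g\<in>carrier G. \<forall>u\<in>carrier M. f (act M u g) = act N (f u) g"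
    and "right_FG_module G M" "right_FG_module G N"
    using assms unfolding FG_isomorphic_def by (elim conjE exE)
  then have "FG_iso G M N f"
    by unfold_locales simp_all
  then show ?thesis by (rule that)
qed

lemma FG_isomorphic_sym:
  assumes "FG_isomorphic G M N"
  shows "FG_isomorphic G N M"
proof -
  obtain f where "FG_iso G M N f" by (rule FG_isomorphicE[OF assms])
  then interpret FG_iso G M N f .
  show ?thesis
    by (rule FG_isomorphic_transport[OF M right_FG_moduleD(2)[OF N] bij f_add f_scale f_act])
qed

lemma FG_semisimple_cong:
  assumes "FG_isomorphic G M N"
  shows "FG_semisimple G M \<longleftrightarrow> FG_semisimple G N"
proof
  obtain f where "FG_iso G M N f" by (rule FG_isomorphicE[OF assms])
  then show "FG_semisimple G M \<Longrightarrow> FG_semisimple G N" by (rule FG_iso.semisimple_imp)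
  obtain h where "FG_iso G N M h" by (rule FG_isomorphicE[OF FG_isomorphic_sym[OF assms]])
  then show "FG_semisimple G N \<Longrightarrow> FG_semisimple G M" by (rule FG_iso.semisimple_imp)
qed


section \<open>The symmetric powers\<close>

text \<open>A translation keeps the leading term, which cancels. Positive degree makes the bound
  strict also when the difference is 0.\<close>

lemma degree_shift_diff:
  fixes f :: "'a::idom poly"
  assumes "degree f > 0"
  shows "degree (pcompose f [:b, 1:] - f) < degree f"
proof -
  have deg: "degree (pcompose f [:b, 1:]) = degree f"
    by (simp add: degree_pcompose)
  have "lead_coeff (pcompose f [:b, 1:]) = lead_coeff f"
    by (subst lead_coeff_comp) simp_all
  then have "coeff (pcompose f [:b, 1:] - f) (degree f) = 0"
    by (simp add: deg)
  moreover have "degree (pcompose f [:b, 1:] - f) \<le> degree f"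
    using degree_diff_le[of "pcompose f [:b, 1:]" "degree f" f] deg by simp
  ultimately show ?thesis
    using assms by (metis coeff_0 degree_0 le_neq_implies_less leading_coeff_0_iff)
qed

context drinfeld
begin

lemma Sym_power_sel [simp]: "scale (Sym_power k) = sym_scale" "act (Sym_power k) = sym_act"
  by (simp_all add: Sym_power_def)

lemma upoly_add: "upoly (u + w) = upoly u + upoly w" for u w :: "('a, 2) sym_algebra"
  by (rule poly_eqI_outside_Fq) (simp add: poly_upoly)

lemma upoly_scale: "upoly (sym_scale c u) = smult c (upoly u)" for u :: "('a, 2) sym_algebra"
  by (rule poly_eqI_outside_Fq) (simp add: poly_upoly)

definition xy_monomial :: "nat \<Rightarrow> nat \<Rightarrow> ('a, 2) sym_algebra" where
  "xy_monomial k j = hpoly k (monom 1 j)"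

lemma xy_monomial_Sym: "xy_monomial k j \<in> Sym k"
  unfolding xy_monomial_def by (rule hpoly_Sym)

lemma sev_xy_monomial: "j \<le> k \<Longrightarrow> sev (xy_monomial k j) v = v$1 ^ j * v$2 ^ (k - j)"
  by (simp add: xy_monomial_def sev_hpoly if_distrib[of "\<lambda>c. c * _"] cong: if_cong)

lemma upoly_xy_monomial: "j \<le> k \<Longrightarrow> upoly (xy_monomial k j) = monom 1 j"
  unfolding xy_monomial_def by (rule upoly_hpoly) (simp add: degree_monom_eq)

lemma xy_monomial_nonzero: "j \<le> k \<Longrightarrow> xy_monomial k j \<noteq> 0"
  using upoly_xy_monomial[of j k] by (auto simp: upoly_def)

text \<open>The vector \<open>y\<^sup>k\<close> spans the fixed points of the upper unitriangular matrices. An element of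
  smallest degree in \<open>x\<close> of a submodule is such a fixed point.\<close>

lemma submodule_contains_yk:
  fixes W :: "('a, 2) sym_algebra set"
  assumes W: "FG_submodule G (Sym_power k) W" and nz: "W \<noteq> {0}" and k: "k < q"
  shows "xy_monomial k 0 \<in> W"
proof -
  note WD = FG_submoduleD[OF right_FG_module_Sym W, unfolded Sym_power_sel]
  have ex: "\<exists>w. w \<in> W \<and> w \<noteq> 0" using nz WD(2) by blast
  then obtain w where w: "w \<in> W" "w \<noteq> 0"
    and min: "\<And>w'. w' \<in> W \<Longrightarrow> w' \<noteq> 0 \<Longrightarrow> degree (upoly w) \<le> degree (upoly w')"
    using ex_has_least_nat[of "\<lambda>w. w \<in> W \<and> w \<noteq> 0" _ "\<lambda>w. degree (upoly w)"] by blast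
  define f where "f = upoly w"
  have wS: "w \<in> Sym k" using WD(1)[OF w(1)] .
  have f0: "upoly (0 :: ('a, 2) sym_algebra) = 0" by (simp add: upoly_def)
  have "f \<noteq> 0"
    using upoly_inject[OF wS Sym_0] w(2) f0 by (auto simp: f_def)
  have shift: "poly f b = poly f 0" if b: "b \<in> Fq" for b
  proof (cases "degree f = 0")
    case True
    then show ?thesis by (metis degree_eq_zeroE poly_const_conv)
  next
    case False
    define g :: "'a^2^2" where "g = vector [vector [1, b], vector [0, 1]]"
    have g: "g \<in> carrier G"
      using b by (simp add: G_iff g_def Fq_0 Fq_1)
    have gv: "g *v vector [x, 1] = vector [x + b, 1]" for x
      by (simp add: g_def vec_eq_iff forall_2 matrix_vector_mult_def sum_2)
    define w' where "w' = sym_act w g + sym_scale (-1) w"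
    have "w' \<in> W"
      unfolding w'_def by (intro WD(3,4,5) g w(1))
    \<comment> \<open>The leading terms of the translate and of w cancel. Minimality of the degree
      of w then forces the difference to vanish.\<close>
    moreover have up: "upoly w' = pcompose f [:b, 1:] - f"
      by (rule poly_eqI_outside_Fq) (simp add: w'_def f_def poly_upoly gv poly_pcompose add.commute)
    then have "degree (upoly w') < degree (upoly w)"
      using degree_shift_diff[of f b] False by (simp add: f_def)
    ultimately have "w' = 0"
      using min[of w'] by (metis not_le)
    then have "pcompose f [:b, 1:] = f" using up f0 by simp
    then have "poly (pcompose f [:b, 1:]) 0 = poly f 0" by simp
    then show ?thesis by (simp add: poly_pcompose)
  qed
  \<comment> \<open>Every element of \<open>Fq\<close> is a root of f - f(0), giving q roots against
    a degree of at most k < q.\<close>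
  have "f - [:poly f 0:] = 0"
  proof (rule ccontr)
    assume nz: "f - [:poly f 0:] \<noteq> 0"
    have "degree f \<le> k" unfolding f_def by (rule degree_upoly[OF wS])
    then have "degree (f - [:poly f 0:]) \<le> k" by (intro degree_diff_le) simp_all
    moreover have "card Fq \<le> card {x. poly (f - [:poly f 0:]) x = 0}"
      using shift by (intro card_mono poly_roots_finite nz) auto
    moreover have "card {x. poly (f - [:poly f 0:]) x = 0} \<le> degree (f - [:poly f 0:])"
      by (rule card_poly_roots_bound[OF nz])
    ultimately show False using k card_Fq by simp
  qed
  then have f: "f = [:poly f 0:]" by simp
  then have "poly f 0 \<noteq> 0" using \<open>f \<noteq> 0\<close> by auto
  have "xy_monomial k 0 = sym_scale (inverse (poly f 0)) w"
  proof (rule upoly_inject[OF xy_monomial_Sym Sym_scale[OF wS]])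
    have "smult (inverse (poly f 0)) f = [:1:]"
      by (subst (2) f) (simp add: \<open>poly f 0 \<noteq> 0\<close>)
    then show "upoly (xy_monomial k 0) = upoly (sym_scale (inverse (poly f 0)) w)"
      by (simp add: upoly_xy_monomial upoly_scale f_def monom_0)
  qed
  then show ?thesis using WD(4)[OF w(1)] by simp
qed

lemma indecomposable_Sym:
  assumes "k \<le> q - 2"
  shows "FG_indecomposable G (Sym_power k :: ('a, ('a, 2) sym_algebra, 'a^2^2) fg_module)"
  unfolding FG_indecomposable_def
proof (intro conjI allI impI)
  have k: "k < q" using assms q_ge by linarith
  show "right_FG_module G (Sym_power k :: ('a, ('a, 2) sym_algebra, 'a^2^2) fg_module)"
    by (rule right_FG_module_Sym)
  show "Sym k \<noteq> {0 :: ('a, 2) sym_algebra}"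
    using xy_monomial_Sym[of k 0] xy_monomial_nonzero[of 0 k] by auto
  fix U W :: "('a, 2) sym_algebra set"
  assume UW: "FG_submodule G (Sym_power k) U \<and> FG_submodule G (Sym_power k) W \<and>
    U \<inter> W = {0} \<and> {u + w |u w. u \<in> U \<and> w \<in> W} = Sym k"
  show "U = {0} \<or> W = {0}"
  proof (rule ccontr)
    assume "\<not> (U = {0} \<or> W = {0})"
    then have "xy_monomial k 0 \<in> U \<inter> W"
      using submodule_contains_yk[OF _ _ k] UW by blast
    then show False using UW xy_monomial_nonzero[of 0 k] by auto
  qed
qed

lemma of_nat_q_minus_1: "of_nat (q - 1) = (- 1 :: 'a)"
  using q_ge by (simp add: of_nat_diff)

text \<open>A Fourier transform over the lower unitriangular matrices extracts the monomials from \<open>(cx + y)\<^sup>k\<close>.\<close>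

lemma submodule_contains_binomial_monomial:
  fixes W :: "('a, 2) sym_algebra set"
  assumes W: "FG_submodule G (Sym_power k) W" and yk: "xy_monomial k 0 \<in> W" and k: "k \<le> q - 2" and j: "j \<le> k"
  shows "sym_scale (of_nat (k choose j)) (xy_monomial k j) \<in> W"
proof -
  note WD = FG_submoduleD[OF right_FG_module_Sym W, unfolded Sym_power_sel]
  \<comment> \<open>As i and j are at most q - 2, the exponent lies strictly between 0 and 2 (q -
    1), so it is a multiple of q - 1 only for i = j. In that case the sum counts q - 1 = -1.\<close>
  have power_sum: "(\<Sum>c\<in>Fq - {0}. c ^ (q - 1 - j + i)) = (if i = j then -1 else 0)" if i: "i \<le> k" for i
  proof -
    have c1: "c ^ (q - 1) = 1" if "c \<in> Fq - {0}" for c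
    proof -
      have "c * c ^ (q - 1) = c * 1"
        using Fq_pow[of c] that q_ge by (simp flip: power_Suc)
      then show ?thesis using that by simp
    qed
    consider "i = j" | "i < j" | "j < i" by linarith
    then show ?thesis
    proof cases
      case 1
      then have "q - 1 - j + i = q - 1" using j k by simp
      then have "(\<Sum>c\<in>Fq - {0}. c ^ (q - 1 - j + i)) = (\<Sum>c\<in>Fq - {0}. 1)"
        by (intro sum.cong refl) (simp only: c1)
      also have "\<dots> = of_nat (q - 1)"
        using Fq_0 finite_Fq card_Fq by simp
      finally show ?thesis using 1 of_nat_q_minus_1 by simp
    next
      case 2
      then show ?thesis using j k by (subst power_sum_Fq) auto
    next
      case 3
      then have "q - 1 - j + i = (q - 1) + (i - j)" using i k by simp
      then have "(\<Sum>c\<in>Fq - {0}. c ^ (q - 1 - j + i)) = (\<Sum>c\<in>Fq - {0}. c ^ (i - j))"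
        by (intro sum.cong refl) (simp only: power_add c1 mult_1)
      also have "\<dots> = 0"
        using 3 i k q_ge by (intro power_sum_Fq) auto
      finally show ?thesis using 3 by simp
    qed
  qed
  define g :: "'a \<Rightarrow> 'a^2^2" where "g c = vector [vector [1, 0], vector [c, 1]]" for c
  \<comment> \<open>The weight is -c^(-j), with c^(q-1) = 1 used to keep the exponent natural. The
    sign compensates for the sum -1 at i = j.\<close>
  define s where "s = (\<Sum>c\<in>Fq - {0}. sym_scale (- (c ^ (q - 1 - j))) (sym_act (xy_monomial k 0) (g c)))"
  have sum: "(\<Sum>c\<in>S. h c) \<in> W" if "\<And>c. c \<in> S \<Longrightarrow> h c \<in> W" for S :: "'a set" and h
    using that by (induction S rule: infinite_finite_induct) (auto intro: WD(2,3))
  have "g c \<in> carrier G" if "c \<in> Fq" for c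
    using that by (simp add: G_iff g_def Fq_0 Fq_1)
  then have "s \<in> W"
    unfolding s_def by (intro sum WD(4,5) yk) simp_all
  moreover have "s = sym_scale (of_nat (k choose j)) (xy_monomial k j)"
  proof (rule Sym_eqI[of _ k])
    show "s \<in> Sym k" using WD(1) \<open>s \<in> W\<close> by blast
    show "sym_scale (of_nat (k choose j)) (xy_monomial k j) \<in> Sym k" by (intro Sym_scale xy_monomial_Sym)
    fix v :: "'a^2"
    have "(g c *v v) $ 2 = c * v$1 + v$2" for c
      by (simp add: g_def matrix_vector_mult_def sum_2)
    then have "sev s v = (\<Sum>c\<in>Fq - {0}. - (c ^ (q - 1 - j)) * (c * v$1 + v$2) ^ k)"
      by (simp add: s_def sev_xy_monomial)
    also have "\<dots> = (\<Sum>c\<in>Fq - {0}. \<Sum>i\<le>k. - (of_nat (k choose i) * v$1 ^ i * v$2 ^ (k - i)) * c ^ (q - 1 - j + i))"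
      unfolding binomial_ring sum_distrib_left
      by (intro sum.cong refl) (simp add: power_mult_distrib power_add mult_ac)
    also have "\<dots> = (\<Sum>i\<le>k. - (of_nat (k choose i) * v$1 ^ i * v$2 ^ (k - i)) * (\<Sum>c\<in>Fq - {0}. c ^ (q - 1 - j + i)))"
      unfolding sum_distrib_left by (rule sum.swap)
    also have "\<dots> = (\<Sum>i\<le>k. if i = j then of_nat (k choose i) * v$1 ^ i * v$2 ^ (k - i) else 0)"
      by (intro sum.cong refl) (simp only: power_sum atMost_iff, simp)
    also have "\<dots> = sev (sym_scale (of_nat (k choose j)) (xy_monomial k j)) v"
      using j by (simp add: sev_xy_monomial mult.assoc)
    finally show "sev s v = sev (sym_scale (of_nat (k choose j)) (xy_monomial k j)) v" .
  qed
  ultimately show ?thesis by simp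
qed

text \<open>For k < p no binomial coefficient k choose j is divisible by p, as it divides k!. The
  scalars in front of the extracted monomials can therefore be inverted, and W contains all
  monomials of degree k.\<close>

lemma submodule_Sym_trivial:
  fixes W :: "('a, 2) sym_algebra set"
  assumes "q = p" and W: "FG_submodule G (Sym_power k) W" and nz: "W \<noteq> {0}" and k: "k \<le> q - 2"
  shows "W = Sym k"
proof (intro equalityI subsetI)
  note WD = FG_submoduleD[OF right_FG_module_Sym W, unfolded Sym_power_sel]
  have kq: "k < q" using k q_ge by linarith
  show "w \<in> Sym k" if "w \<in> W" for w using WD(1) that .
  have mono: "xy_monomial k j \<in> W" if j: "j \<le> k" for j
  proof -
    have "\<not> p dvd k choose j"
    proof
      assume "p dvd k choose j"
      then have "p dvd fact j * fact (k - j) * (k choose j)" by simp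
      then have "p dvd fact k" using binomial_fact_lemma[OF j] by simp
      then show False using prime_p kq \<open>q = p\<close> by (simp add: prime_dvd_fact_iff)
    qed
    then have bnz: "of_nat (k choose j) \<noteq> (0 :: 'a)"
      by (simp add: of_nat_eq_0_iff_char_dvd char)
    interpret vector_space "sym_scale :: 'a \<Rightarrow> ('a, 2) sym_algebra \<Rightarrow> _"
      by (rule vector_space_sym_scale)
    have "xy_monomial k j = sym_scale (inverse (of_nat (k choose j))) (sym_scale (of_nat (k choose j)) (xy_monomial k j))"
      using bnz by simp
    also have "\<dots> \<in> W"
      by (rule WD(4)[OF submodule_contains_binomial_monomial[OF W submodule_contains_yk[OF W nz kq] k j]])
    finally show ?thesis .
  qed
  fix w :: "('a, 2) sym_algebra" assume w: "w \<in> Sym k"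
  define s where "s = (\<Sum>j\<le>k. sym_scale (coeff (upoly w) j) (xy_monomial k j))"
  have sum: "(\<Sum>j\<in>S. h j) \<in> W" if "\<And>j. j \<in> S \<Longrightarrow> h j \<in> W" for S :: "nat set" and h
    using that by (induction S rule: infinite_finite_induct) (auto intro: WD(2,3))
  have "s \<in> W"
    unfolding s_def by (intro sum WD(4) mono) simp
  moreover have "s = w"
  proof (rule upoly_inject[OF _ w])
    show "s \<in> Sym k" using WD(1) \<open>s \<in> W\<close> by blast
    have "upoly w = (\<Sum>j\<le>k. monom (coeff (upoly w) j) j)"
      by (rule poly_as_sum_of_monoms'[OF degree_upoly[OF w], symmetric])
    moreover have "poly (upoly s) x = poly (\<Sum>j\<le>k. monom (coeff (upoly w) j) j) x" for x
      by (simp add: poly_upoly s_def sev_xy_monomial poly_sum poly_monom)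
    then have "upoly s = (\<Sum>j\<le>k. monom (coeff (upoly w) j) j)"
      by (intro poly_eqI_outside_Fq) simp
    ultimately show "upoly s = upoly w" by simp
  qed
  ultimately show "w \<in> W" by simp
qed


section \<open>Semisimplicity of the direct sum\<close>

lemma right_FG_module_V_sum: "right_FG_module G V_sum"
  by (rule right_FG_module_direct_sum[OF right_FG_module_Sym])

lemma projection_submodule:
  assumes S: "FG_submodule G V_sum S" and k: "k \<le> q - 2"
  shows "FG_submodule G (Sym_power k) ((\<lambda>u. u k) ` S)"
proof (rule FG_submoduleI[OF right_FG_module_Sym])
  note SD = FG_submoduleD[OF right_FG_module_V_sum S]
  show "w \<in> Sym k" if "w \<in> (\<lambda>u. u k) ` S" for w
    using that SD(1) k by (auto simp: V_sum_carrier)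
  show "0 \<in> (\<lambda>u. u k) ` S"
    using SD(2) by (rule rev_image_eqI) simp
  show "x + y \<in> (\<lambda>u. u k) ` S" if "x \<in> (\<lambda>u. u k) ` S" "y \<in> (\<lambda>u. u k) ` S" for x y
  proof -
    obtain u v where "u \<in> S" "x = u k" "v \<in> S" "y = v k"
      using \<open>x \<in> (\<lambda>u. u k) ` S\<close> \<open>y \<in> (\<lambda>u. u k) ` S\<close> by (elim imageE)
    then show ?thesis by (intro rev_image_eqI[OF SD(3)[of u v]]) simp_all
  qed
  show "scale (Sym_power k) c x \<in> (\<lambda>u. u k) ` S" if "x \<in> (\<lambda>u. u k) ` S" for c x
  proof -
    obtain u where "u \<in> S" "x = u k" using \<open>x \<in> (\<lambda>u. u k) ` S\<close> by (elim imageE)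
    then show ?thesis by (intro rev_image_eqI[OF SD(4)[of u c]]) (simp_all add: V_sum_sel)
  qed
  show "act (Sym_power k) x g \<in> (\<lambda>u. u k) ` S" if g: "g \<in> carrier G" and x: "x \<in> (\<lambda>u. u k) ` S" for g x
  proof -
    obtain u where "u \<in> S" "x = u k" using x by (elim imageE)
    then show ?thesis using k by (intro rev_image_eqI[OF SD(5)[OF g, of u]]) (simp_all add: V_sum_sel)
  qed
qed

definition summand :: "nat \<Rightarrow> (nat \<Rightarrow> ('a, 2) sym_algebra) set" where
  "summand k = {u \<in> carrier V_sum. \<forall>i. i \<noteq> k \<longrightarrow> u i = 0}"

text \<open>Elements supported at k are determined by their k-th component, so a nonzero submodule
  of the summand is recovered from its projection, which must be all of V^k.\<close>

lemma summand_simple: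
  assumes "q = p" and k: "k \<le> q - 2"
  shows "simple_FG_submodule G V_sum (summand k)"
  unfolding simple_FG_submodule_def
proof (intro conjI allI impI)
  note VS = right_FG_module_sub[OF right_FG_module_V_sum] and VD = right_FG_moduleD[OF right_FG_module_V_sum]
  have act0: "sym_act 0 g = (0 :: ('a, 2) sym_algebra)" for g
    by (simp add: sym_act_def)
  have scale0: "sym_scale c 0 = (0 :: ('a, 2) sym_algebra)" for c
    by (simp add: sym_scale_def)
  show "FG_submodule G V_sum (summand k)"
  proof (rule FG_submoduleI[OF right_FG_module_V_sum])
    show "x + y \<in> summand k" if "x \<in> summand k" "y \<in> summand k" for x y
      using that VS(2)[of x y] by (simp add: summand_def)
    show "scale V_sum c x \<in> summand k" if "x \<in> summand k" for c x
      using that VS(3)[of x c] by (simp add: summand_def V_sum_sel scale0)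
    show "act V_sum x g \<in> summand k" if "g \<in> carrier G" "x \<in> summand k" for g x
      using that VD(4)[of g x] by (simp add: summand_def V_sum_sel act0)
  qed (use VS(1) in \<open>simp_all add: summand_def\<close>)
  let ?e = "\<lambda>i. if i = k then xy_monomial k 0 else 0"
  have "?e \<in> summand k"
    using k by (simp add: summand_def V_sum_carrier xy_monomial_Sym Sym_0)
  moreover have "?e \<noteq> 0"
    using xy_monomial_nonzero[of 0 k] by (auto simp: fun_eq_iff)
  ultimately show "summand k \<noteq> {0}" by blast
  fix U assume U: "FG_submodule G V_sum U \<and> U \<subseteq> summand k"
  note UD = FG_submoduleD[OF right_FG_module_V_sum conjunct1[OF U]]
  show "U = {0} \<or> U = summand k"
  proof (cases "U = {0}")
    case False
    then obtain u where u: "u \<in> U" "u \<noteq> 0" using UD(2) by blast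
    have "u k \<noteq> 0"
    proof
      assume "u k = 0"
      then have "u i = 0" for i using u(1) U by (cases "i = k") (auto simp: summand_def)
      then show False using u(2) by (simp add: fun_eq_iff)
    qed
    then have "(\<lambda>u. u k) ` U \<noteq> {0}" using u(1) by blast
    then have eq: "(\<lambda>u. u k) ` U = Sym k"
      using submodule_Sym_trivial[OF \<open>q = p\<close> projection_submodule[OF conjunct1[OF U] k] _ k] by simp
    have "summand k \<subseteq> U"
    proof
      fix v assume v: "v \<in> summand k"
      then have "v k \<in> Sym k" using k by (simp add: summand_def V_sum_carrier)
      then obtain w where w: "w \<in> U" "v k = w k" using eq by blast
      then have "w \<in> summand k" using U by blast
      then have "v i = w i" for i
        using v w(2) by (cases "i = k") (simp_all add: summand_def)
      then have "v = w" by (rule ext)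
      then show "v \<in> U" using w(1) by simp
    qed
    then show ?thesis using U by blast
  qed simp
qed

lemma semisimple_V_sum:
  assumes "q = p"
  shows "FG_semisimple G V_sum"
  unfolding FG_semisimple_iff[OF right_FG_module_V_sum]
proof
  interpret vector_space "scale V_sum" by (rule right_FG_moduleD(2)[OF right_FG_module_V_sum])
  fix u assume u: "u \<in> carrier V_sum"
  let ?e = "\<lambda>k i. if i = k then u k else 0"
  have "u = (\<Sum>k\<le>q - 2. ?e k)"
  proof
    fix i
    have "(\<Sum>k\<in>S. ?e k) i = (\<Sum>k\<in>S. ?e k i)" for S
      by (induction S rule: infinite_finite_induct) simp_all
    then have "(\<Sum>k\<le>q - 2. ?e k) i = (\<Sum>k\<le>q - 2. ?e k i)" .
    also have "\<dots> = u i"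
      using u by (simp add: sum.delta' V_sum_carrier)
    finally show "u i = (\<Sum>k\<le>q - 2. ?e k) i" by simp
  qed
  moreover have "?e k \<in> span (\<Union>{W. simple_FG_submodule G V_sum W})" if k: "k \<le> q - 2" for k
  proof (rule span_base)
    have "?e k \<in> summand k" using u k by (auto simp: summand_def V_sum_carrier Sym_0)
    then show "?e k \<in> \<Union>{W. simple_FG_submodule G V_sum W}"
      using summand_simple[OF assms k] by blast
  qed
  then have "(\<Sum>k\<le>q - 2. ?e k) \<in> span (\<Union>{W. simple_FG_submodule G V_sum W})"
    by (intro span_sum) simp
  ultimately show "u \<in> span (\<Union>{W. simple_FG_submodule G V_sum W})" by simp
qed

text \<open>The \<open>p\<close>-th powers of linear forms span a proper submodule of \<open>V\<^sup>p\<close>, which contains its socle.\<close>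

definition frob_sub :: "('a, 2) sym_algebra set" where
  "frob_sub = {w \<in> Sym p. \<exists>a b. \<forall>v. sev w v = a * v$1 ^ p + b * v$2 ^ p}"

lemma frob_sub_submodule: "FG_submodule G (Sym_power p) frob_sub"
proof (rule FG_submoduleI[OF right_FG_module_Sym])
  show "0 \<in> frob_sub"
    unfolding frob_sub_def by (auto intro: Sym_0 exI[of _ 0])
  show "x + y \<in> frob_sub" if "x \<in> frob_sub" "y \<in> frob_sub" for x y
  proof -
    obtain a b c d where "x \<in> Sym p" "y \<in> Sym p" "\<And>v. sev x v = a * v$1 ^ p + b * v$2 ^ p"
      "\<And>v. sev y v = c * v$1 ^ p + d * v$2 ^ p"
      using \<open>x \<in> frob_sub\<close> \<open>y \<in> frob_sub\<close> unfolding frob_sub_def by auto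
    then have "x + y \<in> Sym p" "\<And>v. sev (x + y) v = (a + c) * v$1 ^ p + (b + d) * v$2 ^ p"
      by (simp_all add: Sym_add algebra_simps)
    then show ?thesis unfolding frob_sub_def by blast
  qed
  show "scale (Sym_power p) c x \<in> frob_sub" if "x \<in> frob_sub" for c x
  proof -
    obtain a b where "x \<in> Sym p" "\<And>v. sev x v = a * v$1 ^ p + b * v$2 ^ p"
      using \<open>x \<in> frob_sub\<close> unfolding frob_sub_def by auto
    then have "sym_scale c x \<in> Sym p" "\<And>v. sev (sym_scale c x) v = (c * a) * v$1 ^ p + (c * b) * v$2 ^ p"
      by (simp_all add: Sym_scale algebra_simps)
    then show ?thesis unfolding frob_sub_def Sym_power_sel by blast
  qed
  show "act (Sym_power p) x g \<in> frob_sub" if "x \<in> frob_sub" for g x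
  proof -
    obtain a b where "x \<in> Sym p" "\<And>v. sev x v = a * v$1 ^ p + b * v$2 ^ p"
      using \<open>x \<in> frob_sub\<close> unfolding frob_sub_def by auto
    moreover have "(c + d :: 'a) ^ p = c ^ p + d ^ p" for c d
      by (rule freshmans_dream) (simp_all add: char prime_p)
    ultimately have "sym_act x g \<in> Sym p" "\<And>v. sev (sym_act x g) v =
        (a * (g$1$1) ^ p + b * (g$2$1) ^ p) * v$1 ^ p + (a * (g$1$2) ^ p + b * (g$2$2) ^ p) * v$2 ^ p"
      by (simp_all add: Sym_act matrix_vector_mult_def sum_2 power_mult_distrib algebra_simps)
    then show ?thesis unfolding frob_sub_def Sym_power_sel by blast
  qed
qed (simp add: frob_sub_def)

text \<open>Let T consist of the elements whose p-th component lies in \<open>frob_sub\<close>. A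
  simple submodule outside T would meet T in 0 and project to a nonzero submodule of V^p. That
  projection contains y^p, which lies in \<open>frob_sub\<close>, and so produces a nonzero common
  element. Hence T contains the span of all simple submodules, yet it is proper.\<close>

lemma not_semisimple_V_sum:
  assumes "q \<noteq> p"
  shows "\<not> FG_semisimple G V_sum"
proof
  assume ss: "FG_semisimple G V_sum"
  have p2: "p \<ge> 2" using prime_p by (rule prime_ge_2_nat)
  have "r \<noteq> 1" using assms by (auto simp: q_eq)
  \<comment> \<open>From q \<ge> p^2 \<ge> 2p follows p \<le> q - 2, so V^p does occur in the
    sum.\<close>
  then have "p ^ 2 \<le> q"
    unfolding q_eq using r_ge p2 by (intro power_increasing) auto
  moreover have "2 * p \<le> p ^ 2" using p2 by (simp add: power2_eq_square)
  ultimately have "2 * p \<le> q" by linarith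
  then have pk: "p \<le> q - 2" and pq: "p < q" using p2 by linarith+
  note VS = right_FG_module_sub[OF right_FG_module_V_sum] and VD = right_FG_moduleD[OF right_FG_module_V_sum]
  note LD = FG_submoduleD[OF right_FG_module_Sym frob_sub_submodule, unfolded Sym_power_sel]
  let ?T = "{u \<in> carrier V_sum. u p \<in> frob_sub}"
  have T: "FG_submodule G V_sum ?T"
  proof (rule FG_submoduleI[OF right_FG_module_V_sum])
    show "0 \<in> ?T" using VS(1) LD(2) by simp
    show "x + y \<in> ?T" if "x \<in> ?T" "y \<in> ?T" for x y
      using that VS(2)[of x y] LD(3) by simp
    show "scale V_sum c x \<in> ?T" if "x \<in> ?T" for c x
      using that VS(3)[of x c] LD(4) by (simp add: V_sum_sel)
    show "act V_sum x g \<in> ?T" if "g \<in> carrier G" "x \<in> ?T" for g x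
      using that VD(4)[of g x] LD(5)[of g] pk by (simp add: V_sum_sel)
  qed simp
  note TD = FG_submoduleD[OF right_FG_module_V_sum T]
  have simple: "S \<subseteq> ?T" if S: "simple_FG_submodule G V_sum S" for S
  proof (rule ccontr)
    assume not: "\<not> S \<subseteq> ?T"
    have sub: "FG_submodule G V_sum S"
      and min: "\<And>U. FG_submodule G V_sum U \<Longrightarrow> U \<subseteq> S \<Longrightarrow> U = {0} \<or> U = S"
      using S unfolding simple_FG_submodule_def by blast+
    note SD = FG_submoduleD[OF right_FG_module_V_sum sub]
    have "FG_submodule G V_sum (S \<inter> ?T)"
    proof (rule FG_submoduleI[OF right_FG_module_V_sum])
      show "x + y \<in> S \<inter> ?T" if "x \<in> S \<inter> ?T" "y \<in> S \<inter> ?T" for x y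
        using SD(3)[of x y] TD(3)[of x y] that by (simp only: Int_iff simp_thms)
      show "scale V_sum c x \<in> S \<inter> ?T" if "x \<in> S \<inter> ?T" for c x
        using SD(4)[of x c] TD(4)[of x c] that by (simp only: Int_iff simp_thms)
      show "act V_sum x g \<in> S \<inter> ?T" if "g \<in> carrier G" "x \<in> S \<inter> ?T" for g x
        using SD(5)[of g x] TD(5)[of g x] that by (simp only: Int_iff simp_thms)
    qed (use SD(1,2) TD(2) in simp_all)
    from min[OF this] not have zero: "S \<inter> ?T = {0}" by blast
    obtain u where u: "u \<in> S" "u \<notin> ?T" using not by blast
    then have "u p \<noteq> 0" using SD(1)[OF u(1)] LD(2) by auto
    then have "(\<lambda>u. u p) ` S \<noteq> {0}" using u(1) by blast
    then have "xy_monomial p 0 \<in> (\<lambda>u. u p) ` S"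
      using submodule_contains_yk[OF projection_submodule[OF sub pk] _ pq] by simp
    then obtain w where w: "w \<in> S" "w p = xy_monomial p 0" by auto
    have "xy_monomial p 0 \<in> frob_sub"
      unfolding frob_sub_def
      by (intro CollectI conjI xy_monomial_Sym exI[of _ 0] exI[of _ 1]) (simp add: sev_xy_monomial)
    then have "w \<in> S \<inter> ?T" using w SD(1)[OF w(1)] by simp
    then have "w p = 0" using zero by simp
    then show False using w(2) xy_monomial_nonzero[of 0 p] by simp
  qed
  have "Modules.module.span (scale V_sum) (\<Union>{W. simple_FG_submodule G V_sum W}) \<subseteq> ?T"
  proof (rule span_least[OF VD(2)])
    show "Modules.module.subspace (scale V_sum) ?T"
      using T unfolding FG_submodule_def by (elim conjE)
    show "\<Union>{W. simple_FG_submodule G V_sum W} \<subseteq> ?T" using simple by blast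
  qed
  then have all: "carrier V_sum \<subseteq> ?T"
    using ss unfolding FG_semisimple_iff[OF right_FG_module_V_sum] by (rule order.trans[rotated])
  \<comment> \<open>The monomial x y^(p-1) lies outside T: at y = 1 it would make X equal to a X^p +
    b, which fails in the coefficient of X because p \<ge> 2.\<close>
  let ?e = "\<lambda>i. if i = p then xy_monomial p 1 else 0"
  have "?e \<in> carrier V_sum" using pk by (simp add: V_sum_carrier xy_monomial_Sym Sym_0)
  then have "?e \<in> ?T" using all by (rule subsetD[rotated])
  then obtain a b where ab: "\<And>v. sev (xy_monomial p 1) v = a * v$1 ^ p + b * v$2 ^ p"
    by (auto simp: frob_sub_def)
  have "monom 1 1 = monom a p + [:b:]"
  proof (rule poly_eqI_outside_Fq)
    fix x :: 'a
    show "poly (monom 1 1) x = poly (monom a p + [:b:]) x"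
      using ab[of "vector [x, 1]"] p2 by (simp add: sev_xy_monomial poly_monom)
  qed
  then have "coeff (monom (1::'a) 1) 1 = coeff (monom a p + [:b:]) 1" by simp
  then show False using p2 by simp
qed

end

theorem theorem2p1:
  fixes p r q :: nat
    and Fq :: "'a::alg_closed_field set"
  assumes "prime p" and "r \<ge> 1" and "q = p ^ r"
    and "CHAR('a) = p"
    and "subfield Fq (ring_of_type_algebra :: 'a ring)" and "card Fq = q"
  shows "FG_isomorphic (SL2 Fq) (H0_drinfeld q :: ('a, 'a diff_form, 'a^2^2) fg_module)
           (FG_direct_sum {0..q - 2} Sym_power) \<and>
         (\<forall>k\<in>{0..q - 2}. FG_indecomposable (SL2 Fq)
           (Sym_power k :: ('a, ('a, 2) sym_algebra, 'a^2^2) fg_module)) \<and>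
         (FG_semisimple (SL2 Fq) (H0_drinfeld q :: ('a, 'a diff_form, 'a^2^2) fg_module) \<longleftrightarrow> q = p)"
proof -
  interpret drinfeld p r q Fq
    using assms by (simp add: drinfeld_def)
  show ?thesis
    using H0_isomorphic indecomposable_Sym FG_semisimple_cong[OF H0_isomorphic]
      semisimple_V_sum not_semisimple_V_sum by auto
qed

end
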